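(* Let $Q$ be a smooth manifold, $L:TQ\to\mathbb R$ a smooth Lagrangian, $\mathfrak g$ a finite-dimensional real Lie algebra, and $\psi:\mathfrak g\to A^1(Q)$, $X\mapsto X_Q$, a locally transitive action of $\mathfrak g$ on $Q$. With $\varphi$, $\overline L$, $\mathrm d_Q\overline L$, $\mathrm d_{\mathfrak g}\overline L$, $\Omega$, $\mathcal L$, $J$ and $\mathrm{ad}^*$ as defined in the context, one has $$\mathrm d_{\mathfrak g}\overline L=J\circ\mathcal L\circ\varphi .$$ Let moreover $\gamma:[t_0,t_1]\to Q$ be a continuous, piecewise smooth parametrized curve and let $V:[t_0,t_1]\to\mathfrak g$ be a piecewise continuous and smooth parametrized curve satisfying the compatibility condition $$\frac{\mathrm d\gamma(t)}{\mathrm dt}=\varphi\bigl(\gamma(t),V(t)\bigr)$$ for each $t\in[t_0,t_1]$ at which $\gamma$ is smooth. Then $\gamma$ is an extremal of the action functional $I_L(\gamma)=\int_{t_0}^{t_1}L\left(\frac{\mathrm d\gamma(t)}{\mathrm dt}\right)\mathrm dt$, for variations with fixed endpoints, if and only if the Euler–Poincaré equation $$\left(\frac{\mathrm d}{\mathrm dt}-\mathrm{ad}^*_{V(t)}\right)\Bigl(\mathrm d_{\mathfrak g}\overline L\bigl(\gamma(t),V(t)\bigr)\Bigr)=\Omega\bigl(\gamma(t),V(t)\bigr),\qquad \Omega=J\circ\mathrm d_Q\overline L,$$ is satisfied. This equation can equivalently be written under the form $$\left(\frac{\mathrm d}{\mathrm dt}-\mathrm{ad}^*_{V(t)}\right)\Bigl(J\circ\mathcal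 L\circ\varphi\bigl(\gamma(t),V(t)\bigr)\Bigr)=J\circ \mathrm d_Q\overline L\bigl(\gamma(t),V(t)\bigr).$$
   Context: $A^1(Q)$ is the Lie algebra of smooth vector fields on $Q$. An action of $\mathfrak g$ on $Q$ is a smooth Lie algebra homomorphism $\psi:\mathfrak g\to A^1(Q)$; $X_Q=\psi(X)$ is the fundamental vector field associated to $X\in\mathfrak g$. The action is locally transitive if for each $x\in Q$ the set of values $X_Q(x)$, for all $X\in\mathfrak g$, is the whole tangent space $T_xQ$; in other words, the vector bundle homomorphism $\varphi:Q\times\mathfrak g\to TQ$, $\varphi(x,X)=X_Q(x)$, is surjective (it need not be injective). Its transpose is $\varphi^T:T^*Q\to Q\times\mathfrak g^*$, and $p_{\mathfrak g^*}:Q\times\mathfrak g^*\to\mathfrak g^*$ is the projection on the second factor. $\overline L=L\circ\varphi:Q\times\mathfrak g\to\mathbb R$. Its partial differentials with respect to its first and second variables are $\mathrm d_Q\overline L:Q\times\mathfrak g\to T^*Q$ and $\mathrm d_{\mathfrak g}\overline L:Q\times\mathfrak g\to\mathfrak g^*$. One sets $\Omega=p_{\mathfrak g^*}\circ\varphi^T\circ\mathrm d_Q\overline L:Q\times\mathfrak g\to\mathfrak g^*$. The Legendre map $\mathcal L:TQ\to T^*Q$ is the vertical differential of $L$: for $v\in T_xQ$, $\mathcal L(v)\in T_x^*Q$ is the differential at $v$ of the restriction of $L$ to $T_xQ$. The momentum map $J:T^*Q\to\mathfrak g^*$ is defined by $\langle J(\xi),X\rangle=\langle\xi,X_Q(\pi_Q(\xi))\rangle$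 for $\xi\in T^*Q$, $X\in\mathfrak g$, where $\pi_Q:T^*Q\to Q$ is the canonical projection; equivalently $J=p_{\mathfrak g^*}\circ\varphi^T$. For $V\in\mathfrak g$, $\mathrm{ad}_V(X)=[V,X]$, and $\mathrm{ad}^*_V:\mathfrak g^*\to\mathfrak g^*$ is its transpose: $\langle\mathrm{ad}^*_V\xi,X\rangle=\langle\xi,\mathrm{ad}_VX\rangle$. A variation with fixed endpoints of $\gamma$ is a continuous and piecewise smooth map $(t,s)\mapsto\gamma_s(t)$ from $[t_0,t_1]\times[-\varepsilon,\varepsilon]$ to $Q$ such that $\gamma_0(t)=\gamma(t)$ for each $t\in[t_0,t_1]$, and $\gamma_s(t_0)=\gamma(t_0)$, $\gamma_s(t_1)=\gamma(t_1)$ for each $s\in[-\varepsilon,\varepsilon]$. The curve $\gamma$ is an extremal of $I_L$ if $\frac{\mathrm d I_L(\gamma_s)}{\mathrm ds}\big|_{s=0}=0$ for every such variation.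
   Formalization: The Euler–Poincaré equation is required at each t where γ is smooth and, in addition, d_g L̄(γ(t),V(t)) must have equal left and right limits at corners of γ; without this the "if" direction fails (L = v²/2 on ℝ, γ(t) = |t|). *)

theory Defs
  imports "HOL-Analysis.Analysis"
begin

section \<open>Smooth maps between normed spaces\<close>

text \<open>Meant for open \<open>U\<close> and finite-dimensional source, where it is the usual class \<open>C\<^sup>k\<close>.\<close>

primrec Ck_on :: "nat \<Rightarrow> ('a::real_normed_vector \<Rightarrow> 'b::real_normed_vector) \<Rightarrow> 'a set \<Rightarrow> bool" where
  "Ck_on 0 f U \<longleftrightarrow> continuous_on U f"
| "Ck_on (Suc k) f U \<longleftrightarrow> (\<forall>x\<in>U. f differentiable (at x)) \<and>
     (\<forall>v. Ck_on k (\<lambda>x. frechet_derivative f (at x) v) U)"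

text \<open>On an arbitrary set \<open>S\<close> (closed intervals and rectangles are needed), smoothness means
  the existence of local smooth extensions; for open \<open>S\<close> this is plain \<open>C\<^sup>\<infinity>\<close>.\<close>

definition smooth_on :: "'a::real_normed_vector set \<Rightarrow> ('a \<Rightarrow> 'b::real_normed_vector) \<Rightarrow> bool" where
  "smooth_on S f \<longleftrightarrow>
     (\<forall>x\<in>S. \<exists>U g. open U \<and> x \<in> U \<and> (\<forall>k. Ck_on k g U) \<and> (\<forall>y\<in>S \<inter> U. f y = g y))"

section \<open>Smooth manifolds\<close>

type_synonym ('q, 'e) chart = "'q set \<times> ('q \<Rightarrow> 'e)"

abbreviation cdom :: "('q, 'e) chart \<Rightarrow> 'q set" where
  "cdom c \<equiv> fst c"

abbreviation cmap :: "('q, 'e) chart \<Rightarrow> 'q \<Rightarrow> 'e" where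
  "cmap c \<equiv> snd c"

definition cinv :: "('q, 'e) chart \<Rightarrow> 'e \<Rightarrow> 'q" where
  "cinv c = inv_into (cdom c) (cmap c)"

definition smooth_manifold ::
    "('q::{t2_space,second_countable_topology}, 'e::euclidean_space) chart set \<Rightarrow> bool" where
  "smooth_manifold A \<longleftrightarrow>
     (\<forall>c\<in>A. open (cdom c) \<and> open (cmap c ` cdom c) \<and>
        homeomorphism (cdom c) (cmap c ` cdom c) (cmap c) (cinv c)) \<and>
     (\<Union>c\<in>A. cdom c) = UNIV \<and>
     (\<forall>c\<in>A. \<forall>d\<in>A. smooth_on (cmap c ` (cdom c \<inter> cdom d)) (cmap d \<circ> cinv c))"

definition smooth_map_on ::
    "('q::topological_space, 'e::real_normed_vector) chart set \<Rightarrow> 'a::real_normed_vector set \<Rightarrow> ('a \<Rightarrow> 'q) \<Rightarrow> bool" where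
  "smooth_map_on A S F \<longleftrightarrow> continuous_on S F \<and>
     (\<forall>c\<in>A. smooth_on (S \<inter> F -` cdom c) (cmap c \<circ> F))"

section \<open>Tangent and cotangent bundle\<close>

text \<open>A chart \<open>chart_at A x\<close> is selected around each point \<open>x\<close>, and \<open>T\<^sub>xQ\<close> is identified with the
  model space \<open>'e\<close> by means of this chart.  A tangent vector is thus a pair \<open>(x, v)\<close>, a covector
  a pair \<open>(x, \<xi>)\<close> with \<open>\<xi>\<close> in the dual of \<open>'e\<close>.  As \<open>chart_at A x\<close> need not depend continuously
  on \<open>x\<close>, smoothness along the bundle is always tested after passing to one fixed chart \<open>c\<close>, with
  the two mutually inverse coordinate changes \<open>tcoord\<close> and \<open>tvec\<close>.\<close>

definition chart_at :: "('q, 'e) chart set \<Rightarrow> 'q \<Rightarrow> ('q, 'e) chart" where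
  "chart_at A x = (SOME c. c \<in> A \<and> x \<in> cdom c)"

definition pcoord :: "('q, 'e) chart set \<Rightarrow> 'q \<Rightarrow> 'e" where
  "pcoord A x = cmap (chart_at A x) x"

type_synonym ('q, 'e) tangent = "'q \<times> 'e"
type_synonym ('q, 'e) cotangent = "'q \<times> ('e \<Rightarrow>\<^sub>L real)"

text \<open>Components in the chart \<open>c\<close> of \<open>v \<in> T\<^sub>xQ\<close>.\<close>

definition tcoord :: "('q, 'e::real_normed_vector) chart set \<Rightarrow> ('q, 'e) chart \<Rightarrow> 'q \<Rightarrow> 'e \<Rightarrow> 'e" where
  "tcoord A c x v = frechet_derivative (cmap c \<circ> cinv (chart_at A x)) (at (pcoord A x)) v"

text \<open>The vector of \<open>T\<^sub>xQ\<close> with components \<open>w\<close> in the chart \<open>c\<close>.\<close>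

definition tvec :: "('q, 'e::real_normed_vector) chart set \<Rightarrow> ('q, 'e) chart \<Rightarrow> 'q \<Rightarrow> 'e \<Rightarrow> 'e" where
  "tvec A c x w = frechet_derivative (cmap (chart_at A x) \<circ> cinv c) (at (cmap c x)) w"

definition smooth_on_TQ ::
    "('q, 'e::real_normed_vector) chart set \<Rightarrow> (('q, 'e) tangent \<Rightarrow> real) \<Rightarrow> bool" where
  "smooth_on_TQ A L \<longleftrightarrow> (\<forall>c\<in>A. smooth_on ((cmap c ` cdom c) \<times> UNIV)
     (\<lambda>(u, w). L (cinv c u, tvec A c (cinv c u) w)))"

text \<open>Differential at \<open>x\<close> of a function on \<open>Q\<close>.\<close>

definition differential ::
    "('q, 'e::real_normed_vector) chart set \<Rightarrow> ('q \<Rightarrow> real) \<Rightarrow> 'q \<Rightarrow> 'e \<Rightarrow>\<^sub>L real" where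
  "differential A f x = Blinfun (frechet_derivative (f \<circ> cinv (chart_at A x)) (at (pcoord A x)))"

section \<open>Vector fields and Lie algebra actions\<close>

text \<open>Local expression of a vector field in the chart \<open>c\<close>.\<close>

definition vf_rep ::
    "('q, 'e::real_normed_vector) chart set \<Rightarrow> ('q, 'e) chart \<Rightarrow> ('q \<Rightarrow> 'e) \<Rightarrow> 'e \<Rightarrow> 'e" where
  "vf_rep A c X u = tcoord A c (cinv c u) (X (cinv c u))"

definition smooth_vector_field :: "('q, 'e::real_normed_vector) chart set \<Rightarrow> ('q \<Rightarrow> 'e) \<Rightarrow> bool" where
  "smooth_vector_field A X \<longleftrightarrow> (\<forall>c\<in>A. smooth_on (cmap c ` cdom c) (vf_rep A c X))"

text \<open>In local coordinates \<open>[X,Y]\<^sup>i = X\<^sup>j \<partial>\<^sub>jY\<^sup>i - Y\<^sup>j \<partial>\<^sub>jX\<^sup>i\<close>, so that \<open>[X,Y]f = X(Yf) - Y(Xf)\<close>.\<close>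

definition vf_bracket ::
    "('q, 'e::real_normed_vector) chart set \<Rightarrow> ('q \<Rightarrow> 'e) \<Rightarrow> ('q \<Rightarrow> 'e) \<Rightarrow> 'q \<Rightarrow> 'e" where
  "vf_bracket A X Y x =
     frechet_derivative (vf_rep A (chart_at A x) Y) (at (pcoord A x)) (X x) -
     frechet_derivative (vf_rep A (chart_at A x) X) (at (pcoord A x)) (Y x)"

definition lie_algebra :: "('g::euclidean_space \<Rightarrow> 'g \<Rightarrow> 'g) \<Rightarrow> bool" where
  "lie_algebra br \<longleftrightarrow> bilinear br \<and> (\<forall>X. br X X = 0) \<and>
     (\<forall>X Y Z. br X (br Y Z) + br Y (br Z X) + br Z (br X Y) = 0)"

text \<open>Smoothness of \<open>\<psi>\<close> is smoothness of each \<open>\<psi> X\<close>: as \<open>\<psi>\<close> is linear and the Lie algebra is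
  finite-dimensional, \<open>(x, X) \<mapsto> \<psi> X x\<close> is then smooth.\<close>

definition lie_algebra_action ::
    "('q, 'e::real_normed_vector) chart set \<Rightarrow> ('g::euclidean_space \<Rightarrow> 'g \<Rightarrow> 'g) \<Rightarrow> ('g \<Rightarrow> 'q \<Rightarrow> 'e) \<Rightarrow> bool" where
  "lie_algebra_action A br \<psi> \<longleftrightarrow>
     (\<forall>X. smooth_vector_field A (\<psi> X)) \<and>
     (\<forall>x. linear (\<lambda>X. \<psi> X x)) \<and>
     (\<forall>X Y. \<psi> (br X Y) = vf_bracket A (\<psi> X) (\<psi> Y))"

definition locally_transitive :: "('g \<Rightarrow> 'q \<Rightarrow> 'e) \<Rightarrow> bool" where
  "locally_transitive \<psi> \<longleftrightarrow> (\<forall>x. range (\<lambda>X. \<psi> X x) = UNIV)"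

definition phi :: "('g \<Rightarrow> 'q \<Rightarrow> 'e) \<Rightarrow> 'q \<times> 'g \<Rightarrow> ('q, 'e) tangent" where
  "phi \<psi> = (\<lambda>(x, X). (x, \<psi> X x))"

definition phi_transpose ::
    "('g::euclidean_space \<Rightarrow> 'q \<Rightarrow> 'e::real_normed_vector) \<Rightarrow> ('q, 'e) cotangent \<Rightarrow> 'q \<times> ('g \<Rightarrow>\<^sub>L real)" where
  "phi_transpose \<psi> = (\<lambda>(x, \<xi>). (x, \<xi> o\<^sub>L Blinfun (\<lambda>X. snd (phi \<psi> (x, X)))))"

definition momentum_map ::
    "('g::euclidean_space \<Rightarrow> 'q \<Rightarrow> 'e::real_normed_vector) \<Rightarrow> ('q, 'e) cotangent \<Rightarrow> 'g \<Rightarrow>\<^sub>L real" where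
  "momentum_map \<psi> = (\<lambda>(x, \<xi>). Blinfun (\<lambda>X. blinfun_apply \<xi> (\<psi> X x)))"

definition ad_star :: "('g::euclidean_space \<Rightarrow> 'g \<Rightarrow> 'g) \<Rightarrow> 'g \<Rightarrow> ('g \<Rightarrow>\<^sub>L real) \<Rightarrow> 'g \<Rightarrow>\<^sub>L real" where
  "ad_star br V \<xi> = \<xi> o\<^sub>L Blinfun (br V)"

section \<open>The Lagrangian\<close>

definition Lbar ::
    "('g \<Rightarrow> 'q \<Rightarrow> 'e) \<Rightarrow> (('q, 'e) tangent \<Rightarrow> real) \<Rightarrow> 'q \<times> 'g \<Rightarrow> real" where
  "Lbar \<psi> L = L \<circ> phi \<psi>"

definition d_Q ::
    "('q, 'e::real_normed_vector) chart set \<Rightarrow> ('q \<times> 'g \<Rightarrow> real) \<Rightarrow> 'q \<times> 'g \<Rightarrow> ('q, 'e) cotangent" where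
  "d_Q A F = (\<lambda>(x, X). (x, differential A (\<lambda>y. F (y, X)) x))"

definition d_g :: "('q \<times> 'g::euclidean_space \<Rightarrow> real) \<Rightarrow> 'q \<times> 'g \<Rightarrow> 'g \<Rightarrow>\<^sub>L real" where
  "d_g F = (\<lambda>(x, X). Blinfun (frechet_derivative (\<lambda>Y. F (x, Y)) (at X)))"

definition Legendre ::
    "(('q, 'e::real_normed_vector) tangent \<Rightarrow> real) \<Rightarrow> ('q, 'e) tangent \<Rightarrow> ('q, 'e) cotangent" where
  "Legendre L = (\<lambda>(x, v). (x, Blinfun (frechet_derivative (\<lambda>w. L (x, w)) (at v))))"

definition Omega ::
    "('q, 'e::real_normed_vector) chart set \<Rightarrow> ('g::euclidean_space \<Rightarrow> 'q \<Rightarrow> 'e) \<Rightarrow>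
     (('q, 'e) tangent \<Rightarrow> real) \<Rightarrow> 'q \<times> 'g \<Rightarrow> 'g \<Rightarrow>\<^sub>L real" where
  "Omega A \<psi> L = snd \<circ> phi_transpose \<psi> \<circ> d_Q A (Lbar \<psi> L)"

section \<open>Piecewise smooth curves, variations and extremals\<close>

definition subdivision :: "real \<Rightarrow> real \<Rightarrow> real set \<Rightarrow> bool" where
  "subdivision t0 t1 P \<longleftrightarrow> finite P \<and> t0 \<in> P \<and> t1 \<in> P \<and> P \<subseteq> {t0..t1}"

text \<open>The pairs of consecutive points of a subdivision.\<close>

definition pieces :: "real set \<Rightarrow> (real \<times> real) set" where
  "pieces P = {(a, b). a \<in> P \<and> b \<in> P \<and> a < b \<and> {a<..<b} \<inter> P = {}}"

definition piecewise_smooth_curve ::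
    "('q::topological_space, 'e::real_normed_vector) chart set \<Rightarrow> real \<Rightarrow> real \<Rightarrow> (real \<Rightarrow> 'q) \<Rightarrow> bool" where
  "piecewise_smooth_curve A t0 t1 \<gamma> \<longleftrightarrow> continuous_on {t0..t1} \<gamma> \<and>
     (\<exists>P. subdivision t0 t1 P \<and> (\<forall>(a, b)\<in>pieces P. smooth_map_on A {a..b} \<gamma>))"

text \<open>Jumps are allowed at the points of the subdivision: on each open piece the curve agrees with
  one that is smooth on the closed piece.\<close>

definition piecewise_continuous_smooth :: "real \<Rightarrow> real \<Rightarrow> (real \<Rightarrow> 'g::real_normed_vector) \<Rightarrow> bool" where
  "piecewise_continuous_smooth t0 t1 V \<longleftrightarrow>
     (\<exists>P. subdivision t0 t1 P \<and>
        (\<forall>(a, b)\<in>pieces P. \<exists>W. smooth_on {a..b} W \<and> (\<forall>t\<in>{a<..<b}. V t = W t)))"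

definition smooth_at_time ::
    "('q::topological_space, 'e::real_normed_vector) chart set \<Rightarrow> real \<Rightarrow> real \<Rightarrow> (real \<Rightarrow> 'q) \<Rightarrow> real \<Rightarrow> bool" where
  "smooth_at_time A t0 t1 \<gamma> t \<longleftrightarrow> (\<exists>\<delta>>0. smooth_map_on A ({t0..t1} \<inter> ball t \<delta>) \<gamma>)"

text \<open>The velocity, as an element of the tangent bundle; it is meaningful where \<open>\<gamma>\<close> is
  differentiable, and one-sided at the end points.\<close>

definition velocity ::
    "('q, 'e::real_normed_vector) chart set \<Rightarrow> real \<Rightarrow> real \<Rightarrow> (real \<Rightarrow> 'q) \<Rightarrow> real \<Rightarrow> ('q, 'e) tangent" where
  "velocity A t0 t1 \<gamma> t =
     (\<gamma> t, vector_derivative (cmap (chart_at A (\<gamma> t)) \<circ> \<gamma>) (at t within {t0..t1}))"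

definition compatible ::
    "('q::topological_space, 'e::real_normed_vector) chart set \<Rightarrow> ('g \<Rightarrow> 'q \<Rightarrow> 'e) \<Rightarrow> real \<Rightarrow> real \<Rightarrow>
     (real \<Rightarrow> 'q) \<Rightarrow> (real \<Rightarrow> 'g) \<Rightarrow> bool" where
  "compatible A \<psi> t0 t1 \<gamma> V \<longleftrightarrow>
     (\<forall>t\<in>{t0..t1}. smooth_at_time A t0 t1 \<gamma> t \<longrightarrow> velocity A t0 t1 \<gamma> t = phi \<psi> (\<gamma> t, V t))"

definition action_functional ::
    "('q, 'e::real_normed_vector) chart set \<Rightarrow> (('q, 'e) tangent \<Rightarrow> real) \<Rightarrow> real \<Rightarrow> real \<Rightarrow>
     (real \<Rightarrow> 'q) \<Rightarrow> real" where
  "action_functional A L t0 t1 \<gamma> = integral {t0..t1} (\<lambda>t. L (velocity A t0 t1 \<gamma> t))"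

text \<open>The curve \<open>\<gamma>\<^sub>s\<close> of the variation is \<open>\<Gamma> s\<close>.  Piecewise smoothness of a variation refers to a
  subdivision of the time interval into finitely many strips.\<close>

definition fixed_endpoint_variation ::
    "('q::topological_space, 'e::real_normed_vector) chart set \<Rightarrow> real \<Rightarrow> real \<Rightarrow> (real \<Rightarrow> 'q) \<Rightarrow>
     real \<Rightarrow> (real \<Rightarrow> real \<Rightarrow> 'q) \<Rightarrow> bool" where
  "fixed_endpoint_variation A t0 t1 \<gamma> \<epsilon> \<Gamma> \<longleftrightarrow> \<epsilon> > 0 \<and>
     continuous_on ({t0..t1} \<times> {-\<epsilon>..\<epsilon>}) (\<lambda>(t, s). \<Gamma> s t) \<and>
     (\<exists>P. subdivision t0 t1 P \<and>
        (\<forall>(a, b)\<in>pieces P. smooth_map_on A ({a..b} \<times> {-\<epsilon>..\<epsilon>}) (\<lambda>(t, s). \<Gamma> s t))) \<and>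
     (\<forall>t\<in>{t0..t1}. \<Gamma> 0 t = \<gamma> t) \<and>
     (\<forall>s\<in>{-\<epsilon>..\<epsilon>}. \<Gamma> s t0 = \<gamma> t0 \<and> \<Gamma> s t1 = \<gamma> t1)"

definition extremal ::
    "('q::topological_space, 'e::real_normed_vector) chart set \<Rightarrow> (('q, 'e) tangent \<Rightarrow> real) \<Rightarrow>
     real \<Rightarrow> real \<Rightarrow> (real \<Rightarrow> 'q) \<Rightarrow> bool" where
  "extremal A L t0 t1 \<gamma> \<longleftrightarrow>
     (\<forall>\<epsilon> \<Gamma>. fixed_endpoint_variation A t0 t1 \<gamma> \<epsilon> \<Gamma> \<longrightarrow>
        ((\<lambda>s. action_functional A L t0 t1 (\<Gamma> s)) has_real_derivative 0) (at 0))"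

section \<open>The Euler-Poincare equation\<close>

text \<open>The equation \<open>(d/dt - ad\<^sup>*\<^bsub>V(t)\<^esub>) (M (\<gamma> t, V t)) = R (\<gamma> t, V t)\<close> along a curve that is only
  piecewise smooth.  It has to hold at every instant at which \<open>\<gamma>\<close> is smooth.  At the finitely many
  corners of \<open>\<gamma>\<close> the derivative is understood across the corner: since the other terms of the
  equation are bounded, \<open>M (\<gamma> t, V t)\<close> may not jump there (a jump would contribute a Dirac mass to
  the derivative), i.e. its left and right limits agree.  Without this
  Weierstrass-Erdmann condition a broken geodesic, with arbitrary corners, would be a solution.\<close>

definition Euler_Poincare ::
    "('q::topological_space, 'e::real_normed_vector) chart set \<Rightarrow> ('g::euclidean_space \<Rightarrow> 'g \<Rightarrow> 'g) \<Rightarrow>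
     real \<Rightarrow> real \<Rightarrow> (real \<Rightarrow> 'q) \<Rightarrow> (real \<Rightarrow> 'g) \<Rightarrow>
     ('q \<times> 'g \<Rightarrow> 'g \<Rightarrow>\<^sub>L real) \<Rightarrow> ('q \<times> 'g \<Rightarrow> 'g \<Rightarrow>\<^sub>L real) \<Rightarrow> bool" where
  "Euler_Poincare A br t0 t1 \<gamma> V M R \<longleftrightarrow>
     (\<forall>t\<in>{t0..t1}. smooth_at_time A t0 t1 \<gamma> t \<longrightarrow>
        (\<exists>D. ((\<lambda>\<tau>. M (\<gamma> \<tau>, V \<tau>)) has_vector_derivative D) (at t within {t0..t1}) \<and>
             D - ad_star br (V t) (M (\<gamma> t, V t)) = R (\<gamma> t, V t))) \<and>
     (\<forall>t\<in>{t0<..<t1}. \<exists>\<mu>. ((\<lambda>\<tau>. M (\<gamma> \<tau>, V \<tau>)) \<longlongrightarrow> \<mu>) (at t))"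

end

theory Submission
  imports Defs
begin

text \<open>In a chart, \<open>d\<^sub>gL(\<gamma>,V)\<close> paired with \<open>Y\<close> is \<open>\<langle>p, Y\<^sub>Q\<rangle>\<close> with \<open>p = \<partial>L/\<partial>w\<close> along the curve.
  Differentiating and using \<open>[V,Y]\<^sub>Q = [V\<^sub>Q,Y\<^sub>Q]\<close>, the two terms with \<open>DV\<^sub>Q\<cdot>Y\<^sub>Q\<close> and the two with \<open>DY\<^sub>Q\<cdot>V\<^sub>Q\<close> cancel, so
  the Euler-Poincare equation paired with \<open>Y\<close> reads \<open>\<langle>p' - \<partial>L/\<partial>u, Y\<^sub>Q\<rangle> = 0\<close>; by local transitivity it is the
  Euler-Lagrange equation.

  An extremal satisfies it, and has no jump of \<open>p\<close> at a corner, by testing with variations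
  \<open>u + s(t-a)(b-t)h\<close> in a chart: variations need only be piecewise smooth, so no smooth bump functions are required.

  Conversely, for an arbitrary variation the pairing \<open>B\<close> of the momentum with the variation field does not depend
  on a chart, is continuous across corners, and by the Euler-Lagrange equation, used at each time in the one chart
  in which \<open>T\<^sub>xQ\<close> is represented, \<open>B'\<close> is the \<open>s\<close>-derivative of the integrand.  Thus the derivative of the action
  over any piece is the increment of \<open>B\<close>, and \<open>B\<close> vanishes at both ends.\<close>

section \<open>Calculus of smooth maps\<close>

text \<open>The representing chart \<open>chart_at A x\<close> may jump with x, so derivatives along
  curves and in the parameter of a variation are taken in one fixed chart c, through the local
  Lagrangian, and are returned to the representing chart only at a single point. A variation need
  not stay in one chart or in one smooth strip; the first variation is therefore treated as an
  additive function of time intervals and assembled by bisection. The element V(t) is not determined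
  by the velocity, as \<open>phi\<close> need not be injective; the momentum is, because it sees
  V(t) only through the vector \<open>\<psi> (V t) (\<gamma> t)\<close>. This makes its limits at
  corners computable from one-sided velocities. The factor (t-a)(b-t) is positive inside, vanishes
  at both ends and creates nothing worse than kinks there. One family of test variations, with a
  marked time m inside, serves both necessary conditions: a fictitious corner at m gives the
  Euler-Lagrange equation, a true one the equality of the one-sided momenta.\<close>

lemma Ck_on_cong:
  assumes "open U" "\<And>x. x \<in> U \<Longrightarrow> f x = g x" "Ck_on k f U"
  shows "Ck_on k g U"
  using assms(2,3)
proof (induction k arbitrary: f g)
  case 0
  then show ?case
    by (auto intro: continuous_on_eq)
next
  case (Suc k)
  have d: "f differentiable at x" if "x \<in> U" for x
    using Suc.prems that by simp
  have eq: "frechet_derivative f (at x) = frechet_derivative g (at x)" if "x \<in> U" for x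
    by (rule frechet_derivative_transform_within_open[OF d[OF that] assms(1) that])
      (use Suc.prems in auto)
  have "g differentiable at x" if "x \<in> U" for x
    using d[OF that] has_derivative_transform_within_open[OF _ assms(1) that, of f _ UNIV g] Suc.prems(1)
    unfolding differentiable_def by blast
  moreover have "Ck_on k (\<lambda>x. frechet_derivative g (at x) v) U" for v
    by (rule Suc.IH[of "\<lambda>x. frechet_derivative f (at x) v"]) (use Suc.prems eq in auto)
  ultimately show ?case
    by simp
qed

lemma Ck_on_subset: "Ck_on k f U \<Longrightarrow> V \<subseteq> U \<Longrightarrow> Ck_on k f V"
  by (induction k arbitrary: f) (auto intro: continuous_on_subset)

lemma Ck_on_local:
  assumes "\<And>x. x \<in> U \<Longrightarrow> \<exists>V. open V \<and> x \<in> V \<and> Ck_on k f V"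
  shows "Ck_on k f U"
  using assms
proof (induction k arbitrary: f)
  case 0
  then show ?case
    by (metis Ck_on.simps(1) continuous_on_eq_continuous_at continuous_at_imp_continuous_on)
next
  case (Suc k)
  have "f differentiable at x" if "x \<in> U" for x
    using Suc.prems[OF that] by auto
  moreover have "Ck_on k (\<lambda>x. frechet_derivative f (at x) v) U" for v
    by (rule Suc.IH) (use Suc.prems in fastforce)
  ultimately show ?case
    by simp
qed

lemma Ck_on_Suc_imp: "Ck_on (Suc k) f U \<Longrightarrow> Ck_on k f U"
proof (induction k arbitrary: f)
  case 0
  then show ?case
    by (auto intro: continuous_at_imp_continuous_on differentiable_imp_continuous_within)
next
  case (Suc k)
  then show ?case
    by (metis Ck_on.simps(2))
qed

text \<open>Derivatives at a point are unique, so an explicit family f' may replace the selected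
  \<open>frechet_derivative\<close> in the recursion. The inductive closure rules below are proved
  in this form.\<close>

lemma Ck_on_SucI:
  assumes "open U" "\<And>x. x \<in> U \<Longrightarrow> (f has_derivative f' x) (at x)"
    "\<And>v. Ck_on k (\<lambda>x. f' x v) U"
  shows "Ck_on (Suc k) f U"
proof -
  have "frechet_derivative f (at x) = f' x" if "x \<in> U" for x
    using frechet_derivative_at[OF assms(2)[OF that]] by simp
  then have "Ck_on k (\<lambda>x. frechet_derivative f (at x) v) U" for v
    by (intro Ck_on_cong[OF assms(1) _ assms(3)]) auto
  then show ?thesis
    using assms(2) by (auto simp: differentiable_def)
qed

lemma Ck_on_SucD:
  assumes "Ck_on (Suc k) f U" "x \<in> U"
  shows "(f has_derivative frechet_derivative f (at x)) (at x)"
  using assms by (simp flip: frechet_derivative_works)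

lemma Ck_on_const: "Ck_on k (\<lambda>x. c) U"
  by (induction k arbitrary: c) auto

lemma (in bounded_linear) Ck_on_linear: "open U \<Longrightarrow> Ck_on k f U"
proof (cases k)
  case 0
  then show ?thesis by (simp add: linear_continuous_on local.bounded_linear_axioms)
next
  case (Suc n)
  assume "open U"
  then show ?thesis
    unfolding Suc by (rule Ck_on_SucI[where f'="\<lambda>x. f"]) (auto intro: Ck_on_const bounded_linear_imp_has_derivative local.bounded_linear_axioms)
qed

lemma (in bounded_linear) Ck_on_comp: "open U \<Longrightarrow> Ck_on k g U \<Longrightarrow> Ck_on k (\<lambda>x. f (g x)) U"
proof (induction k arbitrary: g)
  case 0
  then show ?case by (simp add: continuous_on)
next
  case (Suc k)
  show ?case
    by (rule Ck_on_SucI[where f'="\<lambda>x v. f (frechet_derivative g (at x) v)"])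
      (use Suc in \<open>auto intro!: has_derivative simp flip: frechet_derivative_works\<close>)
qed

lemma Ck_on_add:
  "open U \<Longrightarrow> Ck_on k f U \<Longrightarrow> Ck_on k g U \<Longrightarrow> Ck_on k (\<lambda>x. f x + g x) U"
proof (induction k arbitrary: f g)
  case 0
  then show ?case by (auto intro: continuous_intros)
next
  case (Suc k)
  show ?case
    by (rule Ck_on_SucI[where f'="\<lambda>x v. frechet_derivative f (at x) v + frechet_derivative g (at x) v"])
      (use Suc in \<open>auto intro!: has_derivative_add simp flip: frechet_derivative_works\<close>)
qed

lemma Ck_on_sum:
  assumes "open U" "\<And>i. i \<in> I \<Longrightarrow> Ck_on k (f i) U"
  shows "Ck_on k (\<lambda>x. \<Sum>i\<in>I. f i x) U"
  using assms(2)
  by (induction I rule: infinite_finite_induct) (auto intro: Ck_on_const Ck_on_add[OF assms(1)])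

lemma (in bounded_bilinear) Ck_on_prod:
  "open U \<Longrightarrow> Ck_on k f U \<Longrightarrow> Ck_on k g U \<Longrightarrow> Ck_on k (\<lambda>x. prod (f x) (g x)) U"
proof (induction k arbitrary: f g)
  case 0
  then show ?case by (auto intro: continuous_on)
next
  case (Suc k)
  have "Ck_on k f U" "Ck_on k g U"
    using Suc.prems by (blast intro: Ck_on_Suc_imp)+
  with Suc show ?case
    by (intro Ck_on_SucI[where f'="\<lambda>x v. prod (f x) (frechet_derivative g (at x) v) + prod (frechet_derivative f (at x) v) (g x)"])
      (auto intro!: FDERIV Ck_on_add simp flip: frechet_derivative_works)
qed

text \<open>The recursion differentiates in fixed directions only, whereas the chain rule applies Dg
  to the moving direction Df(x)v. Expanding this direction over \<open>Basis\<close> turns the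
  derivative into a finite sum of products of C^k functions; this is where the Euclidean
  intermediate space enters.\<close>

lemma Ck_on_compose:
  fixes f :: "'a::real_normed_vector \<Rightarrow> 'b::euclidean_space"
  assumes "open U" "open W" "f ` U \<subseteq> W" "Ck_on k f U" "Ck_on k g W"
  shows "Ck_on k (\<lambda>x. g (f x)) U"
  using assms(4,5)
proof (induction k arbitrary: g)
  case 0
  then show ?case
    using assms(3) by (auto intro: continuous_on_compose2)
next
  case (Suc k)
  have fk: "Ck_on k f U"
    using Suc.prems by (blast intro: Ck_on_Suc_imp)
  define F where "F x v = (\<Sum>i\<in>Basis. (frechet_derivative f (at x) v \<bullet> i) *\<^sub>R frechet_derivative g (at (f x)) i)" for x v
  have "((\<lambda>x. g (f x)) has_derivative F x) (at x)" if "x \<in> U" for x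
  proof -
    have g: "(g has_derivative frechet_derivative g (at (f x))) (at (f x))"
      using Suc.prems(2) assms(3) that by (auto intro!: Ck_on_SucD)
    interpret g: bounded_linear "frechet_derivative g (at (f x))"
      using g by (rule has_derivative_bounded_linear)
    have "F x v = frechet_derivative g (at (f x)) (frechet_derivative f (at x) v)" for v
      unfolding F_def g.scaleR[symmetric] g.sum[symmetric] euclidean_representation by simp
    then have "F x = (\<lambda>v. frechet_derivative g (at (f x)) (frechet_derivative f (at x) v))"
      by blast
    then show ?thesis
      using has_derivative_compose[OF Ck_on_SucD[OF Suc.prems(1) that] g] by simp
  qed
  moreover have "Ck_on k (\<lambda>x. F x v) U" for v
    unfolding F_def
  proof (intro Ck_on_sum assms(1) bounded_bilinear.Ck_on_prod[OF bounded_bilinear_scaleR])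
    fix i :: 'b
    show "Ck_on k (\<lambda>x. frechet_derivative f (at x) v \<bullet> i) U"
      using Suc.prems by (intro bounded_linear.Ck_on_comp[OF bounded_linear_inner_left] assms(1)) auto
    show "Ck_on k (\<lambda>x. frechet_derivative g (at (f x)) i) U"
      using Suc.prems fk by (intro Suc.IH[of "\<lambda>y. frechet_derivative g (at y) i"]) auto
  qed
  ultimately show ?case
    by (rule Ck_on_SucI[OF assms(1)])
qed

section \<open>Smoothness on arbitrary sets through local extensions\<close>

lemma smooth_on_open_iff: "open U \<Longrightarrow> smooth_on U f \<longleftrightarrow> (\<forall>k. Ck_on k f U)"
proof
  assume U: "open U" and f: "smooth_on U f"
  show "\<forall>k. Ck_on k f U"
  proof
    fix k
    show "Ck_on k f U"
    proof (rule Ck_on_local)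
      fix x assume "x \<in> U"
      then obtain V g where V: "open V" "x \<in> V" "Ck_on k g V" "\<forall>y\<in>U \<inter> V. f y = g y"
        using f unfolding smooth_on_def by meson
      then have "Ck_on k f (U \<inter> V)"
        by (intro Ck_on_cong[of "U \<inter> V" g f k]) (auto intro: Ck_on_subset U)
      then show "\<exists>V. open V \<and> x \<in> V \<and> Ck_on k f V"
        using U V \<open>x \<in> U\<close> by blast
    qed
  qed
qed (auto simp: smooth_on_def)

lemma smooth_onE:
  assumes "smooth_on S f" "x \<in> S"
  obtains U g where "open U" "x \<in> U" "smooth_on U g" "\<forall>y\<in>S \<inter> U. f y = g y"
proof -
  have "\<exists>U g. open U \<and> x \<in> U \<and> (\<forall>k. Ck_on k g U) \<and> (\<forall>y\<in>S \<inter> U. f y = g y)"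
    using assms by (simp add: smooth_on_def)
  then show thesis
    by (elim exE conjE) (rule that, auto simp: smooth_on_open_iff)
qed

lemma smooth_onI:
  assumes "\<And>x. x \<in> S \<Longrightarrow> \<exists>U g. open U \<and> x \<in> U \<and> smooth_on U g \<and> (\<forall>y\<in>S \<inter> U. f y = g y)"
  shows "smooth_on S f"
  unfolding smooth_on_def
proof
  fix x assume "x \<in> S"
  from assms[OF this] show "\<exists>U g. open U \<and> x \<in> U \<and> (\<forall>k. Ck_on k g U) \<and> (\<forall>y\<in>S \<inter> U. f y = g y)"
    by (elim exE conjE, intro exI conjI) (simp_all add: smooth_on_open_iff)
qed

lemma smooth_on_subset:
  assumes "smooth_on S f" "T \<subseteq> S"
  shows "smooth_on T f"
proof (rule smooth_onI)
  fix x assume "x \<in> T"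
  then have "x \<in> S"
    using assms(2) by blast
  then obtain U g where U: "open U" "x \<in> U" "smooth_on U g" "\<forall>y\<in>S \<inter> U. f y = g y"
    using smooth_onE[OF assms(1)] by blast
  then show "\<exists>U g. open U \<and> x \<in> U \<and> smooth_on U g \<and> (\<forall>y\<in>T \<inter> U. f y = g y)"
    using assms(2) by (intro exI[of _ U] exI[of _ g]) auto
qed

lemma smooth_on_cong: "smooth_on S f \<Longrightarrow> (\<And>x. x \<in> S \<Longrightarrow> f x = g x) \<Longrightarrow> smooth_on S g"
  unfolding smooth_on_def by simp

lemma smooth_on_const: "smooth_on S (\<lambda>x. c)"
  by (intro smooth_onI exI[of _ UNIV] exI[of _ "\<lambda>x. c"]) (auto simp: smooth_on_open_iff Ck_on_const)

lemma smooth_on_linear: "bounded_linear f \<Longrightarrow> smooth_on S f"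
  by (intro smooth_onI exI[of _ UNIV] exI[of _ f])
    (auto simp: smooth_on_open_iff bounded_linear.Ck_on_linear)

lemma (in bounded_linear) smooth_on_comp:
  assumes "smooth_on S g"
  shows "smooth_on S (\<lambda>x. f (g x))"
proof (rule smooth_onI)
  fix x assume "x \<in> S"
  then obtain U h where "open U" "x \<in> U" "smooth_on U h" "\<forall>y\<in>S \<inter> U. g y = h y"
    using smooth_onE[OF assms] \<open>x \<in> S\<close> by blast
  then show "\<exists>U h. open U \<and> x \<in> U \<and> smooth_on U h \<and> (\<forall>y\<in>S \<inter> U. f (g y) = h y)"
    by (intro exI[of _ U] exI[of _ "\<lambda>x. f (h x)"]) (auto simp: smooth_on_open_iff Ck_on_comp)
qed

lemma smooth_on_add:
  assumes "smooth_on S f" "smooth_on S g"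
  shows "smooth_on S (\<lambda>x. f x + g x)"
proof (rule smooth_onI)
  fix x assume x: "x \<in> S"
  obtain U f' where U: "open U" "x \<in> U" "smooth_on U f'" "\<forall>y\<in>S \<inter> U. f y = f' y"
    using smooth_onE[OF assms(1)] x  by blast
  obtain V g' where V: "open V" "x \<in> V" "smooth_on V g'" "\<forall>y\<in>S \<inter> V. g y = g' y"
    using smooth_onE[OF assms(2)] x  by blast
  have "smooth_on (U \<inter> V) f'" "smooth_on (U \<inter> V) g'"
    using U V by (auto intro: smooth_on_subset)
  then have "smooth_on (U \<inter> V) (\<lambda>x. f' x + g' x)"
    using U V by (auto simp: smooth_on_open_iff open_Int intro: Ck_on_add)
  then show "\<exists>U h. open U \<and> x \<in> U \<and> smooth_on U h \<and> (\<forall>y\<in>S \<inter> U. f y + g y = h y)"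
    using U V by (intro exI[of _ "U \<inter> V"] exI[of _ "\<lambda>x. f' x + g' x"]) auto
qed

lemma (in bounded_bilinear) smooth_on_prod:
  assumes "smooth_on S f" "smooth_on S g"
  shows "smooth_on S (\<lambda>x. prod (f x) (g x))"
proof (rule smooth_onI)
  fix x assume x: "x \<in> S"
  obtain U f' where U: "open U" "x \<in> U" "smooth_on U f'" "\<forall>y\<in>S \<inter> U. f y = f' y"
    using smooth_onE[OF assms(1)] x  by blast
  obtain V g' where V: "open V" "x \<in> V" "smooth_on V g'" "\<forall>y\<in>S \<inter> V. g y = g' y"
    using smooth_onE[OF assms(2)] x  by blast
  have "smooth_on (U \<inter> V) f'" "smooth_on (U \<inter> V) g'"
    using U V by (auto intro: smooth_on_subset)
  then have "smooth_on (U \<inter> V) (\<lambda>x. prod (f' x) (g' x))"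
    using U V by (auto simp: smooth_on_open_iff open_Int intro: Ck_on_prod)
  then show "\<exists>U h. open U \<and> x \<in> U \<and> smooth_on U h \<and> (\<forall>y\<in>S \<inter> U. prod (f y) (g y) = h y)"
    using U V by (intro exI[of _ "U \<inter> V"] exI[of _ "\<lambda>x. prod (f' x) (g' x)"]) auto
qed

lemma smooth_on_Pair:
  assumes "smooth_on S f" "smooth_on S g"
  shows "smooth_on S (\<lambda>x. (f x, g x))"
proof -
  have "smooth_on S (\<lambda>x. (f x, 0) + (0, g x))"
    by (intro smooth_on_add bounded_linear.smooth_on_comp[OF _ assms(1)]
        bounded_linear.smooth_on_comp[OF _ assms(2)])
      (auto intro!: bounded_linear_Pair bounded_linear_ident bounded_linear_zero)
  then show ?thesis
    by simp
qed

lemma smooth_on_imp_continuous_on: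
  assumes "smooth_on S f"
  shows "continuous_on S f"
  unfolding continuous_on_eq_continuous_within
proof
  fix x assume x: "x \<in> S"
  then obtain U g where U: "open U" "x \<in> U" "smooth_on U g" "\<forall>y\<in>S \<inter> U. f y = g y"
    using smooth_onE[OF assms] \<open>x \<in> S\<close> by blast
  have "continuous_on U g"
    using U by (metis Ck_on.simps(1) smooth_on_open_iff)
  then have "continuous (at x within S) g"
    using U by (simp add: continuous_on_eq_continuous_at continuous_at_imp_continuous_at_within)
  then show "continuous (at x within S) f"
    using U x Lim_transform_within_openin[of g "g x" x S "S \<inter> U" f]
    by (simp add: continuous_within openin_open_Int)
qed

lemma smooth_on_compose:
  fixes f :: "'a::real_normed_vector \<Rightarrow> 'b::euclidean_space"
  assumes "smooth_on S f" "smooth_on T g" "f ` S \<subseteq> T"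
  shows "smooth_on S (\<lambda>x. g (f x))"
proof (rule smooth_onI)
  fix x assume x: "x \<in> S"
  obtain U f' where U: "open U" "x \<in> U" "smooth_on U f'" "\<forall>y\<in>S \<inter> U. f y = f' y"
    using smooth_onE[OF assms(1)] x  by blast
  obtain V g' where V: "open V" "f x \<in> V" "smooth_on V g'" "\<forall>y\<in>T \<inter> V. g y = g' y"
    using smooth_onE[OF assms(2), of "f x"] x assms(3) by blast
  \<comment> \<open>The preimage is taken under the extension f', which is continuous on the open
    set U; f is controlled only on S, so its preimage of V need not be open.\<close>
  define W where "W = U \<inter> f' -` V"
  have W: "open W"
    unfolding W_def using U V by (auto intro: continuous_open_preimage smooth_on_imp_continuous_on)
  have "smooth_on W f'"
    using U by (auto simp: W_def intro: smooth_on_subset)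
  moreover have "f' ` W \<subseteq> V"
    by (auto simp: W_def)
  ultimately have "Ck_on k (\<lambda>x. g' (f' x)) W" for k
    using V(3) by (intro Ck_on_compose[OF W V(1), of f' k g']) (auto simp: smooth_on_open_iff[OF W] smooth_on_open_iff[OF V(1)])
  then have "smooth_on W (\<lambda>x. g' (f' x))"
    by (simp add: smooth_on_open_iff[OF W])
  moreover have "x \<in> W"
    using U V(2) x by (simp add: W_def)
  moreover have "g (f y) = g' (f' y)" if "y \<in> S \<inter> W" for y
  proof -
    have "f y = f' y" "f y \<in> T \<inter> V"
      using that U(4) assms(3) by (auto simp: W_def)
    then show ?thesis
      using V(4) by metis
  qed
  ultimately show "\<exists>U h. open U \<and> x \<in> U \<and> smooth_on U h \<and> (\<forall>y\<in>S \<inter> U. g (f y) = h y)"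
    using W by blast
qed

lemma smooth_on_has_derivative:
  assumes "open U" "smooth_on U f" "x \<in> U"
  shows "(f has_derivative frechet_derivative f (at x)) (at x)"
  using assms by (meson Ck_on_SucD smooth_on_open_iff)

lemma smooth_on_frechet_derivative:
  assumes "open U" "smooth_on U f"
  shows "smooth_on U (\<lambda>x. frechet_derivative f (at x) v)"
  using assms by (metis Ck_on.simps(2) smooth_on_open_iff)

section \<open>Derivatives up to the boundary of intervals and rectangles\<close>

lemma at_within_Icc_nontrivial: "a < b \<Longrightarrow> t \<in> {a..b::real} \<Longrightarrow> at t within {a..b} \<noteq> bot"
  by (simp add: islimpt_Icc trivial_limit_within)

text \<open>Local extensions may have different derivatives off the set, but within a nondegenerate
  interval the derivative in t is determined by u alone. The t-derivatives of the extensions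
  therefore agree on {a..b} \<times> T and patch to one smooth function.\<close>

lemma smooth_on_partial_derivative:
  fixes u :: "real \<times> 's::real_normed_vector \<Rightarrow> 'b::real_normed_vector"
  assumes "a < b" "smooth_on ({a..b} \<times> T) u"
  obtains u' where "smooth_on ({a..b} \<times> T) u'"
    "\<And>t s. t \<in> {a..b} \<Longrightarrow> s \<in> T \<Longrightarrow>
      ((\<lambda>\<tau>. u (\<tau>, s)) has_vector_derivative u' (t, s)) (at t within {a..b})"
proof -
  have loc: "\<exists>U g. open U \<and> z \<in> U \<and> smooth_on U g \<and> (\<forall>y\<in>({a..b} \<times> T) \<inter> U. u y = g y)"
    if "z \<in> {a..b} \<times> T" for z
    using smooth_onE[OF assms(2) that] by metis
  have der: "((\<lambda>\<tau>. u (\<tau>, s)) has_vector_derivative frechet_derivative g (at (t, s)) (1, 0)) (at t within {a..b})"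
    if "open U" "smooth_on U g" "\<forall>y\<in>({a..b} \<times> T) \<inter> U. u y = g y" "(t, s) \<in> U" "t \<in> {a..b}" "s \<in> T"
    for U g t s
  proof -
    have "(g has_derivative frechet_derivative g (at (t, s))) (at (t, s))"
      using smooth_on_has_derivative that by blast
    moreover have "((\<lambda>\<tau>. (\<tau>, s)) has_vector_derivative (1, 0)) (at t within {a..b})"
      by (auto simp: has_vector_derivative_def intro!: derivative_eq_intros)
    ultimately have "((\<lambda>\<tau>. g (\<tau>, s)) has_vector_derivative frechet_derivative g (at (t, s)) (1, 0)) (at t within {a..b})"
      using vector_derivative_diff_chain_within[of "\<lambda>\<tau>. (\<tau>, s)" "(1,0)" t "{a..b}" g]
      by (auto simp: o_def has_derivative_at_withinI)
    then have "((\<lambda>\<tau>. g (\<tau>, s)) has_derivative (\<lambda>x. x *\<^sub>R frechet_derivative g (at (t, s)) (1, 0))) (at t within {a..b})"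
      by (simp add: has_vector_derivative_def)
    moreover have tU: "t \<in> (\<lambda>\<tau>. (\<tau>, s)) -` U" "open ((\<lambda>\<tau>. (\<tau>, s)) -` U)"
      using that(1,4) by (auto intro!: open_vimage continuous_intros)
    then obtain d where "d > 0" "\<And>\<tau>. dist \<tau> t < d \<Longrightarrow> (\<tau>, s) \<in> U"
      unfolding open_dist by auto
    ultimately have "((\<lambda>\<tau>. u (\<tau>, s)) has_derivative (\<lambda>x. x *\<^sub>R frechet_derivative g (at (t, s)) (1, 0))) (at t within {a..b})"
      using that by (elim has_derivative_transform_within) auto
    then show ?thesis
      by (simp add: has_vector_derivative_def)
  qed
  \<comment> \<open>Defined without choosing an extension; uniqueness of the derivative within
    {a..b} identifies it with each local formula.\<close>
  define u' where "u' z = vector_derivative (\<lambda>\<tau>. u (\<tau>, snd z)) (at (fst z) within {a..b})" for z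
  have u': "u' (t, s) = frechet_derivative g (at (t, s)) (1, 0)"
    if "open U" "smooth_on U g" "\<forall>y\<in>({a..b} \<times> T) \<inter> U. u y = g y" "(t, s) \<in> U" "t \<in> {a..b}" "s \<in> T"
    for U g t s
    unfolding u'_def fst_conv snd_conv
    by (rule vector_derivative_within[OF at_within_Icc_nontrivial[OF assms(1)] der]) (use that in auto)
  show thesis
  proof
    show "smooth_on ({a..b} \<times> T) u'"
    proof (rule smooth_onI)
      fix z assume "z \<in> {a..b} \<times> T"
      then obtain U g where U: "open U" "z \<in> U" "smooth_on U g" "\<forall>y\<in>({a..b} \<times> T) \<inter> U. u y = g y"
        using loc by metis
      then show "\<exists>U g. open U \<and> z \<in> U \<and> smooth_on U g \<and> (\<forall>y\<in>({a..b} \<times> T) \<inter> U. u' y = g y)"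
        by (intro exI[of _ U] exI[of _ "\<lambda>z. frechet_derivative g (at z) (1, 0)"])
          (auto intro!: smooth_on_frechet_derivative simp: u'[OF U(1,3,4)])
    qed
    fix t s assume ts: "t \<in> {a..b}" "s \<in> T"
    then obtain U g where U: "open U" "(t, s) \<in> U" "smooth_on U g" "\<forall>y\<in>({a..b} \<times> T) \<inter> U. u y = g y"
      using loc[of "(t, s)"] by auto
    show "((\<lambda>\<tau>. u (\<tau>, s)) has_vector_derivative u' (t, s)) (at t within {a..b})"
      using der[OF U(1,3,4,2) ts] u'[OF U(1,3,4,2) ts] by simp
  qed
qed

lemma smooth_on_swap:
  fixes u :: "'a::euclidean_space \<times> 'c::euclidean_space \<Rightarrow> 'b::real_normed_vector"
  shows "smooth_on (S \<times> T) u \<Longrightarrow> smooth_on (T \<times> S) (\<lambda>z. u (snd z, fst z))"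
  by (rule smooth_on_compose[where f="\<lambda>z. (snd z, fst z)"])
    (auto intro!: smooth_on_linear bounded_linear_Pair bounded_linear_fst bounded_linear_snd)

lemma smooth_on_partial_derivative_snd:
  fixes u :: "'s::euclidean_space \<times> real \<Rightarrow> 'b::real_normed_vector"
  assumes "a < b" "smooth_on (T \<times> {a..b}) u"
  obtains u' where "smooth_on (T \<times> {a..b}) u'"
    "\<And>t s. t \<in> {a..b} \<Longrightarrow> s \<in> T \<Longrightarrow>
      ((\<lambda>\<tau>. u (s, \<tau>)) has_vector_derivative u' (s, t)) (at t within {a..b})"
proof -
  obtain v where v: "smooth_on ({a..b} \<times> T) v"
    "\<And>t s. t \<in> {a..b} \<Longrightarrow> s \<in> T \<Longrightarrow>
      ((\<lambda>\<tau>. u (s, \<tau>)) has_vector_derivative v (t, s)) (at t within {a..b})"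
    using smooth_on_partial_derivative[OF assms(1) smooth_on_swap[OF assms(2)]] by auto
  show thesis
    by (rule that[of "\<lambda>z. v (snd z, fst z)"]) (use v smooth_on_swap in auto)
qed

text \<open>A dummy second variable ranging over {0} reduces this to the partial derivative.\<close>

lemma smooth_on_vector_derivative:
  fixes u :: "real \<Rightarrow> 'b::real_normed_vector"
  assumes "a < b" "smooth_on {a..b} u"
  obtains u' where "smooth_on {a..b} u'"
    "\<And>t. t \<in> {a..b} \<Longrightarrow> (u has_vector_derivative u' t) (at t within {a..b})"
proof -
  have "smooth_on ({a..b} \<times> {0::real}) (\<lambda>z. u (fst z))"
    by (rule smooth_on_compose[OF _ assms(2)]) (auto intro: smooth_on_linear bounded_linear_fst)
  then obtain v where v: "smooth_on ({a..b} \<times> {0::real}) v"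
    "\<And>t. t \<in> {a..b} \<Longrightarrow> (u has_vector_derivative v (t, 0)) (at t within {a..b})"
    by (rule smooth_on_partial_derivative[OF assms(1)]) auto
  moreover have "smooth_on {a..b} (\<lambda>t. v (t, 0))"
    by (rule smooth_on_compose[OF _ v(1)]) (auto intro!: smooth_on_linear bounded_linear_Pair)
  ultimately show thesis
    using that by blast
qed

text \<open>Symmetry of the mixed partial derivatives, up to the boundary of the rectangle: differentiate
  \<open>u(t,s) - u(a,s) = \<integral>\<^sub>a\<^sup>t \<partial>\<^sub>tu(\<tau>,s) d\<tau>\<close> under the integral sign.\<close>

lemma mixed_partial_derivatives:
  fixes u ut us uts :: "real \<times> real \<Rightarrow> 'b::banach"
  assumes "a < b" "c < d" "continuous_on ({a..b} \<times> {c..d}) ut" "continuous_on ({a..b} \<times> {c..d}) uts"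
    and ut: "\<And>t s. t \<in> {a..b} \<Longrightarrow> s \<in> {c..d} \<Longrightarrow>
      ((\<lambda>\<tau>. u (\<tau>, s)) has_vector_derivative ut (t, s)) (at t within {a..b})"
    and us: "\<And>t s. t \<in> {a..b} \<Longrightarrow> s \<in> {c..d} \<Longrightarrow>
      ((\<lambda>\<sigma>. u (t, \<sigma>)) has_vector_derivative us (t, s)) (at s within {c..d})"
    and uts: "\<And>t s. t \<in> {a..b} \<Longrightarrow> s \<in> {c..d} \<Longrightarrow>
      ((\<lambda>\<sigma>. ut (t, \<sigma>)) has_vector_derivative uts (t, s)) (at s within {c..d})"
    and t: "t \<in> {a..b}" and s: "s \<in> {c..d}"
  shows "((\<lambda>\<tau>. us (\<tau>, s)) has_vector_derivative uts (t, s)) (at t within {a..b})"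
proof -
  have "us (\<tau>, s) = us (a, s) + integral {a..\<tau>} (\<lambda>r. uts (r, s))" if \<tau>: "\<tau> \<in> {a..b}" for \<tau>
  proof -
    have int: "integral {a..\<tau>} (\<lambda>r. ut (r, \<sigma>)) = u (\<tau>, \<sigma>) - u (a, \<sigma>)" if "\<sigma> \<in> {c..d}" for \<sigma>
      by (rule integral_unique, rule fundamental_theorem_of_calculus)
        (use \<tau> that in \<open>auto intro!: has_vector_derivative_within_subset[OF ut]\<close>)
    have "((\<lambda>\<sigma>. integral (cbox a \<tau>) (\<lambda>r. ut (r, \<sigma>))) has_vector_derivative
        integral (cbox a \<tau>) (\<lambda>r. uts (r, s))) (at s within {c..d})"
    proof (rule leibniz_rule_vector_derivative)
      show "((\<lambda>x. ut (t, x)) has_vector_derivative uts (t, x)) (at x within {c..d})"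
        if "x \<in> {c..d}" "t \<in> cbox a \<tau>" for x t
        using that \<tau> by (intro uts) auto
      show "(\<lambda>r. ut (r, x)) integrable_on cbox a \<tau>" if "x \<in> {c..d}" for x
        by (intro integrable_continuous continuous_on_compose2[OF assms(3)] continuous_intros)
          (use that \<tau> in auto)
      show "continuous_on ({c..d} \<times> cbox a \<tau>) (\<lambda>(x, t). uts (t, x))"
        unfolding split_beta
        by (intro continuous_on_compose2[OF assms(4)] continuous_intros) (use \<tau> in auto)
    qed (use s in auto)
    then have "((\<lambda>\<sigma>. u (\<tau>, \<sigma>) - u (a, \<sigma>)) has_vector_derivative
        integral (cbox a \<tau>) (\<lambda>r. uts (r, s))) (at s within {c..d})"
      by (rule has_vector_derivative_transform[rotated 2]) (use s int in auto)
    moreover have "((\<lambda>\<sigma>. u (\<tau>, \<sigma>) - u (a, \<sigma>)) has_vector_derivative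
        us (\<tau>, s) - us (a, s)) (at s within {c..d})"
      by (intro has_vector_derivative_diff us) (use \<tau> s assms in auto)
    ultimately have "integral (cbox a \<tau>) (\<lambda>r. uts (r, s)) = us (\<tau>, s) - us (a, s)"
      using vector_derivative_unique_within at_within_Icc_nontrivial assms(2) s by blast
    then show ?thesis
      by simp
  qed
  note eq = this
  have "continuous_on {a..b} (\<lambda>r. uts (r, s))"
    by (rule continuous_on_compose2[OF assms(4)]) (use s in \<open>auto intro!: continuous_intros\<close>)
  then have "((\<lambda>\<tau>. us (a, s) + integral {a..\<tau>} (\<lambda>r. uts (r, s))) has_vector_derivative 0 + uts (t, s)) (at t within {a..b})"
    by (intro has_vector_derivative_add has_vector_derivative_const integral_has_vector_derivative t)
  then show ?thesis
    unfolding add_0_left by (rule has_vector_derivative_transform[OF t, rotated]) (rule eq)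
qed

section \<open>The first variation in coordinates\<close>

text \<open>Expansion over \<open>Basis\<close> leaves finitely many scalar products, so it is
  enough that the moving linear form is differentiable on each fixed vector. Linearity of q' is
  inherited from q by uniqueness of derivatives. With q the momentum, this differentiates its
  pairings with vector fields and variation fields.\<close>

lemma has_vector_derivative_linear_pairing:
  fixes q :: "real \<Rightarrow> 'e::euclidean_space \<Rightarrow> real"
  assumes "a < b" "t \<in> {a..b}"
    and q: "\<And>\<tau>. \<tau> \<in> {a..b} \<Longrightarrow> linear (q \<tau>)"
    and q': "\<And>h. ((\<lambda>\<tau>. q \<tau> h) has_vector_derivative q' h) (at t within {a..b})"
    and \<xi>: "(\<xi> has_vector_derivative \<xi>') (at t within {a..b})"
  shows "((\<lambda>\<tau>. q \<tau> (\<xi> \<tau>)) has_vector_derivative q' (\<xi> t) + q t \<xi>') (at t within {a..b})"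
    and "linear q'"
proof -
  have unique: "x = y" if "(f has_vector_derivative x) (at t within {a..b})"
    "(f has_vector_derivative y) (at t within {a..b})" for x y :: real and f
    using that vector_derivative_unique_within at_within_Icc_nontrivial assms(1,2) by blast
  show lin: "linear q'"
  proof (rule linearI)
    fix x y
    have "((\<lambda>\<tau>. q \<tau> x + q \<tau> y) has_vector_derivative q' x + q' y) (at t within {a..b})"
      by (intro has_vector_derivative_add q')
    then have "((\<lambda>\<tau>. q \<tau> (x + y)) has_vector_derivative q' x + q' y) (at t within {a..b})"
      by (rule has_vector_derivative_transform[OF assms(2), rotated]) (simp add: q linear_add)
    then show "q' (x + y) = q' x + q' y"
      using q' unique by blast
  next
    fix c x
    have "((\<lambda>\<tau>. c *\<^sub>R q \<tau> x) has_vector_derivative c *\<^sub>R q' x) (at t within {a..b})"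
      using q'[of x] by (auto intro!: derivative_eq_intros simp: has_real_derivative_iff_has_vector_derivative[symmetric])
    then have "((\<lambda>\<tau>. q \<tau> (c *\<^sub>R x)) has_vector_derivative c *\<^sub>R q' x) (at t within {a..b})"
      by (rule has_vector_derivative_transform[OF assms(2), rotated]) (simp add: q linear_scale)
    then show "q' (c *\<^sub>R x) = c *\<^sub>R q' x"
      using q' unique by blast
  qed
  have expand: "g v = (\<Sum>i\<in>Basis. (v \<bullet> i) * g i)" if "linear g" for g :: "'e \<Rightarrow> real" and v
  proof -
    have "g v = g (\<Sum>i\<in>Basis. (v \<bullet> i) *\<^sub>R i)"
      by (simp add: euclidean_representation)
    then show ?thesis
      using that by (simp add: linear_sum linear_scale)
  qed
  have "((\<lambda>\<tau>. \<Sum>i\<in>Basis. (\<xi> \<tau> \<bullet> i) * q \<tau> i) has_vector_derivative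
      (\<Sum>i\<in>Basis. (\<xi> t \<bullet> i) * q' i + (\<xi>' \<bullet> i) * q t i)) (at t within {a..b})"
    by (intro has_vector_derivative_sum has_vector_derivative_mult q'
        bounded_linear.has_vector_derivative[OF bounded_linear_inner_left] \<xi>)
  also have "(\<Sum>i\<in>Basis. (\<xi> t \<bullet> i) * q' i + (\<xi>' \<bullet> i) * q t i) = q' (\<xi> t) + q t \<xi>'"
    using expand[OF lin, of "\<xi> t"] expand[OF q[OF assms(2)], of \<xi>'] by (simp only: sum.distrib)
  finally show "((\<lambda>\<tau>. q \<tau> (\<xi> \<tau>)) has_vector_derivative q' (\<xi> t) + q t \<xi>') (at t within {a..b})"
    by (rule has_vector_derivative_transform[OF assms(2), rotated]) (simp only: expand[OF q, symmetric])
qed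

text \<open>The s-derivative of the integrand involves \<open>uts\<close>, obtained as the
  s-derivative of the velocity \<open>ut\<close>; equality of mixed partials identifies it with the
  t-derivative of the variation field \<open>us\<close>, which is the form integration by parts
  needs. On the compact rectangle the s-derivative passes under the integral by the Leibniz
  rule.\<close>

lemma first_variation:
  fixes u :: "real \<times> real \<Rightarrow> 'e::euclidean_space" and l :: "'e \<times> 'e \<Rightarrow> real"
  assumes ab: "a < b" and e: "0 < e" and U: "open U" and l: "smooth_on (U \<times> UNIV) l"
    and u: "smooth_on ({a..b} \<times> {-e..e}) u" "u ` ({a..b} \<times> {-e..e}) \<subseteq> U"
  obtains ut us and uts :: "real \<times> real \<Rightarrow> 'e" where
    "smooth_on ({a..b} \<times> {-e..e}) ut" "smooth_on ({a..b} \<times> {-e..e}) us"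
    "\<And>t s. t \<in> {a..b} \<Longrightarrow> s \<in> {-e..e} \<Longrightarrow>
      ((\<lambda>\<tau>. u (\<tau>, s)) has_vector_derivative ut (t, s)) (at t within {a..b})"
    "\<And>t. t \<in> {a..b} \<Longrightarrow> ((\<lambda>\<sigma>. u (t, \<sigma>)) has_vector_derivative us (t, 0)) (at 0)"
    "\<And>t. t \<in> {a..b} \<Longrightarrow> ((\<lambda>\<tau>. us (\<tau>, 0)) has_vector_derivative uts (t, 0)) (at t within {a..b})"
    "\<And>s. s \<in> {-e..e} \<Longrightarrow> continuous_on {a..b} (\<lambda>t. l (u (t, s), ut (t, s)))"
    "\<And>t. t \<in> {a..b} \<Longrightarrow> ((\<lambda>\<sigma>. l (u (t, \<sigma>), ut (t, \<sigma>))) has_vector_derivative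
      frechet_derivative l (at (u (t, 0), ut (t, 0))) (us (t, 0), uts (t, 0))) (at 0)"
    "continuous_on {a..b} (\<lambda>t. frechet_derivative l (at (u (t, 0), ut (t, 0))) (us (t, 0), uts (t, 0)))"
    "((\<lambda>s. integral {a..b} (\<lambda>t. l (u (t, s), ut (t, s)))) has_real_derivative
      integral {a..b} (\<lambda>t. frechet_derivative l (at (u (t, 0), ut (t, 0))) (us (t, 0), uts (t, 0)))) (at 0)"
proof -
  let ?R = "{a..b} \<times> {-e..e}"
  have e': "-e < e" and 0: "0 \<in> {-e..e}"
    using e by auto
  have at0: "(f has_vector_derivative f') (at 0)"
    if "(f has_vector_derivative f') (at 0 within {-e..e})" for f :: "real \<Rightarrow> 'x::real_normed_vector" and f'
    using that e at_within_interior[of 0 "{-e..e}"] by (simp add: interior_atLeastAtMost_real)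
  obtain ut where ut: "smooth_on ?R ut" "\<And>t s. t \<in> {a..b} \<Longrightarrow> s \<in> {-e..e} \<Longrightarrow>
      ((\<lambda>\<tau>. u (\<tau>, s)) has_vector_derivative ut (t, s)) (at t within {a..b})"
    by (rule smooth_on_partial_derivative[OF ab u(1)]) blast
  obtain us where us: "smooth_on ?R us" "\<And>t s. t \<in> {a..b} \<Longrightarrow> s \<in> {-e..e} \<Longrightarrow>
      ((\<lambda>\<sigma>. u (t, \<sigma>)) has_vector_derivative us (t, s)) (at s within {-e..e})"
    by (rule smooth_on_partial_derivative_snd[OF e' u(1)]) blast
  obtain uts where uts: "smooth_on ?R uts" "\<And>t s. t \<in> {a..b} \<Longrightarrow> s \<in> {-e..e} \<Longrightarrow>
      ((\<lambda>\<sigma>. ut (t, \<sigma>)) has_vector_derivative uts (t, s)) (at s within {-e..e})"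
    by (rule smooth_on_partial_derivative_snd[OF e' ut(1)]) blast
  define F where "F z = frechet_derivative l (at (u z, ut z)) (us z, uts z)" for z
  have UU: "open (U \<times> (UNIV :: 'e set))"
    using U by (simp add: open_Times)
  have dl: "(l has_derivative frechet_derivative l (at (u z, ut z))) (at (u z, ut z))"
    if "z \<in> ?R" for z
    using u(2) that by (intro smooth_on_has_derivative[OF UU l]) auto
  have G: "smooth_on ?R (\<lambda>z. l (u z, ut z))"
    by (rule smooth_on_compose[OF smooth_on_Pair[OF u(1) ut(1)] l]) (use u(2) in auto)
  have dG: "((\<lambda>\<sigma>. l (u (t, \<sigma>), ut (t, \<sigma>))) has_vector_derivative F (t, s)) (at s within {-e..e})"
    if "t \<in> {a..b}" "s \<in> {-e..e}" for t s
    using vector_derivative_diff_chain_within[OF has_vector_derivative_Pair[OF us(2) uts(2)]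
        has_derivative_at_withinI[OF dl[of "(t, s)"]]] that
    by (simp add: o_def F_def)
  \<comment> \<open>F evaluates a varying derivative in a varying direction. Its continuity is read
    off indirectly: F is the s-derivative of the function in \<open>G\<close>, which is smooth on
    the rectangle, and derivatives are unique.\<close>
  have F: "continuous_on ?R F"
  proof -
    obtain G' where G': "smooth_on ?R G'" "\<And>t s. t \<in> {-e..e} \<Longrightarrow> s \<in> {a..b} \<Longrightarrow>
        ((\<lambda>\<sigma>. l (u (s, \<sigma>), ut (s, \<sigma>))) has_vector_derivative G' (s, t)) (at t within {-e..e})"
      by (rule smooth_on_partial_derivative_snd[OF e' G]) blast
    have "G' (t, s) = F (t, s)" if "t \<in> {a..b}" "s \<in> {-e..e}" for t s
      using vector_derivative_unique_within[OF at_within_Icc_nontrivial[OF e']] G'(2) dG that by blast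
    then show ?thesis
      by (intro continuous_on_eq[OF smooth_on_imp_continuous_on[OF G'(1)]]) auto
  qed
  have cont: "continuous_on {a..b} (\<lambda>t. l (u (t, s), ut (t, s)))" if "s \<in> {-e..e}" for s
    by (rule continuous_on_compose2[OF smooth_on_imp_continuous_on[OF G], of "{a..b}" "\<lambda>t. (t, s)"])
      (use that in \<open>auto intro!: continuous_intros\<close>)
  have "((\<lambda>s. integral (cbox a b) (\<lambda>t. l (u (t, s), ut (t, s)))) has_vector_derivative
      integral (cbox a b) (\<lambda>t. F (t, 0))) (at 0 within {-e..e})"
  proof (rule leibniz_rule_vector_derivative)
    show "continuous_on ({-e..e} \<times> cbox a b) (\<lambda>(x, t). F (t, x))"
      unfolding split_beta by (intro continuous_on_compose2[OF F] continuous_intros) auto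
  qed (use dG cont 0 in \<open>auto intro: integrable_continuous_real\<close>)
  then have int: "((\<lambda>s. integral {a..b} (\<lambda>t. l (u (t, s), ut (t, s)))) has_real_derivative
      integral {a..b} (\<lambda>t. F (t, 0))) (at 0)"
    using at0 by (simp add: has_real_derivative_iff_has_vector_derivative)
  have F0: "continuous_on {a..b} (\<lambda>t. F (t, 0))"
    by (rule continuous_on_compose2[OF F]) (use 0 in \<open>auto intro!: continuous_intros\<close>)
  have mixed: "((\<lambda>\<tau>. us (\<tau>, 0)) has_vector_derivative uts (t, 0)) (at t within {a..b})"
    if "t \<in> {a..b}" for t
    by (rule mixed_partial_derivatives[OF ab e' smooth_on_imp_continuous_on[OF ut(1)]
          smooth_on_imp_continuous_on[OF uts(1)] ut(2) us(2) uts(2) that 0])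
  show thesis
    by (rule that[of ut us uts])
      (fact ut us(1) at0[OF us(2)[OF _ 0]] mixed cont at0[OF dG[OF _ 0], unfolded F_def]
          F0[unfolded F_def] int[unfolded F_def])+
qed

text \<open>Near a point where f does not vanish it keeps its sign, and a quadratic bump on a small
  interval there gives a nonzero weighted integral. Multiplying by the constant f t treats both
  signs at once.\<close>

lemma continuous_zero_if_bump_integrals_zero:
  fixes f :: "real \<Rightarrow> real"
  assumes "a < b" "continuous_on {a..b} f"
    and zero: "\<And>c d. a \<le> c \<Longrightarrow> c < d \<Longrightarrow> d \<le> b \<Longrightarrow> integral {c..d} (\<lambda>t. (t - c) * (d - t) * f t) = 0"
    and t: "t \<in> {a..b}"
  shows "f t = 0"
proof (rule ccontr)
  assume nz: "f t \<noteq> 0"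
  have "continuous_on {a..b} (\<lambda>\<tau>. f t * f \<tau>)"
    using assms(2) by (intro continuous_intros)
  moreover have "f t * f t > 0"
    using nz by (metis not_real_square_gt_zero)
  ultimately obtain r where r: "r > 0" "\<forall>\<tau>\<in>{a..b}. dist \<tau> t < r \<longrightarrow> dist (f t * f \<tau>) (f t * f t) < f t * f t"
    using t unfolding continuous_on_iff by blast
  have r': "f t * f \<tau> > 0" if "\<tau> \<in> {a..b}" "dist \<tau> t < r" for \<tau>
    using r(2) that unfolding dist_real_def by fastforce
  \<comment> \<open>The interval of radius r/2 about t, cut off at a and b since t may be an end
    point; the half keeps the closed ends strictly within distance r of t.\<close>
  define c d where "c = max a (t - r / 2)" and "d = min b (t + r / 2)"
  have cd: "a \<le> c" "c < d" "d \<le> b"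
    using assms(1) t r(1) by (auto simp: c_def d_def)
  have pos: "f t * f \<tau> > 0" if "\<tau> \<in> {c..d}" for \<tau>
    using that r(1) cd by (intro r') (auto simp: c_def d_def dist_real_def)
  define g where "g \<tau> = (\<tau> - c) * (d - \<tau>) * (f t * f \<tau>)" for \<tau>
  have "integral {c..d} g = f t * integral {c..d} (\<lambda>\<tau>. (\<tau> - c) * (d - \<tau>) * f \<tau>)"
    unfolding integral_mult_right[symmetric] g_def by (simp add: mult_ac)
  then have "integral {c..d} g = 0"
    using zero[OF cd] by simp
  moreover have "continuous_on {c..d} g"
    unfolding g_def using cd by (intro continuous_intros continuous_on_subset[OF assms(2)]) auto
  moreover have "g \<tau> \<ge> 0" if "\<tau> \<in> {c..d}" for \<tau>
    unfolding g_def using that by (intro mult_nonneg_nonneg[OF mult_nonneg_nonneg less_imp_le[OF pos]]) auto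
  ultimately have "\<forall>\<tau>\<in>{c..d}. g \<tau> = 0"
    using cd by (subst (asm) integral_eq_0_iff) auto
  then have "g ((c + d) / 2) = 0"
    using cd by auto
  moreover have "g ((c + d) / 2) > 0"
    unfolding g_def using cd by (intro mult_pos_pos[OF mult_pos_pos pos]) auto
  ultimately show False
    by simp
qed

lemma smooth_on_frechet_derivative_along:
  fixes l :: "'e::euclidean_space \<times> 'e \<Rightarrow> real"
  assumes "open U" "smooth_on (U \<times> UNIV) l" "smooth_on S u" "smooth_on S v" "u ` S \<subseteq> U"
  shows "smooth_on S (\<lambda>t. frechet_derivative l (at (u t, v t)) k)"
  by (rule smooth_on_compose[OF smooth_on_Pair[OF assms(3,4)] smooth_on_frechet_derivative[OF _ assms(2)]])
    (use assms(1,5) in \<open>auto intro: open_Times\<close>)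

lemma linear_frechet_derivative_on:
  fixes l :: "'e::euclidean_space \<times> 'e \<Rightarrow> real"
  assumes "open U" "smooth_on (U \<times> UNIV) l" "x \<in> U"
  shows "linear (frechet_derivative l (at (x, w)))"
    and "linear (\<lambda>h. frechet_derivative l (at (x, w)) (0, h))"
    and "linear (\<lambda>h. frechet_derivative l (at (x, w)) (h, 0))"
proof -
  have "(l has_derivative frechet_derivative l (at (x, w))) (at (x, w))"
    using assms by (intro smooth_on_has_derivative[of "U \<times> UNIV"]) (auto intro: open_Times)
  then show lin: "linear (frechet_derivative l (at (x, w)))"
    by (rule has_derivative_linear)
  have "linear (\<lambda>h. (0 :: 'e, h))" "linear (\<lambda>h. (h, 0 :: 'e))"
    by (auto intro!: linearI)
  from linear_compose[OF this(1) lin] linear_compose[OF this(2) lin]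
  show "linear (\<lambda>h. frechet_derivative l (at (x, w)) (0, h))"
    "linear (\<lambda>h. frechet_derivative l (at (x, w)) (h, 0))"
    by (simp_all add: o_def)
qed

lemma frechet_derivative_split:
  fixes l :: "'e::euclidean_space \<times> 'e \<Rightarrow> real"
  assumes "open U" "smooth_on (U \<times> UNIV) l" "x \<in> U"
  shows "frechet_derivative l (at (x, w)) (h, k) =
    frechet_derivative l (at (x, w)) (h, 0) + frechet_derivative l (at (x, w)) (0, k)"
  using linear_add[OF linear_frechet_derivative_on(1)[OF assms], of w "(h, 0)" "(0, k)"] by simp

lemma momentum_derivative:
  fixes l :: "'e::euclidean_space \<times> 'e \<Rightarrow> real"
  assumes "a < b" "open U" "smooth_on (U \<times> UNIV) l" "smooth_on {a..b} u" "smooth_on {a..b} v"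
    "u ` {a..b} \<subseteq> U"
  obtains p' where "\<And>h. continuous_on {a..b} (\<lambda>t. p' t h)"
    "\<And>t h. t \<in> {a..b} \<Longrightarrow>
      ((\<lambda>\<tau>. frechet_derivative l (at (u \<tau>, v \<tau>)) (0, h)) has_vector_derivative p' t h) (at t within {a..b})"
proof -
  let ?m = "\<lambda>h \<tau>. frechet_derivative l (at (u \<tau>, v \<tau>)) (0, h)"
  \<comment> \<open>A canonical choice: one function of t and h together, where the smoothness of
    each component would only give a separate derivative for each h.\<close>
  define p' where "p' t h = vector_derivative (?m h) (at t within {a..b})" for t h
  have "continuous_on {a..b} (\<lambda>t. p' t h) \<and> (\<forall>t\<in>{a..b}. (?m h has_vector_derivative p' t h) (at t within {a..b}))" for h
  proof (rule smooth_on_vector_derivative[OF assms(1) smooth_on_frechet_derivative_along[OF assms(2-6), of "(0, h)"]])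
    fix m' assume m': "smooth_on {a..b} m'"
      "\<And>t. t \<in> {a..b} \<Longrightarrow> (?m h has_vector_derivative m' t) (at t within {a..b})"
    then have eq: "p' t h = m' t" if "t \<in> {a..b}" for t
      unfolding p'_def using that
      by (intro vector_derivative_within at_within_Icc_nontrivial assms(1))
    then have "continuous_on {a..b} (\<lambda>t. p' t h)"
      using continuous_on_eq[OF smooth_on_imp_continuous_on[OF m'(1)]] by metis
    then show ?thesis
      using m'(2) eq by simp
  qed
  then show thesis
    by (intro that[of p']) blast+
qed

text \<open>Since (p \<eta>)' = p' \<eta> + p \<eta>', the integrand is the Euler-Lagrange residual
  plus a total derivative. The residual enters through a prescribed integral E, so that either a
  computed integral or the value 0 can be supplied.\<close>

lemma first_variation_by_parts:
  fixes l :: "'e::euclidean_space \<times> 'e \<Rightarrow> real"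
  assumes "a < b" "open U" "smooth_on (U \<times> UNIV) l" "u ` {a..b} \<subseteq> U"
    and p': "\<And>t h. t \<in> {a..b} \<Longrightarrow>
      ((\<lambda>\<tau>. frechet_derivative l (at (u \<tau>, v \<tau>)) (0, h)) has_vector_derivative p' t h) (at t within {a..b})"
    and \<eta>: "\<And>t. t \<in> {a..b} \<Longrightarrow> (\<eta> has_vector_derivative \<eta>' t) (at t within {a..b})"
    and E: "((\<lambda>t. frechet_derivative l (at (u t, v t)) (\<eta> t, 0) - p' t (\<eta> t)) has_integral E) {a..b}"
  shows "((\<lambda>t. frechet_derivative l (at (u t, v t)) (\<eta> t, \<eta>' t)) has_integral
    E + (frechet_derivative l (at (u b, v b)) (0, \<eta> b) - frechet_derivative l (at (u a, v a)) (0, \<eta> a))) {a..b}"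
proof -
  let ?D = "\<lambda>t. frechet_derivative l (at (u t, v t))"
  have U: "u t \<in> U" if "t \<in> {a..b}" for t
    using assms(4) that by blast
  have "((\<lambda>\<tau>. ?D \<tau> (0, \<eta> \<tau>)) has_vector_derivative p' t (\<eta> t) + ?D t (0, \<eta>' t)) (at t within {a..b})"
    if "t \<in> {a..b}" for t
    by (rule has_vector_derivative_linear_pairing(1)[OF assms(1) that _ p'[OF that] \<eta>[OF that]])
      (rule linear_frechet_derivative_on(2)[OF assms(2,3) U])
  then have "((\<lambda>t. p' t (\<eta> t) + ?D t (0, \<eta>' t)) has_integral ?D b (0, \<eta> b) - ?D a (0, \<eta> a)) {a..b}"
    using assms(1) by (intro fundamental_theorem_of_calculus) auto
  from has_integral_add[OF E this]
  have "((\<lambda>t. ?D t (\<eta> t, 0) - p' t (\<eta> t) + (p' t (\<eta> t) + ?D t (0, \<eta>' t))) has_integral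
      E + (?D b (0, \<eta> b) - ?D a (0, \<eta> a))) {a..b}" .
  then show ?thesis
    by (rule has_integral_eq[rotated])
      (subst frechet_derivative_split[OF assms(2,3) U, where h="\<eta> _"], simp_all)
qed

section \<open>Charts and the local Lagrangian\<close>

definition local_lagrangian ::
    "('q, 'e::real_normed_vector) chart set \<Rightarrow> (('q, 'e) tangent \<Rightarrow> real) \<Rightarrow> ('q, 'e) chart \<Rightarrow> 'e \<times> 'e \<Rightarrow> real" where
  "local_lagrangian A L c = (\<lambda>(u, w). L (cinv c u, tvec A c (cinv c u) w))"

text \<open>The Jacobian at x of the transition from c to d. Both \<open>tcoord\<close> and
  \<open>tvec\<close> are instances in which one of the two charts is the representing one, so a
  single cocycle rule governs all coordinate changes.\<close>

definition jac :: "('q, 'e::real_normed_vector) chart \<Rightarrow> ('q, 'e) chart \<Rightarrow> 'q \<Rightarrow> 'e \<Rightarrow> 'e" where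
  "jac c d x = frechet_derivative (cmap d \<circ> cinv c) (at (cmap c x))"

lemma tcoord_eq_jac: "tcoord A c x = jac (chart_at A x) c x"
  by (simp add: fun_eq_iff tcoord_def jac_def pcoord_def)

lemma tvec_eq_jac: "tvec A c x = jac c (chart_at A x) x"
  by (simp add: fun_eq_iff tvec_def jac_def)

locale manifold =
  fixes A :: "('q::{t2_space,second_countable_topology}, 'e::euclidean_space) chart set"
  assumes smooth_manifold: "smooth_manifold A"
begin

section \<open>Charts, transition maps and their Jacobians\<close>

lemma
  assumes "c \<in> A"
  shows open_cdom: "open (cdom c)"
    and open_chart_image: "open (cmap c ` cdom c)"
    and chart_homeomorphism: "homeomorphism (cdom c) (cmap c ` cdom c) (cmap c) (cinv c)"
  using smooth_manifold assms unfolding smooth_manifold_def by blast+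

lemma
  assumes "c \<in> A"
  shows continuous_on_cmap: "continuous_on (cdom c) (cmap c)"
    and continuous_on_cinv: "continuous_on (cmap c ` cdom c) (cinv c)"
    and cinv_cmap: "x \<in> cdom c \<Longrightarrow> cinv c (cmap c x) = x"
    and cmap_cinv: "y \<in> cmap c ` cdom c \<Longrightarrow> cmap c (cinv c y) = y"
    and cinv_in_cdom: "y \<in> cmap c ` cdom c \<Longrightarrow> cinv c y \<in> cdom c"
  using chart_homeomorphism[OF assms] unfolding homeomorphism_def by auto

lemma chart_at: "chart_at A x \<in> A" "x \<in> cdom (chart_at A x)"
proof -
  have "\<exists>c. c \<in> A \<and> x \<in> cdom c"
    using smooth_manifold unfolding smooth_manifold_def by blast
  then have "chart_at A x \<in> A \<and> x \<in> cdom (chart_at A x)"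
    unfolding chart_at_def by (rule someI_ex)
  then show "chart_at A x \<in> A" "x \<in> cdom (chart_at A x)"
    by auto
qed

lemma open_overlap:
  assumes "c \<in> A" "d \<in> A"
  shows "open (cmap c ` (cdom c \<inter> cdom d))"
proof -
  have "cmap c ` (cdom c \<inter> cdom d) = (cmap c ` cdom c) \<inter> cinv c -` cdom d"
    using cinv_cmap[OF assms(1)] by auto
  then show ?thesis
    using continuous_open_preimage[OF continuous_on_cinv open_chart_image open_cdom] assms by simp
qed

lemma transition_smooth:
  assumes "c \<in> A" "d \<in> A"
  shows "smooth_on (cmap c ` (cdom c \<inter> cdom d)) (cmap d \<circ> cinv c)"
  using smooth_manifold assms unfolding smooth_manifold_def by blast

lemma transition_has_derivative:
  assumes "c \<in> A" "d \<in> A" "x \<in> cdom c" "x \<in> cdom d"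
  shows "(cmap d \<circ> cinv c has_derivative jac c d x) (at (cmap c x))"
  unfolding jac_def
  by (rule smooth_on_has_derivative[OF open_overlap transition_smooth]) (use assms in auto)

lemma linear_jac:
  assumes "c \<in> A" "d \<in> A" "x \<in> cdom c" "x \<in> cdom d"
  shows "linear (jac c d x)"
  using transition_has_derivative[OF assms] by (rule has_derivative_linear)

text \<open>Near x the transition from c to f factors through d, and the chain rule gives the
  cocycle identity. Together with \<open>jac_self\<close> it makes \<open>tcoord\<close> and
  \<open>tvec\<close> mutually inverse.\<close>

lemma jac_jac:
  assumes "c \<in> A" "d \<in> A" "f \<in> A" "x \<in> cdom c" "x \<in> cdom d" "x \<in> cdom f"
  shows "jac d f x (jac c d x v) = jac c f x v"
proof -
  have x: "cmap d x = (cmap d \<circ> cinv c) (cmap c x)"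
    using assms cinv_cmap by simp
  have "((\<lambda>y. (cmap f \<circ> cinv d) ((cmap d \<circ> cinv c) y)) has_derivative (\<lambda>v. jac d f x (jac c d x v))) (at (cmap c x))"
    by (rule has_derivative_compose[OF transition_has_derivative]; (subst x[symmetric])?)
      (use transition_has_derivative assms in auto)
  then have "(cmap f \<circ> cinv c has_derivative (\<lambda>v. jac d f x (jac c d x v))) (at (cmap c x))"
    by (rule has_derivative_transform_within_open[OF _ open_overlap[OF assms(1,2)]])
      (use assms(4,5) cinv_cmap[OF assms(1)] cinv_cmap[OF assms(2)] in \<open>auto simp: image_iff\<close>)
  from has_derivative_unique[OF this transition_has_derivative[OF assms(1,3,4,6)]]
  show ?thesis
    by (rule fun_cong)
qed

lemma jac_self:
  assumes "c \<in> A" "x \<in> cdom c"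
  shows "jac c c x v = v"
proof -
  have "(cmap c \<circ> cinv c has_derivative (\<lambda>v. v)) (at (cmap c x))"
    by (rule has_derivative_transform_within_open[OF has_derivative_ident open_chart_image[OF assms(1)]])
      (use assms cmap_cinv in auto)
  from has_derivative_unique[OF transition_has_derivative[OF assms(1,1,2,2)] this]
  show ?thesis
    by (rule fun_cong)
qed

lemma
  assumes "c \<in> A" "x \<in> cdom c"
  shows tcoord_tvec: "tcoord A c x (tvec A c x w) = w"
    and tvec_tcoord: "tvec A c x (tcoord A c x v) = v"
    and linear_tcoord: "linear (tcoord A c x)"
  using assms chart_at[of x] unfolding tcoord_eq_jac tvec_eq_jac
  by (simp_all add: jac_jac jac_self linear_jac)

lemma tcoord_chart_at: "tcoord A (chart_at A x) x v = v"
  unfolding tcoord_eq_jac using jac_self[OF chart_at] .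

text \<open>The two coordinate curves are related by the transition map only while the curve stays
  in \<open>cdom c\<close>; continuity at t guarantees this near t. The set S allows one-sided
  derivatives at corners and end points and, as \<open>UNIV\<close>, the s-direction of a
  variation.\<close>

lemma curve_change_of_chart:
  fixes \<gamma> :: "real \<Rightarrow> 'q"
  assumes "c \<in> A" "d \<in> A" "\<gamma> t \<in> cdom c" "\<gamma> t \<in> cdom d" "t \<in> S"
    and cont: "continuous (at t within S) \<gamma>"
    and deriv: "(cmap c \<circ> \<gamma> has_vector_derivative w) (at t within S)"
  shows "(cmap d \<circ> \<gamma> has_vector_derivative jac c d (\<gamma> t) w) (at t within S)"
proof -
  have "((cmap d \<circ> cinv c) \<circ> (cmap c \<circ> \<gamma>) has_vector_derivative jac c d (\<gamma> t) w) (at t within S)"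
    by (rule vector_derivative_diff_chain_within[OF deriv])
      (simp only: o_apply[of "cmap c" \<gamma> t] has_derivative_at_withinI[OF transition_has_derivative[OF assms(1-4)]])
  then have "((cmap d \<circ> cinv c) \<circ> (cmap c \<circ> \<gamma>) has_derivative (\<lambda>h. h *\<^sub>R jac c d (\<gamma> t) w)) (at t within S)"
    by (simp add: has_vector_derivative_def)
  moreover have "\<forall>\<^sub>F \<tau> in at t within S. \<gamma> \<tau> \<in> cdom c"
    using cont open_cdom[OF assms(1)] assms(3) unfolding continuous_within by (rule topological_tendstoD)
  then have "\<forall>\<^sub>F \<tau> in at t within S. ((cmap d \<circ> cinv c) \<circ> (cmap c \<circ> \<gamma>)) \<tau> = (cmap d \<circ> \<gamma>) \<tau>"
    by eventually_elim (simp add: cinv_cmap[OF assms(1)])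
  ultimately have "(cmap d \<circ> \<gamma> has_derivative (\<lambda>h. h *\<^sub>R jac c d (\<gamma> t) w)) (at t within S)"
    by (rule has_derivative_transform_eventually) (use assms in \<open>auto simp: cinv_cmap\<close>)
  then show ?thesis
    by (simp add: has_vector_derivative_def)
qed

lemma velocity_in_chart:
  assumes "t0 < t1" "t \<in> {t0..t1}" "c \<in> A" "\<gamma> t \<in> cdom c"
    and "continuous (at t within {t0..t1}) \<gamma>"
    and "(cmap c \<circ> \<gamma> has_vector_derivative w) (at t within {t0..t1})"
  shows "velocity A t0 t1 \<gamma> t = (\<gamma> t, tvec A c (\<gamma> t) w)"
proof -
  have "(cmap (chart_at A (\<gamma> t)) \<circ> \<gamma> has_vector_derivative tvec A c (\<gamma> t) w) (at t within {t0..t1})"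
    unfolding tvec_eq_jac using assms by (intro curve_change_of_chart chart_at) auto
  from vector_derivative_within[OF at_within_Icc_nontrivial[OF assms(1,2)] this]
  show ?thesis
    by (simp add: velocity_def)
qed

text \<open>\<open>velocity\<close> differentiates within {t0..t1}, coordinate derivatives come
  within a piece {a..b}. Both are two-sided at interior points of the piece; at a corner they may
  differ.\<close>

lemma velocity_in_chart_interior:
  assumes "t0 \<le> a" "b \<le> t1" "t \<in> {a<..<b}" "c \<in> A" "\<gamma> t \<in> cdom c"
    and "continuous_on {a..b} \<gamma>"
    and "(cmap c \<circ> \<gamma> has_vector_derivative w) (at t within {a..b})"
  shows "velocity A t0 t1 \<gamma> t = (\<gamma> t, tvec A c (\<gamma> t) w)"
proof -
  have "at t within {t0..t1} = at t" "at t within {a..b} = at t"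
    using assms(1-3) by (auto intro!: at_within_interior simp: interior_atLeastAtMost_real)
  moreover have "continuous (at t within {a..b}) \<gamma>"
    using assms(3,6) by (auto simp: continuous_on_eq_continuous_within)
  ultimately show ?thesis
    using assms by (intro velocity_in_chart) auto
qed

lemma smooth_map_on_subset:
  assumes "smooth_map_on A S F" "T \<subseteq> S"
  shows "smooth_map_on A T F"
  using assms unfolding smooth_map_on_def
  by (auto intro: continuous_on_subset smooth_on_subset)

lemma smooth_map_on_chart:
  assumes "smooth_map_on A S F" "c \<in> A" "F ` S \<subseteq> cdom c"
  shows "smooth_on S (cmap c \<circ> F)"
proof -
  have "S \<inter> F -` cdom c = S"
    using assms(3) by auto
  then show ?thesis
    using assms(1,2) unfolding smooth_map_on_def by metis
qed

end

section \<open>The Lagrangian in a fixed chart\<close>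

locale lagrangian_manifold = manifold A for A :: "('q::{t2_space,second_countable_topology}, 'e::euclidean_space) chart set" +
  fixes L :: "('q, 'e) tangent \<Rightarrow> real"
  assumes smooth_lagrangian: "smooth_on_TQ A L"
begin

abbreviation "lc \<equiv> local_lagrangian A L"

lemma lc_smooth: "c \<in> A \<Longrightarrow> smooth_on ((cmap c ` cdom c) \<times> UNIV) (lc c)"
  using smooth_lagrangian unfolding smooth_on_TQ_def local_lagrangian_def by blast

lemma lagrangian_tvec:
  assumes "c \<in> A" "x \<in> cdom c"
  shows "L (x, tvec A c x w) = lc c (cmap c x, w)"
  using assms by (simp add: local_lagrangian_def cinv_cmap)

lemma lagrangian_tcoord:
  assumes "c \<in> A" "x \<in> cdom c"
  shows "L (x, v) = lc c (cmap c x, tcoord A c x v)"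
  using lagrangian_tvec[OF assms, of "tcoord A c x v"] assms by (simp add: tvec_tcoord)

lemma lc_has_derivative:
  assumes "c \<in> A" "x \<in> cdom c"
  shows "(lc c has_derivative frechet_derivative (lc c) (at (cmap c x, w))) (at (cmap c x, w))"
  by (rule smooth_on_has_derivative[OF _ lc_smooth])
    (use assms open_chart_image in \<open>auto intro: open_Times\<close>)

text \<open>On a fixed fibre the passage to the chart is a linear map, hence its own derivative.
  This makes the Legendre map computable in any chart.\<close>

lemma lagrangian_fibre_derivative:
  assumes "c \<in> A" "x \<in> cdom c"
  shows "((\<lambda>w. L (x, w)) has_derivative
    (\<lambda>k. frechet_derivative (lc c) (at (cmap c x, tcoord A c x v)) (0, tcoord A c x k))) (at v)"
proof -
  have "((\<lambda>w. (cmap c x, tcoord A c x w)) has_derivative (\<lambda>k. (0, tcoord A c x k))) (at v)"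
    using linear_tcoord[OF assms]
    by (auto intro!: has_derivative_Pair bounded_linear_imp_has_derivative simp: linear_conv_bounded_linear)
  from has_derivative_compose[OF this lc_has_derivative[OF assms]]
  show ?thesis
    unfolding lagrangian_tcoord[OF assms] .
qed

lemma Legendre_apply:
  assumes "c \<in> A" "x \<in> cdom c"
  shows "blinfun_apply (snd (Legendre L (x, v))) k =
    frechet_derivative (lc c) (at (cmap c x, tcoord A c x v)) (0, tcoord A c x k)"
proof -
  note d = lagrangian_fibre_derivative[OF assms, of v]
  show ?thesis
    using has_derivative_bounded_linear[OF d]
    by (simp add: Legendre_def bounded_linear_Blinfun_apply frechet_derivative_at[OF d, symmetric])
qed

end

section \<open>The Euler-Poincare equation in coordinates\<close>

text \<open>A covector is the combination of the dual basis with its values on \<open>Basis\<close>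
  as coefficients, so finitely many scalar derivatives assemble to the derivative in the dual that
  the Euler-Poincare equation asks for.\<close>

lemma blinfun_has_vector_derivative_componentwise:
  fixes N :: "real \<Rightarrow> 'g::euclidean_space \<Rightarrow>\<^sub>L real"
  assumes "\<And>Y. ((\<lambda>\<tau>. blinfun_apply (N \<tau>) Y) has_vector_derivative d Y) F"
  shows "\<exists>D. (N has_vector_derivative D) F"
proof -
  have eq: "B = (\<Sum>i\<in>Basis. blinfun_apply B i *\<^sub>R blinfun_inner_left i)" for B :: "'g \<Rightarrow>\<^sub>L real"
  proof (rule blinfun_eqI)
    fix Y
    have "blinfun_apply B Y = blinfun_apply B (\<Sum>i\<in>Basis. (Y \<bullet> i) *\<^sub>R i)"
      by (simp add: euclidean_representation)
    also have "\<dots> = blinfun_apply (\<Sum>i\<in>Basis. blinfun_apply B i *\<^sub>R blinfun_inner_left i) Y"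
      by (simp add: blinfun.sum_right blinfun.sum_left blinfun.scaleR_left blinfun.scaleR_right mult.commute)
    finally show "blinfun_apply B Y = blinfun_apply (\<Sum>i\<in>Basis. blinfun_apply B i *\<^sub>R blinfun_inner_left i) Y" .
  qed
  have "((\<lambda>\<tau>. \<Sum>i\<in>Basis. blinfun_apply (N \<tau>) i *\<^sub>R blinfun_inner_left i) has_vector_derivative
      (\<Sum>i\<in>Basis. d i *\<^sub>R (blinfun_inner_left i :: 'g \<Rightarrow>\<^sub>L real))) F"
    by (intro has_vector_derivative_sum bounded_linear.has_vector_derivative[OF bounded_linear_scaleR_left] assms)
  then show ?thesis
    unfolding eq[symmetric] by blast
qed

locale lagrangian_action = lagrangian_manifold A L
  for A :: "('q::{t2_space,second_countable_topology}, 'e::euclidean_space) chart set"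
    and L :: "('q, 'e) tangent \<Rightarrow> real" +
  fixes br :: "'g::euclidean_space \<Rightarrow> 'g \<Rightarrow> 'g" and \<psi> :: "'g \<Rightarrow> 'q \<Rightarrow> 'e"
  assumes lie_algebra: "lie_algebra br"
    and action: "lie_algebra_action A br \<psi>"
    and transitive: "locally_transitive \<psi>"
begin

abbreviation "momentum \<equiv> momentum_map \<psi> \<circ> Legendre L \<circ> phi \<psi>"

lemma linear_action: "linear (\<lambda>X. \<psi> X x)"
  using action unfolding lie_algebra_action_def by blast

lemma bounded_linear_action: "bounded_linear (\<lambda>X. \<psi> X x)"
  using linear_action by (simp add: linear_conv_bounded_linear)

lemma action_bracket: "\<psi> (br X Y) = vf_bracket A (\<psi> X) (\<psi> Y)"
  using action unfolding lie_algebra_action_def by blast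

lemma smooth_vf_rep: "c \<in> A \<Longrightarrow> smooth_on (cmap c ` cdom c) (vf_rep A c (\<psi> X))"
  using action unfolding lie_algebra_action_def smooth_vector_field_def by blast

lemma vf_rep_cmap: "c \<in> A \<Longrightarrow> x \<in> cdom c \<Longrightarrow> vf_rep A c X (cmap c x) = tcoord A c x (X x)"
  by (simp add: vf_rep_def cinv_cmap)

lemma vf_rep_has_derivative:
  assumes "c \<in> A" "x \<in> cdom c"
  shows "(vf_rep A c (\<psi> X) has_derivative frechet_derivative (vf_rep A c (\<psi> X)) (at (cmap c x))) (at (cmap c x))"
  by (rule smooth_on_has_derivative[OF open_chart_image smooth_vf_rep]) (use assms in auto)

lemma transitive_obtain:
  obtains X where "\<psi> X x = v"
  using transitive unfolding locally_transitive_def by (metis rangeE UNIV_I)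

lemma momentum_map_apply: "blinfun_apply (momentum_map \<psi> (x, \<xi>)) X = blinfun_apply \<xi> (\<psi> X x)"
  unfolding momentum_map_def
  by (simp add: bounded_linear_Blinfun_apply bounded_linear_compose[OF blinfun.bounded_linear_right bounded_linear_action])

lemma momentum_apply:
  assumes "c \<in> A" "x \<in> cdom c"
  shows "blinfun_apply (momentum (x, X)) Y =
    frechet_derivative (lc c) (at (cmap c x, tcoord A c x (\<psi> X x))) (0, tcoord A c x (\<psi> Y x))"
  using Legendre_apply[OF assms, of "\<psi> X x" "\<psi> Y x"] momentum_map_apply[of x "snd (Legendre L (x, \<psi> X x))" Y]
  by (simp add: phi_def Legendre_def)

text \<open>On the fibre over x the map \<open>phi\<close> is linear in X, so the chain rule turns
  the derivative in X into the fibre derivative of L applied to the value at x of the field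
  \<open>\<psi> Y\<close>.\<close>

lemma d_g_Lbar: "d_g (Lbar \<psi> L) = momentum"
proof (rule ext, clarify)
  fix x X
  note d = lagrangian_fibre_derivative[OF chart_at, of x "\<psi> X x"]
  have "((\<lambda>Y. L (x, \<psi> Y x)) has_derivative (\<lambda>Y. frechet_derivative (\<lambda>w. L (x, w)) (at (\<psi> X x)) (\<psi> Y x))) (at X)"
    using has_derivative_compose[OF bounded_linear_imp_has_derivative[OF bounded_linear_action] d[unfolded frechet_derivative_at[OF d]]]
    by simp
  from frechet_derivative_at[OF this]
  have "d_g (Lbar \<psi> L) (x, X) = Blinfun (\<lambda>Y. frechet_derivative (\<lambda>w. L (x, w)) (at (\<psi> X x)) (\<psi> Y x))"
    by (simp add: d_g_def Lbar_def phi_def)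
  also have "\<dots> = momentum (x, X)"
    using has_derivative_bounded_linear[OF d, unfolded frechet_derivative_at[OF d]]
    by (simp add: momentum_map_def Legendre_def phi_def bounded_linear_Blinfun_apply)
  finally show "d_g (Lbar \<psi> L) (x, X) = momentum (x, X)" .
qed

lemma Omega_eq: "Omega A \<psi> L = momentum_map \<psi> \<circ> d_Q A (Lbar \<psi> L)"
proof (rule ext)
  fix z
  obtain x \<xi> where "d_Q A (Lbar \<psi> L) z = (x, \<xi>)"
    by fastforce
  then show "Omega A \<psi> L z = (momentum_map \<psi> \<circ> d_Q A (Lbar \<psi> L)) z"
    by (auto intro!: blinfun_eqI simp: Omega_def phi_transpose_def phi_def momentum_map_apply
        bounded_linear_Blinfun_apply bounded_linear_action)
qed

text \<open>With X fixed, moving the point moves both slots of the local Lagrangian: the base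
  coordinate directly, and the velocity through the field \<open>\<psi> X\<close>, whose derivative
  along \<open>\<psi> Y\<close> is the second component. The chart is the representing one because
  \<open>differential\<close> is taken there; \<open>tcoord\<close> is then the identity.\<close>

lemma Omega_apply:
  assumes "c = chart_at A x"
  shows "blinfun_apply (Omega A \<psi> L (x, X)) Y =
    frechet_derivative (lc c) (at (cmap c x, \<psi> X x))
      (\<psi> Y x, frechet_derivative (vf_rep A c (\<psi> X)) (at (cmap c x)) (\<psi> Y x))"
proof -
  have c: "c \<in> A" "x \<in> cdom c"
    using assms chart_at by auto
  have rep: "vf_rep A c (\<psi> X) (cmap c x) = \<psi> X x"
    using vf_rep_cmap[OF c] tcoord_chart_at assms by simp
  have "((\<lambda>u. (u, vf_rep A c (\<psi> X) u)) has_derivative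
      (\<lambda>h. (h, frechet_derivative (vf_rep A c (\<psi> X)) (at (cmap c x)) h))) (at (cmap c x))"
    by (intro has_derivative_Pair has_derivative_ident vf_rep_has_derivative c)
  from has_derivative_compose[OF this, of "lc c"] lc_has_derivative[OF c, of "\<psi> X x"]
  have "((\<lambda>u. lc c (u, vf_rep A c (\<psi> X) u)) has_derivative
      (\<lambda>h. frechet_derivative (lc c) (at (cmap c x, \<psi> X x))
        (h, frechet_derivative (vf_rep A c (\<psi> X)) (at (cmap c x)) h))) (at (cmap c x))"
    by (simp add: rep)
  then have d: "((\<lambda>y. L (y, \<psi> X y)) \<circ> cinv c has_derivative
      (\<lambda>h. frechet_derivative (lc c) (at (cmap c x, \<psi> X x))
        (h, frechet_derivative (vf_rep A c (\<psi> X)) (at (cmap c x)) h))) (at (cmap c x))"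
    by (rule has_derivative_transform_within_open[OF _ open_chart_image[OF c(1)]])
      (use c in \<open>auto simp: vf_rep_def cinv_cmap lagrangian_tcoord\<close>)
  have "d_Q A (Lbar \<psi> L) (x, X) = (x, Blinfun (\<lambda>h. frechet_derivative (lc c) (at (cmap c x, \<psi> X x))
        (h, frechet_derivative (vf_rep A c (\<psi> X)) (at (cmap c x)) h)))"
    using frechet_derivative_at[OF d]
    by (simp add: d_Q_def differential_def Lbar_def phi_def pcoord_def assms o_def)
  then show ?thesis
    using has_derivative_bounded_linear[OF d]
    by (simp add: Omega_eq momentum_map_apply bounded_linear_Blinfun_apply)
qed

text \<open>By compatibility the pairing is the chart momentum applied to the field
  \<open>\<psi> Y\<close> along the curve. Both factors move, hence two terms.\<close>

lemma momentum_curve_derivative: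
  fixes \<gamma> :: "real \<Rightarrow> 'q"
  assumes "a < b" "t \<in> {a..b}" "c \<in> A" "\<gamma> ` {a..b} \<subseteq> cdom c"
    and v: "(cmap c \<circ> \<gamma> has_vector_derivative v t) (at t within {a..b})"
    and V: "\<And>\<tau>. \<tau> \<in> {a..b} \<Longrightarrow> tcoord A c (\<gamma> \<tau>) (\<psi> (V \<tau>) (\<gamma> \<tau>)) = v \<tau>"
    and p': "\<And>h. ((\<lambda>\<tau>. frechet_derivative (lc c) (at (cmap c (\<gamma> \<tau>), v \<tau>)) (0, h)) has_vector_derivative p' h)
      (at t within {a..b})"
  shows "((\<lambda>\<tau>. blinfun_apply (momentum (\<gamma> \<tau>, V \<tau>)) Y) has_vector_derivative
      p' (tcoord A c (\<gamma> t) (\<psi> Y (\<gamma> t))) + frechet_derivative (lc c) (at (cmap c (\<gamma> t), v t))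
        (0, frechet_derivative (vf_rep A c (\<psi> Y)) (at (cmap c (\<gamma> t))) (v t))) (at t within {a..b})"
proof -
  have dom: "\<gamma> \<tau> \<in> cdom c" if "\<tau> \<in> {a..b}" for \<tau>
    using assms(4) that by blast
  have \<xi>: "((\<lambda>\<tau>. vf_rep A c (\<psi> Y) (cmap c (\<gamma> \<tau>))) has_vector_derivative
      frechet_derivative (vf_rep A c (\<psi> Y)) (at (cmap c (\<gamma> t))) (v t)) (at t within {a..b})"
    using vector_derivative_diff_chain_within[OF v, of "vf_rep A c (\<psi> Y)"]
      has_derivative_at_withinI[OF vf_rep_has_derivative[OF assms(3) dom[OF assms(2)]]]
    by (simp add: o_def)
  have lin: "linear (\<lambda>h. frechet_derivative (lc c) (at (cmap c (\<gamma> \<tau>), v \<tau>)) (0, h))" if "\<tau> \<in> {a..b}" for \<tau>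
    by (rule linear_frechet_derivative_on(2)[OF open_chart_image lc_smooth]) (use assms(3) dom[OF that] in auto)
  have "((\<lambda>\<tau>. frechet_derivative (lc c) (at (cmap c (\<gamma> \<tau>), v \<tau>)) (0, vf_rep A c (\<psi> Y) (cmap c (\<gamma> \<tau>))))
      has_vector_derivative p' (vf_rep A c (\<psi> Y) (cmap c (\<gamma> t))) + frechet_derivative (lc c) (at (cmap c (\<gamma> t), v t))
        (0, frechet_derivative (vf_rep A c (\<psi> Y)) (at (cmap c (\<gamma> t))) (v t))) (at t within {a..b})"
    by (rule has_vector_derivative_linear_pairing(1)[OF assms(1,2) lin p' \<xi>])
  then show ?thesis
    unfolding vf_rep_cmap[OF assms(3) dom[OF assms(2)]]
    by (rule has_vector_derivative_transform[OF assms(2), rotated])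
      (simp add: momentum_apply[OF assms(3) dom] V vf_rep_cmap[OF assms(3) dom] del: o_apply)
qed

text \<open>The chart is the one representing the tangent space at \<gamma>(t), because
  \<open>vf_bracket\<close> and \<open>d_Q\<close> are computed there; only then do the derivatives
  of the fields in the bracket and in \<open>Omega\<close> meet in the same coordinates.\<close>

lemma Euler_Poincare_iff_Euler_Lagrange:
  fixes \<gamma> :: "real \<Rightarrow> 'q"
  assumes "a < b" "t \<in> {a..b}" and c: "c = chart_at A (\<gamma> t)" "\<gamma> ` {a..b} \<subseteq> cdom c"
    and v: "(cmap c \<circ> \<gamma> has_vector_derivative v t) (at t within {a..b})"
    and V: "\<And>\<tau>. \<tau> \<in> {a..b} \<Longrightarrow> tcoord A c (\<gamma> \<tau>) (\<psi> (V \<tau>) (\<gamma> \<tau>)) = v \<tau>"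
    and p': "\<And>h. ((\<lambda>\<tau>. frechet_derivative (lc c) (at (cmap c (\<gamma> \<tau>), v \<tau>)) (0, h)) has_vector_derivative p' h)
      (at t within {a..b})"
  shows "(\<exists>D. ((\<lambda>\<tau>. momentum (\<gamma> \<tau>, V \<tau>)) has_vector_derivative D) (at t within {a..b}) \<and>
      D - ad_star br (V t) (momentum (\<gamma> t, V t)) = Omega A \<psi> L (\<gamma> t, V t)) \<longleftrightarrow>
    (\<forall>h. p' h = frechet_derivative (lc c) (at (cmap c (\<gamma> t), v t)) (h, 0))"
proof -
  have cA: "c \<in> A" and dom: "\<gamma> t \<in> cdom c"
    using c chart_at by auto
  let ?D = "frechet_derivative (lc c) (at (cmap c (\<gamma> t), v t))"
  let ?\<xi>' = "\<lambda>Y. frechet_derivative (vf_rep A c (\<psi> Y)) (at (cmap c (\<gamma> t)))"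
  have vt: "\<psi> (V t) (\<gamma> t) = v t"
    using V[OF assms(2)] c(1) tcoord_chart_at by simp
  note split = frechet_derivative_split[OF open_chart_image[OF cA] lc_smooth[OF cA] imageI[OF dom]]
  note lin = linear_frechet_derivative_on[OF open_chart_image[OF cA] lc_smooth[OF cA] imageI[OF dom], of "v t"]
  have comp: "((\<lambda>\<tau>. blinfun_apply (momentum (\<gamma> \<tau>, V \<tau>)) Y) has_vector_derivative
      p' (\<psi> Y (\<gamma> t)) + ?D (0, ?\<xi>' Y (v t))) (at t within {a..b})" for Y
    using momentum_curve_derivative[OF assms(1,2) cA c(2) v V p'] c(1) tcoord_chart_at by simp
  have D_apply: "blinfun_apply D Y = p' (\<psi> Y (\<gamma> t)) + ?D (0, ?\<xi>' Y (v t))"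
    if "((\<lambda>\<tau>. momentum (\<gamma> \<tau>, V \<tau>)) has_vector_derivative D) (at t within {a..b})" for D Y
    using bounded_linear.has_vector_derivative[OF blinfun.bounded_linear_left that]
      vector_derivative_unique_within[OF at_within_Icc_nontrivial[OF assms(1,2)] _ comp] by blast
  have ad: "blinfun_apply (ad_star br (V t) (momentum (\<gamma> t, V t))) Y =
      ?D (0, ?\<xi>' Y (v t)) - ?D (0, ?\<xi>' (V t) (\<psi> Y (\<gamma> t)))" for Y
  proof -
    have "bounded_linear (br (V t))"
      using lie_algebra unfolding lie_algebra_def bilinear_def by (simp add: linear_conv_bounded_linear)
    then have "blinfun_apply (ad_star br (V t) (momentum (\<gamma> t, V t))) Y =
        ?D (0, \<psi> (br (V t) Y) (\<gamma> t))"
      using momentum_apply[OF cA dom, of "V t" "br (V t) Y"] c(1) tcoord_chart_at vt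
      by (simp add: ad_star_def bounded_linear_Blinfun_apply del: o_apply)
    \<comment> \<open>The homomorphism property turns the Lie bracket into the bracket of vector
      fields, which is by definition this coordinate expression.\<close>
    also have "\<psi> (br (V t) Y) (\<gamma> t) = ?\<xi>' Y (v t) - ?\<xi>' (V t) (\<psi> Y (\<gamma> t))"
      unfolding action_bracket vf_bracket_def pcoord_def by (simp add: c(1) vt)
    finally show ?thesis
      using linear_diff[OF lin(2)] by simp
  qed
  have Om: "blinfun_apply (Omega A \<psi> L (\<gamma> t, V t)) Y = ?D (\<psi> Y (\<gamma> t), 0) + ?D (0, ?\<xi>' (V t) (\<psi> Y (\<gamma> t)))" for Y
    unfolding Omega_apply[OF c(1)] vt by (rule split)
  have "D - ad_star br (V t) (momentum (\<gamma> t, V t)) = Omega A \<psi> L (\<gamma> t, V t) \<longleftrightarrow>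
      (\<forall>h. p' h = ?D (h, 0))"
    if D: "((\<lambda>\<tau>. momentum (\<gamma> \<tau>, V \<tau>)) has_vector_derivative D) (at t within {a..b})" for D
  proof -
    have ext: "B = C \<longleftrightarrow> (\<forall>Y. blinfun_apply B Y = blinfun_apply C Y)" for B C :: "'g \<Rightarrow>\<^sub>L real"
      by (metis blinfun_eqI)
    have "D - ad_star br (V t) (momentum (\<gamma> t, V t)) = Omega A \<psi> L (\<gamma> t, V t) \<longleftrightarrow>
        (\<forall>Y. p' (\<psi> Y (\<gamma> t)) = ?D (\<psi> Y (\<gamma> t), 0))"
      unfolding ext blinfun.diff_left D_apply[OF D] ad Om by simp
    also have "\<dots> \<longleftrightarrow> (\<forall>h. p' h = ?D (h, 0))"
      using transitive_obtain[of "\<gamma> t"] by metis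
    finally show ?thesis .
  qed
  \<comment> \<open>The derivative exists on a smooth piece whether or not the equation holds, so
    the existential quantifier adds no condition.\<close>
  moreover have "\<exists>D. ((\<lambda>\<tau>. momentum (\<gamma> \<tau>, V \<tau>)) has_vector_derivative D) (at t within {a..b})"
    by (rule blinfun_has_vector_derivative_componentwise[OF comp])
  ultimately show ?thesis
    by blast
qed

end

section \<open>Piecewise smooth variations\<close>

lemma subdivision_piece_right:
  assumes "subdivision t0 t1 P" "t0 \<le> t" "t < t1"
  obtains a b where "(a, b) \<in> pieces P" "a \<le> t" "t < b"
proof -
  let ?l = "{p\<in>P. p \<le> t}" and ?r = "{p\<in>P. t < p}"
  have fin: "finite ?l" "finite ?r" "?l \<noteq> {}" "?r \<noteq> {}"
    using assms unfolding subdivision_def by auto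
  have "Max ?l \<in> ?l" "Min ?r \<in> ?r"
    using fin Max_in Min_in by blast+
  moreover have "p \<le> Max ?l \<or> Min ?r \<le> p" if "p \<in> P" for p
    using that fin by (cases "p \<le> t") auto
  ultimately show thesis
    by (intro that[of "Max ?l" "Min ?r"]) (force simp: pieces_def)+
qed

lemma subdivision_piece_left:
  assumes "subdivision t0 t1 P" "t0 < t" "t \<le> t1"
  obtains a b where "(a, b) \<in> pieces P" "a < t" "t \<le> b"
proof -
  let ?l = "{p\<in>P. p < t}" and ?r = "{p\<in>P. t \<le> p}"
  have fin: "finite ?l" "finite ?r" "?l \<noteq> {}" "?r \<noteq> {}"
    using assms unfolding subdivision_def by auto
  have "Max ?l \<in> ?l" "Min ?r \<in> ?r"
    using fin Max_in Min_in by blast+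
  moreover have "p \<le> Max ?l \<or> Min ?r \<le> p" if "p \<in> P" for p
    using that fin by (cases "p < t") auto
  ultimately show thesis
    by (intro that[of "Max ?l" "Min ?r"]) (force simp: pieces_def)+
qed

text \<open>The piece of P that contains a and extends to its right cannot end strictly between a
  and b, where P has no points.\<close>

lemma subdivision_refine:
  assumes "subdivision t0 t1 P" "Q \<subseteq> {t0..t1}" "(a, b) \<in> pieces (P \<union> Q)"
  obtains a' b' where "(a', b') \<in> pieces P" "a' \<le> a" "b \<le> b'"
proof -
  have ab: "a \<in> P \<union> Q" "b \<in> P \<union> Q" "a < b" "{a<..<b} \<inter> (P \<union> Q) = {}"
    using assms(3) by (auto simp: pieces_def)
  then have "t0 \<le> a" "a < t1"
    using assms(1,2) unfolding subdivision_def by fastforce+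
  then obtain a' b' where p: "(a', b') \<in> pieces P" "a' \<le> a" "a < b'"
    using subdivision_piece_right[OF assms(1)] by blast
  then have "b' \<notin> {a<..<b}"
    using ab(4) by (auto simp: pieces_def)
  then show thesis
    using that[OF p(1,2)] p(3) by fastforce
qed

lemma eventually_near_slice:
  fixes G :: "real \<times> real \<Rightarrow> 'q::topological_space"
  assumes "continuous_on ({t0..t1} \<times> {-\<epsilon>..\<epsilon>}) G" "x \<in> {t0..t1}" "0 < \<epsilon>" "open W" "G (x, 0) \<in> W"
  obtains d where "0 < d" "d \<le> \<epsilon>"
    "\<And>t s. t \<in> {t0..t1} \<Longrightarrow> \<bar>t - x\<bar> \<le> d \<Longrightarrow> \<bar>s\<bar> \<le> d \<Longrightarrow> G (t, s) \<in> W"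
proof -
  let ?R = "{t0..t1} \<times> {-\<epsilon>..\<epsilon>}"
  have "(G \<longlongrightarrow> G (x, 0)) (at (x, 0) within ?R)"
    using assms(1-3) unfolding continuous_on_def by auto
  from topological_tendstoD[OF this assms(4,5)]
  obtain r where r: "r > 0" "\<And>z. z \<in> ?R \<Longrightarrow> z \<noteq> (x, 0) \<Longrightarrow> dist z (x, 0) < r \<Longrightarrow> G z \<in> W"
    unfolding eventually_at by auto
  \<comment> \<open>With r/3 in both coordinates the distance to (x,0) is at most 2r/3, hence below
    r.\<close>
  have "G (t, s) \<in> W" if "t \<in> {t0..t1}" "\<bar>t - x\<bar> \<le> min \<epsilon> (r / 3)" "\<bar>s\<bar> \<le> min \<epsilon> (r / 3)" for t s
  proof (cases "(t, s) = (x, 0)")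
    case False
    have "dist (t, s) (x, 0) \<le> \<bar>t - x\<bar> + \<bar>s\<bar>"
      using sqrt_sum_squares_le_sum_abs[of "t - x" s] by (simp add: dist_Pair_Pair dist_real_def)
    then show ?thesis
      using that r(1) False by (intro r(2)) auto
  qed (use assms in auto)
  then show thesis
    using r(1) assms(3) by (intro that[of "min \<epsilon> (r / 3)"]) auto
qed

section \<open>Smooth maps into the manifold\<close>

lemma (in manifold) smooth_map_on_cong:
  assumes "smooth_map_on A S F" "\<And>x. x \<in> S \<Longrightarrow> F x = G x"
  shows "smooth_map_on A S G"
proof -
  have eq: "S \<inter> F -` W = S \<inter> G -` W" for W
    using assms(2) by auto
  have "smooth_on (S \<inter> F -` W) (cmap c \<circ> F) \<Longrightarrow> smooth_on (S \<inter> G -` W) (cmap c \<circ> G)" for c W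
    unfolding eq[symmetric] by (erule smooth_on_cong) (simp add: assms(2))
  moreover have "continuous_on S G"
    using assms(1) assms(2) unfolding smooth_map_on_def by (blast intro: continuous_on_eq)
  ultimately show ?thesis
    using assms(1) unfolding smooth_map_on_def by blast
qed

lemma (in manifold) smooth_map_on_fst:
  fixes \<gamma> :: "real \<Rightarrow> 'q" and T :: "real set"
  assumes "smooth_map_on A S \<gamma>"
  shows "smooth_map_on A (S \<times> T) (\<lambda>(t, s). \<gamma> t)"
  unfolding smooth_map_on_def
proof (intro conjI ballI)
  show "continuous_on (S \<times> T) (\<lambda>(t, s). \<gamma> t)"
    unfolding split_beta
    by (rule continuous_on_compose2[of S \<gamma>])
      (use assms in \<open>auto simp: smooth_map_on_def intro!: continuous_intros\<close>)
  fix c assume "c \<in> A"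
  then have c: "smooth_on (S \<inter> \<gamma> -` cdom c) (cmap c \<circ> \<gamma>)"
    using assms unfolding smooth_map_on_def by blast
  have "smooth_on (S \<times> T \<inter> (\<lambda>(t, s). \<gamma> t) -` cdom c) (\<lambda>z. (cmap c \<circ> \<gamma>) (fst z))"
    by (rule smooth_on_compose[OF smooth_on_linear[OF bounded_linear_fst] c]) auto
  then show "smooth_on (S \<times> T \<inter> (\<lambda>(t, s). \<gamma> t) -` cdom c) (cmap c \<circ> (\<lambda>(t, s). \<gamma> t))"
    by (simp add: o_def split_beta)
qed

text \<open>Seen in any chart d, the map is f followed by a transition map.\<close>

lemma (in manifold) smooth_map_on_cinv:
  assumes "c \<in> A" "smooth_on S f" "f ` S \<subseteq> cmap c ` cdom c"
  shows "smooth_map_on A S (\<lambda>x. cinv c (f x))"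
  unfolding smooth_map_on_def
proof (intro conjI ballI)
  show "continuous_on S (\<lambda>x. cinv c (f x))"
    using assms(3) by (rule continuous_on_compose2[OF continuous_on_cinv[OF assms(1)] smooth_on_imp_continuous_on[OF assms(2)]])
  fix d assume d: "d \<in> A"
  have "smooth_on (S \<inter> (\<lambda>x. cinv c (f x)) -` cdom d) (\<lambda>x. (cmap d \<circ> cinv c) (f x))"
  proof (rule smooth_on_compose[OF smooth_on_subset[OF assms(2)] transition_smooth[OF assms(1) d]])
    show "f ` (S \<inter> (\<lambda>x. cinv c (f x)) -` cdom d) \<subseteq> cmap c ` (cdom c \<inter> cdom d)"
    proof
      fix y assume "y \<in> f ` (S \<inter> (\<lambda>x. cinv c (f x)) -` cdom d)"
      then have y: "y \<in> cmap c ` cdom c" "cinv c y \<in> cdom d"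
        using assms(3) by auto
      then have "y = cmap c (cinv c y)" "cinv c y \<in> cdom c \<inter> cdom d"
        using cmap_cinv[OF assms(1)] cinv_in_cdom[OF assms(1)] by auto
      then show "y \<in> cmap c ` (cdom c \<inter> cdom d)"
        by blast
    qed
  qed auto
  then show "smooth_on (S \<inter> (\<lambda>x. cinv c (f x)) -` cdom d) (cmap d \<circ> (\<lambda>x. cinv c (f x)))"
    by (simp add: o_def)
qed

section \<open>The first variation of the action over a time interval\<close>

context lagrangian_manifold
begin

text \<open>Integrability for all small s is part of the notion because \<open>integral\<close>
  takes a default value on non-integrable functions, and integrals over adjacent intervals need then
  not add up.\<close>

definition first_var ::
    "real \<Rightarrow> real \<Rightarrow> (real \<Rightarrow> real \<Rightarrow> 'q) \<Rightarrow> real \<Rightarrow> real \<Rightarrow> real \<Rightarrow> bool" where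
  "first_var t0 t1 \<Gamma> a b K \<longleftrightarrow>
     (\<exists>e>0. \<forall>s\<in>{-e..e}. (\<lambda>t. L (velocity A t0 t1 (\<Gamma> s) t)) integrable_on {a..b}) \<and>
     ((\<lambda>s. integral {a..b} (\<lambda>t. L (velocity A t0 t1 (\<Gamma> s) t))) has_real_derivative K) (at 0)"

lemma first_var_refl: "first_var t0 t1 \<Gamma> a a 0"
  unfolding first_var_def
  using integrable_on_refl[where a="a :: real"] by (intro conjI exI[of _ 1]) auto

lemma first_var_combine:
  assumes "first_var t0 t1 \<Gamma> a b K" "first_var t0 t1 \<Gamma> b c K'" "a \<le> b" "b \<le> c"
  shows "first_var t0 t1 \<Gamma> a c (K + K')"
proof -
  let ?f = "\<lambda>s t. L (velocity A t0 t1 (\<Gamma> s) t)"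
  obtain e where e: "e > 0" "\<And>s. s \<in> {-e..e} \<Longrightarrow> ?f s integrable_on {a..b}"
    using assms(1) unfolding first_var_def by blast
  obtain e' where e': "e' > 0" "\<And>s. s \<in> {-e'..e'} \<Longrightarrow> ?f s integrable_on {b..c}"
    using assms(2) unfolding first_var_def by blast
  have int: "?f s integrable_on {a..c}" if "s \<in> {-min e e'..min e e'}" for s
    by (rule Henstock_Kurzweil_Integration.integrable_combine[OF assms(3,4) e(2) e'(2)]) (use that in auto)
  have "((\<lambda>s. integral {a..b} (?f s) + integral {b..c} (?f s)) has_real_derivative K + K') (at 0)"
    using assms(1,2) unfolding first_var_def by (intro DERIV_add) auto
  then have "((\<lambda>s. integral {a..c} (?f s)) has_real_derivative K + K') (at 0)"
    by (rule has_field_derivative_transform_within[where d="min e e'"])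
      (use e(1) e'(1) in \<open>auto simp: dist_real_def intro!: Henstock_Kurzweil_Integration.integral_combine[OF assms(3,4) int]\<close>)
  then show ?thesis
    unfolding first_var_def using e(1) e'(1) int by (intro conjI exI[of _ "min e e'"]) auto
qed

text \<open>At a and b, possible corners, the velocity within {t0..t1} need not be the one-sided
  coordinate derivative, so the integrands are compared off these two points. The s-derivative of
  the integrand is recorded for L along the variation itself, so that it can later be read in
  another chart.\<close>

lemma first_var_chart:
  fixes \<Gamma> :: "real \<Rightarrow> real \<Rightarrow> 'q"
  assumes "t0 \<le> a" "a < b" "b \<le> t1" and c: "c \<in> A" and e: "0 < e"
    and smooth: "smooth_map_on A ({a..b} \<times> {-e..e}) (\<lambda>(t, s). \<Gamma> s t)"
    and dom: "\<And>t s. t \<in> {a..b} \<Longrightarrow> s \<in> {-e..e} \<Longrightarrow> \<Gamma> s t \<in> cdom c"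
  obtains v w w' where
    "smooth_on {a..b} (\<lambda>t. cmap c (\<Gamma> 0 t))" "smooth_on {a..b} v" "smooth_on {a..b} w"
    "\<And>t. t \<in> {a..b} \<Longrightarrow> ((\<lambda>\<tau>. cmap c (\<Gamma> 0 \<tau>)) has_vector_derivative v t) (at t within {a..b})"
    "\<And>t. t \<in> {a..b} \<Longrightarrow> ((\<lambda>\<sigma>. cmap c (\<Gamma> \<sigma> t)) has_vector_derivative w t) (at 0)"
    "\<And>t. t \<in> {a..b} \<Longrightarrow> (w has_vector_derivative w' t) (at t within {a..b})"
    "\<And>t. t \<in> {a<..<b} \<Longrightarrow> velocity A t0 t1 (\<Gamma> 0) t = (\<Gamma> 0 t, tvec A c (\<Gamma> 0 t) (v t))"
    "\<And>t. t \<in> {a<..<b} \<Longrightarrow> ((\<lambda>\<sigma>. L (velocity A t0 t1 (\<Gamma> \<sigma>) t)) has_vector_derivative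
      frechet_derivative (lc c) (at (cmap c (\<Gamma> 0 t), v t)) (w t, w' t)) (at 0)"
    "(\<lambda>t. frechet_derivative (lc c) (at (cmap c (\<Gamma> 0 t), v t)) (w t, w' t)) integrable_on {a..b}"
    "first_var t0 t1 \<Gamma> a b
      (integral {a..b} (\<lambda>t. frechet_derivative (lc c) (at (cmap c (\<Gamma> 0 t), v t)) (w t, w' t)))"
proof -
  let ?R = "{a..b} \<times> {-e..e}"
  define u where "u z = cmap c (\<Gamma> (snd z) (fst z))" for z
  have u: "smooth_on ?R u" "u ` ?R \<subseteq> cmap c ` cdom c"
  proof -
    have "smooth_on ?R (cmap c \<circ> (\<lambda>(t, s). \<Gamma> s t))"
      by (rule smooth_map_on_chart[OF smooth c]) (use dom in auto)
    then show "smooth_on ?R u"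
      by (simp add: u_def[abs_def] o_def split_beta)
  qed (use dom in \<open>auto simp: u_def\<close>)
  obtain ut us and uts :: "real \<times> real \<Rightarrow> 'e" where
    ut: "smooth_on ?R ut" and us: "smooth_on ?R us"
    and dt: "\<And>t s. t \<in> {a..b} \<Longrightarrow> s \<in> {-e..e} \<Longrightarrow>
      ((\<lambda>\<tau>. u (\<tau>, s)) has_vector_derivative ut (t, s)) (at t within {a..b})"
    and ds: "\<And>t. t \<in> {a..b} \<Longrightarrow> ((\<lambda>\<sigma>. u (t, \<sigma>)) has_vector_derivative us (t, 0)) (at 0)"
    and mixed: "\<And>t. t \<in> {a..b} \<Longrightarrow> ((\<lambda>\<tau>. us (\<tau>, 0)) has_vector_derivative uts (t, 0)) (at t within {a..b})"
    and cont: "\<And>s. s \<in> {-e..e} \<Longrightarrow> continuous_on {a..b} (\<lambda>t. lc c (u (t, s), ut (t, s)))"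
    and dL: "\<And>t. t \<in> {a..b} \<Longrightarrow> ((\<lambda>\<sigma>. lc c (u (t, \<sigma>), ut (t, \<sigma>))) has_vector_derivative
      frechet_derivative (lc c) (at (u (t, 0), ut (t, 0))) (us (t, 0), uts (t, 0))) (at 0)"
    and F: "continuous_on {a..b} (\<lambda>t. frechet_derivative (lc c) (at (u (t, 0), ut (t, 0))) (us (t, 0), uts (t, 0)))"
    and dI: "((\<lambda>s. integral {a..b} (\<lambda>t. lc c (u (t, s), ut (t, s)))) has_real_derivative
      integral {a..b} (\<lambda>t. frechet_derivative (lc c) (at (u (t, 0), ut (t, 0))) (us (t, 0), uts (t, 0)))) (at 0)"
    by (rule first_variation[OF assms(2) e open_chart_image[OF c] lc_smooth[OF c] u]) (rule that, assumption+)
  have slice: "smooth_on {a..b} (\<lambda>t. g (t, 0))" if "smooth_on ?R g" for g :: "real \<times> real \<Rightarrow> 'e"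
    by (rule smooth_on_compose[OF _ that]) (use e in \<open>auto intro!: smooth_on_linear bounded_linear_Pair\<close>)
  have cont\<Gamma>: "continuous_on {a..b} (\<Gamma> s)" if "s \<in> {-e..e}" for s
  proof -
    have G: "continuous_on ?R (\<lambda>z. \<Gamma> (snd z) (fst z))"
      using smooth by (simp add: smooth_map_on_def split_beta)
    have "continuous_on {a..b} (\<lambda>t. \<Gamma> (snd (t, s)) (fst (t, s)))"
      by (rule continuous_on_compose2[OF G]) (use that in \<open>auto intro!: continuous_intros\<close>)
    then show ?thesis
      by simp
  qed
  have vel: "velocity A t0 t1 (\<Gamma> s) t = (\<Gamma> s t, tvec A c (\<Gamma> s t) (ut (t, s)))"
    if "t \<in> {a<..<b}" "s \<in> {-e..e}" for t s
    by (rule velocity_in_chart_interior[OF assms(1,3) that(1) c dom cont\<Gamma>])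
      (use that dt[of t s] in \<open>auto simp: u_def o_def\<close>)
  then have Lvel: "L (velocity A t0 t1 (\<Gamma> s) t) = lc c (u (t, s), ut (t, s))"
    if "t \<in> {a<..<b}" "s \<in> {-e..e}" for t s
    using that lagrangian_tvec[OF c dom] by (simp add: u_def)
  have int: "(\<lambda>t. L (velocity A t0 t1 (\<Gamma> s) t)) integrable_on {a..b}"
    "integral {a..b} (\<lambda>t. L (velocity A t0 t1 (\<Gamma> s) t)) = integral {a..b} (\<lambda>t. lc c (u (t, s), ut (t, s)))"
    if "s \<in> {-e..e}" for s
  proof -
    have eq: "L (velocity A t0 t1 (\<Gamma> s) t) = lc c (u (t, s), ut (t, s))" if "t \<in> {a..b} - {a, b}" for t
      by (rule Lvel) (use that \<open>s \<in> {-e..e}\<close> in auto)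
    show "(\<lambda>t. L (velocity A t0 t1 (\<Gamma> s) t)) integrable_on {a..b}"
      by (rule integrable_spike_finite[where S="{a, b}", OF _ eq integrable_continuous_real[OF cont[OF that]]]) auto
    show "integral {a..b} (\<lambda>t. L (velocity A t0 t1 (\<Gamma> s) t)) = integral {a..b} (\<lambda>t. lc c (u (t, s), ut (t, s)))"
      by (rule integral_spike[of "{a, b}"]) (use eq in auto)
  qed
  have "((\<lambda>s. integral {a..b} (\<lambda>t. L (velocity A t0 t1 (\<Gamma> s) t))) has_real_derivative
      integral {a..b} (\<lambda>t. frechet_derivative (lc c) (at (u (t, 0), ut (t, 0))) (us (t, 0), uts (t, 0)))) (at 0)"
    by (rule has_field_derivative_transform_within[OF dI e _ int(2)[symmetric]]) (auto simp: dist_real_def)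
  then have fv: "first_var t0 t1 \<Gamma> a b
      (integral {a..b} (\<lambda>t. frechet_derivative (lc c) (at (u (t, 0), ut (t, 0))) (us (t, 0), uts (t, 0))))"
    using e int(1) unfolding first_var_def by blast
  have dLvel: "((\<lambda>\<sigma>. L (velocity A t0 t1 (\<Gamma> \<sigma>) t)) has_vector_derivative
      frechet_derivative (lc c) (at (u (t, 0), ut (t, 0))) (us (t, 0), uts (t, 0))) (at 0)"
    if "t \<in> {a<..<b}" for t
    by (rule has_vector_derivative_transform_within[OF dL e _ Lvel[symmetric]])
      (use that in \<open>auto simp: dist_real_def\<close>)
  show thesis
    by (rule that[of "\<lambda>t. ut (t, 0)" "\<lambda>t. us (t, 0)" "\<lambda>t. uts (t, 0)"])
      (use slice[OF u(1)] slice[OF ut] slice[OF us] dt[of _ 0] ds mixed vel[of _ 0] dLvel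
        integrable_continuous_real[OF F] fv e in \<open>simp_all add: u_def\<close>)
qed

text \<open>Bisection glues local first variations along a curve that crosses charts and corners.
  The additive relation R carries along what is to be known of the derivative K: nothing when only
  integrability is wanted, an increment of the boundary term for the converse direction.\<close>

lemma first_var_Bolzano:
  fixes \<Gamma> :: "real \<Rightarrow> real \<Rightarrow> 'q"
  assumes var: "fixed_endpoint_variation A t0 t1 \<gamma> \<epsilon> \<Gamma>" and "t0 \<le> t1"
    and R0: "\<And>a. R a a 0" and R: "\<And>a b c K K'. R a b K \<Longrightarrow> R b c K' \<Longrightarrow> R a c (K + K')"
    and local: "\<And>a b c e. t0 \<le> a \<Longrightarrow> a < b \<Longrightarrow> b \<le> t1 \<Longrightarrow> c \<in> A \<Longrightarrow> 0 < e \<Longrightarrow> e \<le> \<epsilon> \<Longrightarrow>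
      smooth_map_on A ({a..b} \<times> {-e..e}) (\<lambda>(t, s). \<Gamma> s t) \<Longrightarrow>
      (\<And>t s. t \<in> {a..b} \<Longrightarrow> s \<in> {-e..e} \<Longrightarrow> \<Gamma> s t \<in> cdom c) \<Longrightarrow>
      \<exists>K. first_var t0 t1 \<Gamma> a b K \<and> R a b K"
  shows "\<exists>K. first_var t0 t1 \<Gamma> t0 t1 K \<and> R t0 t1 K"
proof -
  let ?Q = "\<lambda>a b. \<exists>K. first_var t0 t1 \<Gamma> a b K \<and> R a b K"
  let ?G = "\<lambda>(t, s). \<Gamma> s t"
  obtain P where \<epsilon>: "0 < \<epsilon>" and G: "continuous_on ({t0..t1} \<times> {-\<epsilon>..\<epsilon>}) ?G"
    and P: "subdivision t0 t1 P"
    and piece: "\<And>a b. (a, b) \<in> pieces P \<Longrightarrow> smooth_map_on A ({a..b} \<times> {-\<epsilon>..\<epsilon>}) ?G"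
    using var unfolding fixed_endpoint_variation_def by blast
  have Q_refl: "?Q a a" for a
    using first_var_refl R0 by blast
  have Q_trans: "?Q a c" if "?Q a b" "?Q b c" "a \<le> b" "b \<le> c" for a b c
    using that first_var_combine R by meson
  have "t0 \<le> t0 \<and> t1 \<le> t1 \<longrightarrow> ?Q t0 t1"
  proof (rule Bolzano[OF \<open>t0 \<le> t1\<close>, where P="\<lambda>a b. t0 \<le> a \<and> b \<le> t1 \<longrightarrow> ?Q a b"])
    fix a b c
    assume "t0 \<le> a \<and> b \<le> t1 \<longrightarrow> ?Q a b" "t0 \<le> b \<and> c \<le> t1 \<longrightarrow> ?Q b c" "a \<le> b" "b \<le> c"
    then show "t0 \<le> a \<and> c \<le> t1 \<longrightarrow> ?Q a c"
      using Q_trans[of a b c] by auto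
  next
    fix x
    assume local: "t0 \<le> x" "x \<le> t1"
    let ?c = "chart_at A (\<Gamma> 0 x)"
    obtain d where d: "0 < d" "d \<le> \<epsilon>"
      "\<And>t s. t \<in> {t0..t1} \<Longrightarrow> \<bar>t - x\<bar> \<le> d \<Longrightarrow> \<bar>s\<bar> \<le> d \<Longrightarrow> ?G (t, s) \<in> cdom ?c"
      by (rule eventually_near_slice[OF G _ \<epsilon> open_cdom[OF chart_at(1)], of x "\<Gamma> 0 x"])
        (use local chart_at(2) in auto)
    have near: "?Q a b" if "t0 \<le> a" "a < b" "b \<le> t1" "x - d \<le> a" "b \<le> x + d" "(p, q) \<in> pieces P" "p \<le> a" "b \<le> q" for a b p q
    proof (rule assms(5)[OF that(1-3) chart_at(1) d(1,2)])
      show "smooth_map_on A ({a..b} \<times> {-d..d}) ?G"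
        by (rule smooth_map_on_subset[OF piece[OF that(6)]]) (use that(7,8) d in auto)
      show "\<Gamma> s t \<in> cdom ?c" if "t \<in> {a..b}" "s \<in> {-d..d}" for t s
        using d(3)[of t s] that \<open>t0 \<le> a\<close> \<open>b \<le> t1\<close> \<open>x - d \<le> a\<close> \<open>b \<le> x + d\<close> by auto
    qed
    have "\<exists>r>0. \<forall>b. x \<le> b \<and> b < x + r \<and> b \<le> t1 \<longrightarrow> ?Q x b"
    proof (cases "x < t1")
      case True
      then obtain p q where pq: "(p, q) \<in> pieces P" "p \<le> x" "x < q"
        using subdivision_piece_right[OF P local(1)] by blast
      have "?Q x b" if "x \<le> b" "b < x + min d (q - x)" "b \<le> t1" for b
        by (cases "x = b") (use that near[of x b p q] Q_refl local pq d(1) in auto)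
      then show ?thesis
        using pq(3) d(1) by (intro exI[of _ "min d (q - x)"]) auto
    next
      case False
      have "?Q x b" if "x \<le> b \<and> b < x + 1 \<and> b \<le> t1" for b
      proof -
        have "b = x"
          using that False by linarith
        then show ?thesis
          using Q_refl by simp
      qed
      then show ?thesis
        by (intro exI[of _ 1]) auto
    qed
    then obtain r where r: "r > 0" "\<And>b. x \<le> b \<Longrightarrow> b < x + r \<Longrightarrow> b \<le> t1 \<Longrightarrow> ?Q x b"
      by blast
    have "\<exists>r>0. \<forall>a. a \<le> x \<and> x - r < a \<and> t0 \<le> a \<longrightarrow> ?Q a x"
    proof (cases "t0 < x")
      case True
      then obtain p q where pq: "(p, q) \<in> pieces P" "p < x" "x \<le> q"
        using subdivision_piece_left[OF P _ local(2)] by blast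
      have "?Q a x" if "a \<le> x" "x - min d (x - p) < a" "t0 \<le> a" for a
        by (cases "x = a") (use that near[of a x p q] Q_refl local pq d(1) in auto)
      then show ?thesis
        using pq(2) d(1) by (intro exI[of _ "min d (x - p)"]) auto
    next
      case False
      have "?Q a x" if "a \<le> x \<and> x - 1 < a \<and> t0 \<le> a" for a
      proof -
        have "a = x"
          using that False by linarith
        then show ?thesis
          using Q_refl by simp
      qed
      then show ?thesis
        by (intro exI[of _ 1]) auto
    qed
    then obtain r' where r': "r' > 0" "\<And>a. a \<le> x \<Longrightarrow> x - r' < a \<Longrightarrow> t0 \<le> a \<Longrightarrow> ?Q a x"
      by blast
    show "\<exists>d>0. \<forall>a b. a \<le> x \<and> x \<le> b \<and> b - a < d \<longrightarrow> (t0 \<le> a \<and> b \<le> t1 \<longrightarrow> ?Q a b)"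
    proof (rule exI[of _ "min r r'"], intro conjI allI impI)
      fix a b assume "a \<le> x \<and> x \<le> b \<and> b - a < min r r'" "t0 \<le> a \<and> b \<le> t1"
      then show "?Q a b"
        by (intro Q_trans[of a x b] r r') auto
    qed (use r(1) r'(1) in auto)
  qed
  then show ?thesis
    by simp
qed

text \<open>The curve itself, taken constant in s, is a variation, and \<open>first_var\<close>
  contains integrability at s = 0.\<close>

lemma lagrangian_velocity_integrable:
  fixes \<gamma> :: "real \<Rightarrow> 'q"
  assumes "t0 \<le> t1" "piecewise_smooth_curve A t0 t1 \<gamma>"
  shows "(\<lambda>t. L (velocity A t0 t1 \<gamma> t)) integrable_on {t0..t1}"
proof -
  obtain P where "subdivision t0 t1 P" "\<And>a b. (a, b) \<in> pieces P \<Longrightarrow> smooth_map_on A {a..b} \<gamma>"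
    and "continuous_on {t0..t1} \<gamma>"
    using assms(2) unfolding piecewise_smooth_curve_def by blast
  note P = this
  have "continuous_on ({t0..t1} \<times> {-1..1::real}) (\<lambda>(t, s). \<gamma> t)"
    unfolding split_beta by (rule continuous_on_compose2[OF P(3)]) (auto intro!: continuous_intros)
  moreover have "\<forall>(a, b)\<in>pieces P. smooth_map_on A ({a..b} \<times> {-1..1::real}) (\<lambda>(t, s). \<gamma> t)"
    by (auto intro: smooth_map_on_fst P(2))
  ultimately have "fixed_endpoint_variation A t0 t1 \<gamma> 1 (\<lambda>s. \<gamma>)"
    unfolding fixed_endpoint_variation_def using P(1) by (intro conjI exI[of _ P]) auto
  then have "\<exists>K. first_var t0 t1 (\<lambda>s. \<gamma>) t0 t1 K \<and> True"
  proof (rule first_var_Bolzano)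
    fix a b c and e :: real
    assume "t0 \<le> a" "a < b" "b \<le> t1" "c \<in> A" "0 < e" "smooth_map_on A ({a..b} \<times> {-e..e}) (\<lambda>(t, s). \<gamma> t)"
      and dom: "\<And>t s. t \<in> {a..b} \<Longrightarrow> s \<in> {-e..e} \<Longrightarrow> \<gamma> t \<in> cdom c"
    then show "\<exists>K. first_var t0 t1 (\<lambda>s. \<gamma>) a b K \<and> True"
      by - (rule first_var_chart[of t0 a b t1 c e "\<lambda>s. \<gamma>"], (fact | blast)+)
  qed (use assms(1) in auto)
  then show ?thesis
    unfolding first_var_def by force
qed

end

section \<open>Test variations supported in a chart\<close>

lemma continuous_on_glue3:
  fixes f :: "'a::topological_space \<Rightarrow> 'b::topological_space"
  assumes "closed S" "closed T" "closed U" "continuous_on S f" "continuous_on T f" "continuous_on U f"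
  shows "continuous_on (S \<union> T \<union> U) f"
  using assms by (intro continuous_on_closed_Un closed_Un)

text \<open>The curve is displaced in the coordinates of c by s times a quadratic bump; compactness
  of the segment keeps it in the chart for small s, and the zeros of the bump at a and b make it
  join the unmoved curve continuously. The time m is where \<gamma> may have a corner.\<close>

lemma (in manifold) bump_variation:
  fixes \<gamma> :: "real \<Rightarrow> 'q" and h :: 'e
  assumes "piecewise_smooth_curve A t0 t1 \<gamma>" "t0 \<le> a" "a < m" "m < b" "b \<le> t1" and c: "c \<in> A"
    and smooth: "smooth_map_on A {a..m} \<gamma>" "smooth_map_on A {m..b} \<gamma>"
    and dom: "\<gamma> ` {a..b} \<subseteq> cdom c"
  obtains e \<Gamma> where "0 < e" "fixed_endpoint_variation A t0 t1 \<gamma> e \<Gamma>" "\<Gamma> 0 = \<gamma>"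
    "\<And>t s. t \<in> {a..b} \<Longrightarrow> s \<in> {-e..e} \<Longrightarrow> \<Gamma> s t \<in> cdom c"
    "\<And>t s. t \<in> {a..b} \<Longrightarrow> s \<in> {-e..e} \<Longrightarrow>
      cmap c (\<Gamma> s t) = cmap c (\<gamma> t) + s *\<^sub>R (((t - a) * (b - t)) *\<^sub>R h)"
    "\<And>t s. t \<notin> {a..b} \<Longrightarrow> \<Gamma> s t = \<gamma> t"
    "smooth_map_on A ({a..m} \<times> {-e..e}) (\<lambda>(t, s). \<Gamma> s t)"
    "smooth_map_on A ({m..b} \<times> {-e..e}) (\<lambda>(t, s). \<Gamma> s t)"
proof -
  define \<eta> where "\<eta> t = ((t - a) * (b - t)) *\<^sub>R h" for t
  define u where "u = cmap c \<circ> \<gamma>"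
  obtain P where \<gamma>: "continuous_on {t0..t1} \<gamma>" and P: "subdivision t0 t1 P"
    and piece: "\<And>a b. (a, b) \<in> pieces P \<Longrightarrow> smooth_map_on A {a..b} \<gamma>"
    using assms(1) unfolding piecewise_smooth_curve_def by blast
  have dom': "\<gamma> t \<in> cdom c" if "t \<in> {a..b}" for t
    using dom that by blast
  have u_cont: "continuous_on {a..b} u"
    unfolding u_def
    by (rule continuous_on_compose[OF continuous_on_subset[OF \<gamma>] continuous_on_subset[OF continuous_on_cmap[OF c] dom]])
      (use assms in auto)
  have "u ` {a..b} \<subseteq> cmap c ` cdom c"
    using dom by (auto simp: u_def)
  then obtain r where r: "r > 0" "(\<Union>x\<in>u ` {a..b}. cball x r) \<subseteq> cmap c ` cdom c"
    by (rule compact_subset_open_imp_cball_epsilon_subset[OF compact_continuous_image[OF u_cont compact_Icc] open_chart_image[OF c]])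
  have "compact (\<eta> ` {a..b})"
    unfolding \<eta>_def by (intro compact_continuous_image continuous_intros compact_Icc)
  then obtain B where B: "B > 0" "\<And>t. t \<in> {a..b} \<Longrightarrow> norm (\<eta> t) \<le> B"
    using compact_imp_bounded[of "\<eta> ` {a..b}"] unfolding bounded_pos by auto
  \<comment> \<open>r is a uniform margin of the compact coordinate segment inside the open chart
    image and B bounds the bump, so |s| \<le> e displaces each point by at most e B = r.\<close>
  define e where "e = r / B"
  have e: "e > 0"
    using r B by (simp add: e_def)
  have inU: "u t + s *\<^sub>R \<eta> t \<in> cmap c ` cdom c" if "t \<in> {a..b}" "s \<in> {-e..e}" for t s
  proof -
    have "norm (s *\<^sub>R \<eta> t) \<le> e * B"
      using that B(2)[OF that(1)] e unfolding norm_scaleR by (intro mult_mono) auto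
    also have "e * B = r"
      using B(1) by (simp add: e_def)
    finally have "u t + s *\<^sub>R \<eta> t \<in> cball (u t) r"
      by (simp add: dist_norm)
    then show ?thesis
      using r(2) that(1) by blast
  qed
  define \<Gamma> where "\<Gamma> s t = (if t \<in> {a..b} then cinv c (u t + s *\<^sub>R \<eta> t) else \<gamma> t)" for s t
  let ?G = "\<lambda>(t, s). \<Gamma> s t"
  have \<Gamma>_dom: "\<Gamma> s t \<in> cdom c" and \<Gamma>_coord: "cmap c (\<Gamma> s t) = u t + s *\<^sub>R \<eta> t"
    if "t \<in> {a..b}" "s \<in> {-e..e}" for t s
    using that inU[OF that] cinv_in_cdom[OF c] cmap_cinv[OF c] by (simp_all add: \<Gamma>_def)
  have \<Gamma>_eq: "\<Gamma> s t = \<gamma> t" if "t \<notin> {a<..<b} \<or> s = 0" for s t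
  proof (cases "t \<in> {a..b}")
    case True
    then have eq: "u t + s *\<^sub>R \<eta> t = u t"
      using that by (auto simp: \<eta>_def)
    show ?thesis
      unfolding \<Gamma>_def eq using True cinv_cmap[OF c dom'[OF True]] by (simp add: u_def)
  next
    case False
    then show ?thesis
      by (auto simp: \<Gamma>_def)
  qed
  have inner: "smooth_map_on A ({p..q} \<times> {-e..e}) ?G" if "smooth_map_on A {p..q} \<gamma>" "a \<le> p" "q \<le> b" for p q
  proof -
    let ?R = "{p..q} \<times> {-e..e}"
    have u: "smooth_on {p..q} u"
      unfolding u_def by (rule smooth_map_on_chart[OF that(1) c]) (use dom' that in auto)
    have fst: "smooth_on ?R (fst :: real \<times> real \<Rightarrow> real)" and snd: "smooth_on ?R (snd :: real \<times> real \<Rightarrow> real)"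
      by (auto intro: smooth_on_linear bounded_linear_fst bounded_linear_snd)
    have lin: "smooth_on ?R (\<lambda>z. fst z - a)" "smooth_on ?R (\<lambda>z. b - fst z)"
      using smooth_on_add[OF fst smooth_on_const[of _ "-a"]]
        smooth_on_add[OF smooth_on_const[of _ b] bounded_linear.smooth_on_comp[OF bounded_linear_minus[OF bounded_linear_ident] fst]]
      by simp_all
    have "smooth_on ?R (\<lambda>z. u (fst z) + snd z *\<^sub>R (((fst z - a) * (b - fst z)) *\<^sub>R h))"
      by (rule smooth_on_add[OF smooth_on_compose[OF fst u]
            bounded_bilinear.smooth_on_prod[OF bounded_bilinear_scaleR snd
              bounded_bilinear.smooth_on_prod[OF bounded_bilinear_scaleR
                bounded_bilinear.smooth_on_prod[OF bounded_bilinear_mult lin] smooth_on_const]]]) auto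
    then have "smooth_map_on A ?R (\<lambda>z. cinv c (u (fst z) + snd z *\<^sub>R (((fst z - a) * (b - fst z)) *\<^sub>R h)))"
      by (rule smooth_map_on_cinv[OF c]) (use inU that(2,3) in \<open>auto simp: \<eta>_def\<close>)
    then show ?thesis
      by (rule smooth_map_on_cong) (use that(2,3) in \<open>auto simp: \<Gamma>_def \<eta>_def\<close>)
  qed
  have outer: "smooth_map_on A ({p..q} \<times> {-e..e}) ?G" if "smooth_map_on A {p..q} \<gamma>" "q \<le> a \<or> b \<le> p" for p q
    by (rule smooth_map_on_cong[OF smooth_map_on_fst[OF that(1)]]) (use that(2) \<Gamma>_eq in auto)
  have "continuous_on ({t0..a} \<times> {-e..e} \<union> {a..b} \<times> {-e..e} \<union> {b..t1} \<times> {-e..e}) ?G"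
  proof (rule continuous_on_glue3)
    have out: "continuous_on ({p..q} \<times> {-e..e}) ?G" if "t0 \<le> p" "q \<le> t1" "q \<le> a \<or> b \<le> p" for p q
    proof -
      have "continuous_on ({p..q} \<times> {-e..e}) (\<lambda>z. \<gamma> (fst z))"
        by (rule continuous_on_compose2[OF \<gamma>]) (use that in \<open>auto intro!: continuous_intros\<close>)
      then show ?thesis
        by (rule continuous_on_eq) (use that(3) \<Gamma>_eq in auto)
    qed
    show "continuous_on ({t0..a} \<times> {-e..e}) ?G" "continuous_on ({b..t1} \<times> {-e..e}) ?G"
      by (rule out; use assms in simp)+
    have "continuous_on ({a..b} \<times> {-e..e}) (\<lambda>z. cinv c (u (fst z) + snd z *\<^sub>R \<eta> (fst z)))"
    proof (rule continuous_on_compose2[OF continuous_on_cinv[OF c]])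
      have "continuous_on ({a..b} \<times> {-e..e}) (\<lambda>z. u (fst z))"
        by (rule continuous_on_compose2[OF u_cont]) (auto intro!: continuous_intros)
      then show "continuous_on ({a..b} \<times> {-e..e}) (\<lambda>z. u (fst z) + snd z *\<^sub>R \<eta> (fst z))"
        unfolding \<eta>_def by (intro continuous_intros)
    qed (use inU in auto)
    then show "continuous_on ({a..b} \<times> {-e..e}) ?G"
      by (rule continuous_on_eq) (auto simp: \<Gamma>_def)
  qed (auto intro: closed_Times)
  moreover have "{t0..a} \<times> {-e..e} \<union> {a..b} \<times> {-e..e} \<union> {b..t1} \<times> {-e..e} = {t0..t1} \<times> {-e..e}"
    using assms(2-5) by auto
  ultimately have cont: "continuous_on ({t0..t1} \<times> {-e..e}) ?G"
    by simp
  \<comment> \<open>The bump may create kinks at a and b, so these become subdivision points. On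
    each refined piece the variation is then either given by the bump formula or independent of
    s.\<close>
  let ?P = "P \<union> {a, m, b}"
  have "subdivision t0 t1 ?P"
    using P assms(2-5) unfolding subdivision_def by auto
  moreover have "smooth_map_on A ({p..q} \<times> {-e..e}) ?G" if pq: "(p, q) \<in> pieces ?P" for p q
  proof -
    obtain p' q' where "(p', q') \<in> pieces P" "p' \<le> p" "q \<le> q'"
      by (rule subdivision_refine[OF P _ pq]) (use assms(2-5) in auto)
    then have \<gamma>pq: "smooth_map_on A {p..q} \<gamma>"
      by (intro smooth_map_on_subset[OF piece]) auto
    have "a \<notin> {p<..<q}" "b \<notin> {p<..<q}" "p < q"
      using pq unfolding pieces_def by auto
    then consider "q \<le> a \<or> b \<le> p" | "a \<le> p" "q \<le> b"
      by fastforce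
    then show ?thesis
      using inner[OF \<gamma>pq] outer[OF \<gamma>pq] by cases auto
  qed
  ultimately have "fixed_endpoint_variation A t0 t1 \<gamma> e \<Gamma>"
    unfolding fixed_endpoint_variation_def using e cont \<Gamma>_eq assms(2-5)
    by (intro conjI exI[of _ ?P]) auto
  then show thesis
    using e \<Gamma>_dom \<Gamma>_coord \<Gamma>_eq inner[OF smooth(1)] inner[OF smooth(2)] assms(3,4)
    by (intro that[of e \<Gamma>]) (auto simp: u_def \<eta>_def)
qed

lemma (in manifold) velocity_local:
  assumes "t \<in> {p<..<q}" "t \<in> {t0..t1}" "\<And>\<tau>. \<tau> \<in> {p<..<q} \<Longrightarrow> \<gamma>1 \<tau> = \<gamma>2 \<tau>"
  shows "velocity A t0 t1 \<gamma>1 t = velocity A t0 t1 \<gamma>2 t"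
proof -
  have "eventually (\<lambda>\<tau>. \<tau> \<in> {p<..<q}) (nhds t)"
    using assms(1) by (intro eventually_nhds_in_open) auto
  then have "eventually (\<lambda>\<tau>. \<tau> \<in> {t0..t1} \<longrightarrow> (cmap d \<circ> \<gamma>1) \<tau> = (cmap d \<circ> \<gamma>2) \<tau>) (nhds t)" for d
    by (rule eventually_mono) (simp add: assms(3))
  then have "vector_derivative (cmap d \<circ> \<gamma>1) (at t within {t0..t1}) = vector_derivative (cmap d \<circ> \<gamma>2) (at t within {t0..t1})" for d
    by (rule vector_derivative_cong_eq[OF _ refl refl assms(2)])
  then show ?thesis
    using assms(1,3) by (simp add: velocity_def)
qed

section \<open>Necessary conditions obtained from test variations\<close>

context lagrangian_manifold
begin

text \<open>At times inside (p,q) the curves agree nearby, hence so do their velocities. At p and q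
  the velocities may differ, which the integral does not see.\<close>

lemma first_var_constant:
  assumes "t0 \<le> p" "q \<le> t1" "(\<lambda>t. L (velocity A t0 t1 \<gamma> t)) integrable_on {t0..t1}"
    and "\<And>s t. t \<in> {p<..<q} \<Longrightarrow> \<Gamma> s t = \<gamma> t"
  shows "first_var t0 t1 \<Gamma> p q 0"
proof -
  have eq: "L (velocity A t0 t1 (\<Gamma> s) t) = L (velocity A t0 t1 \<gamma> t)" if "t \<in> {p..q} - {p, q}" for s t
    by (rule arg_cong[where f=L], rule velocity_local[of t p q]) (use that assms in auto)
  have int: "(\<lambda>t. L (velocity A t0 t1 \<gamma> t)) integrable_on {p..q}"
    by (rule integrable_on_subinterval[OF assms(3)]) (use assms(1,2) in auto)
  have "(\<lambda>t. L (velocity A t0 t1 (\<Gamma> s) t)) integrable_on {p..q}" for s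
    by (rule integrable_spike_finite[where S="{p, q}", OF _ eq int]) auto
  moreover have "integral {p..q} (\<lambda>t. L (velocity A t0 t1 (\<Gamma> s) t)) = integral {p..q} (\<lambda>t. L (velocity A t0 t1 \<gamma> t))" for s
    by (rule integral_spike[of "{p, q}"]) (use eq in auto)
  ultimately show ?thesis
    unfolding first_var_def by (auto intro: exI[of _ 1])
qed

text \<open>Coordinates affine in s have \<eta> as their variation field. Uniqueness of derivatives
  identifies the data supplied by \<open>first_var_chart\<close> with \<eta> and the given v, and
  integration by parts applies.\<close>

lemma first_var_bump_piece:
  fixes \<gamma> :: "real \<Rightarrow> 'q" and \<eta> :: "real \<Rightarrow> 'e"
  assumes "t0 \<le> p" "p < q" "q \<le> t1" and c: "c \<in> A" and e: "0 < e"
    and smooth: "smooth_map_on A ({p..q} \<times> {-e..e}) (\<lambda>(t, s). \<Gamma> s t)"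
    and dom: "\<And>t s. t \<in> {p..q} \<Longrightarrow> s \<in> {-e..e} \<Longrightarrow> \<Gamma> s t \<in> cdom c"
    and coord: "\<And>t s. t \<in> {p..q} \<Longrightarrow> s \<in> {-e..e} \<Longrightarrow> cmap c (\<Gamma> s t) = cmap c (\<gamma> t) + s *\<^sub>R \<eta> t"
    and v: "\<And>t. t \<in> {p..q} \<Longrightarrow> (cmap c \<circ> \<gamma> has_vector_derivative v t) (at t within {p..q})"
    and p': "\<And>t h. t \<in> {p..q} \<Longrightarrow>
      ((\<lambda>\<tau>. frechet_derivative (lc c) (at (cmap c (\<gamma> \<tau>), v \<tau>)) (0, h)) has_vector_derivative p' t h) (at t within {p..q})"
    and E: "((\<lambda>t. frechet_derivative (lc c) (at (cmap c (\<gamma> t), v t)) (\<eta> t, 0) - p' t (\<eta> t)) has_integral E) {p..q}"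
  shows "first_var t0 t1 \<Gamma> p q (E + (frechet_derivative (lc c) (at (cmap c (\<gamma> q), v q)) (0, \<eta> q)
      - frechet_derivative (lc c) (at (cmap c (\<gamma> p), v p)) (0, \<eta> p)))"
proof (rule first_var_chart[OF assms(1-3) c e smooth dom])
  fix v1 w w'
  assume v1: "\<And>t. t \<in> {p..q} \<Longrightarrow> ((\<lambda>\<tau>. cmap c (\<Gamma> 0 \<tau>)) has_vector_derivative v1 t) (at t within {p..q})"
    and w: "\<And>t. t \<in> {p..q} \<Longrightarrow> ((\<lambda>\<sigma>. cmap c (\<Gamma> \<sigma> t)) has_vector_derivative w t) (at 0)"
    and w': "\<And>t. t \<in> {p..q} \<Longrightarrow> (w has_vector_derivative w' t) (at t within {p..q})"
    and fv: "first_var t0 t1 \<Gamma> p q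
      (integral {p..q} (\<lambda>t. frechet_derivative (lc c) (at (cmap c (\<Gamma> 0 t), v1 t)) (w t, w' t)))"
  have \<Gamma>0: "cmap c (\<Gamma> 0 t) = cmap c (\<gamma> t)" if "t \<in> {p..q}" for t
    using coord[OF that, of 0] e by simp
  have eq_v: "v1 t = v t" if "t \<in> {p..q}" for t
  proof -
    have "(cmap c \<circ> \<gamma> has_vector_derivative v1 t) (at t within {p..q})"
      by (rule has_vector_derivative_transform[OF that _ v1[OF that]]) (simp add: \<Gamma>0)
    then show ?thesis
      using v[OF that] vector_derivative_unique_within[OF at_within_Icc_nontrivial[OF assms(2) that]] by blast
  qed
  have eq_w: "w t = \<eta> t" if "t \<in> {p..q}" for t
  proof -
    have "((\<lambda>\<sigma>. cmap c (\<gamma> t) + \<sigma> *\<^sub>R \<eta> t) has_vector_derivative \<eta> t) (at 0)"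
      by (auto intro!: derivative_eq_intros)
    then have "((\<lambda>\<sigma>. cmap c (\<Gamma> \<sigma> t)) has_vector_derivative \<eta> t) (at 0)"
      by (rule has_vector_derivative_transform_within[OF _ e _ coord[OF that, symmetric]]) (auto simp: dist_real_def)
    then show ?thesis
      using vector_derivative_unique_at[OF w[OF that]] by blast
  qed
  have d\<eta>: "(\<eta> has_vector_derivative w' t) (at t within {p..q})" if "t \<in> {p..q}" for t
    by (rule has_vector_derivative_transform[OF that _ w'[OF that]]) (simp add: eq_w)
  have im: "(\<lambda>t. cmap c (\<gamma> t)) ` {p..q} \<subseteq> cmap c ` cdom c"
  proof clarify
    fix t assume t: "t \<in> {p..q}"
    then have "\<Gamma> 0 t \<in> cdom c"
      using dom[of t 0] e by simp
    then show "cmap c (\<gamma> t) \<in> cmap c ` cdom c"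
      unfolding \<Gamma>0[OF t, symmetric] by (rule imageI)
  qed
  have "integral {p..q} (\<lambda>t. frechet_derivative (lc c) (at (cmap c (\<Gamma> 0 t), v1 t)) (w t, w' t)) =
      integral {p..q} (\<lambda>t. frechet_derivative (lc c) (at (cmap c (\<gamma> t), v t)) (\<eta> t, w' t))"
    by (rule Henstock_Kurzweil_Integration.integral_cong) (simp add: \<Gamma>0 eq_v eq_w)
  also have "\<dots> = E + (frechet_derivative (lc c) (at (cmap c (\<gamma> q), v q)) (0, \<eta> q)
      - frechet_derivative (lc c) (at (cmap c (\<gamma> p), v p)) (0, \<eta> p))"
    by (rule integral_unique[OF first_variation_by_parts[OF assms(2) open_chart_image[OF c] lc_smooth[OF c] im p' d\<eta> E]])
  finally show ?thesis
    using fv by simp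
qed

text \<open>The first variation is summed over [t0,a], [a,m], [m,b] and [b,t1]. Nothing moves
  outside [a,b], and the bump vanishes at a and b, so of all boundary terms only the jump of the
  momentum at m survives, weighted by the height (m-a)(b-m) of the bump there.\<close>

lemma extremal_bump:
  fixes \<gamma> :: "real \<Rightarrow> 'q"
  assumes "extremal A L t0 t1 \<gamma>" and "piecewise_smooth_curve A t0 t1 \<gamma>"
    and ab: "t0 \<le> a" "a < m" "m < b" "b \<le> t1" and c: "c \<in> A"
    and smooth: "smooth_map_on A {a..m} \<gamma>" "smooth_map_on A {m..b} \<gamma>"
    and dom: "\<gamma> ` {a..b} \<subseteq> cdom c"
    and v1: "\<And>t. t \<in> {a..m} \<Longrightarrow> (cmap c \<circ> \<gamma> has_vector_derivative v1 t) (at t within {a..m})"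
    and v2: "\<And>t. t \<in> {m..b} \<Longrightarrow> (cmap c \<circ> \<gamma> has_vector_derivative v2 t) (at t within {m..b})"
    and p1: "\<And>t h. t \<in> {a..m} \<Longrightarrow>
      ((\<lambda>\<tau>. frechet_derivative (lc c) (at (cmap c (\<gamma> \<tau>), v1 \<tau>)) (0, h)) has_vector_derivative p1 t h) (at t within {a..m})"
    and p2: "\<And>t h. t \<in> {m..b} \<Longrightarrow>
      ((\<lambda>\<tau>. frechet_derivative (lc c) (at (cmap c (\<gamma> \<tau>), v2 \<tau>)) (0, h)) has_vector_derivative p2 t h) (at t within {m..b})"
    and E1: "((\<lambda>t. (t - a) * (b - t) * (frechet_derivative (lc c) (at (cmap c (\<gamma> t), v1 t)) (h, 0) - p1 t h)) has_integral E1) {a..m}"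
    and E2: "((\<lambda>t. (t - a) * (b - t) * (frechet_derivative (lc c) (at (cmap c (\<gamma> t), v2 t)) (h, 0) - p2 t h)) has_integral E2) {m..b}"
  shows "E1 + E2 + (m - a) * (b - m) * (frechet_derivative (lc c) (at (cmap c (\<gamma> m), v1 m)) (0, h)
      - frechet_derivative (lc c) (at (cmap c (\<gamma> m), v2 m)) (0, h)) = 0"
proof -
  let ?\<eta> = "\<lambda>t. ((t - a) * (b - t)) *\<^sub>R h"
  obtain e \<Gamma> where e: "0 < e" and var: "fixed_endpoint_variation A t0 t1 \<gamma> e \<Gamma>"
    and \<Gamma>: "\<And>t s. t \<in> {a..b} \<Longrightarrow> s \<in> {-e..e} \<Longrightarrow> \<Gamma> s t \<in> cdom c"
      "\<And>t s. t \<in> {a..b} \<Longrightarrow> s \<in> {-e..e} \<Longrightarrow> cmap c (\<Gamma> s t) = cmap c (\<gamma> t) + s *\<^sub>R ?\<eta> t"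
      "\<And>t s. t \<notin> {a..b} \<Longrightarrow> \<Gamma> s t = \<gamma> t"
      "smooth_map_on A ({a..m} \<times> {-e..e}) (\<lambda>(t, s). \<Gamma> s t)"
      "smooth_map_on A ({m..b} \<times> {-e..e}) (\<lambda>(t, s). \<Gamma> s t)"
    by (rule bump_variation[OF assms(2) ab c smooth dom, of h]) blast
  have dom': "cmap c (\<gamma> t) \<in> cmap c ` cdom c" if "t \<in> {a..b}" for t
    using dom that by blast
  note lin = linear_frechet_derivative_on[OF open_chart_image[OF c] lc_smooth[OF c] dom']
  have scale: "frechet_derivative (lc c) (at (cmap c (\<gamma> t), v)) (0, r *\<^sub>R h) = r * frechet_derivative (lc c) (at (cmap c (\<gamma> t), v)) (0, h)"
    "frechet_derivative (lc c) (at (cmap c (\<gamma> t), v)) (r *\<^sub>R h, 0) = r * frechet_derivative (lc c) (at (cmap c (\<gamma> t), v)) (h, 0)"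
    if "t \<in> {a..b}" for t v r
    using linear_scale[OF lin(2)[OF that]] linear_scale[OF lin(3)[OF that]] by simp_all
  \<comment> \<open>Linearity lets the scalar bump be pulled out of p'. The pairing rule is invoked
    with the zero curve merely to extract this property.\<close>
  have lin_p: "linear (p' t)"
    if "p < q" "t \<in> {p..q}" "{p..q} \<subseteq> {a..b}" "\<And>h. ((\<lambda>\<tau>. frechet_derivative (lc c) (at (cmap c (\<gamma> \<tau>), v \<tau>)) (0, h)) has_vector_derivative p' t h) (at t within {p..q})"
    for p q t v and p' :: "real \<Rightarrow> 'e \<Rightarrow> real"
    by (rule has_vector_derivative_linear_pairing(2)[OF that(1,2) _ that(4) has_vector_derivative_const[of "0 :: 'e"]])
      (rule lin(2), use that(3) in auto)
  have fv1: "first_var t0 t1 \<Gamma> a m (E1 + (frechet_derivative (lc c) (at (cmap c (\<gamma> m), v1 m)) (0, ?\<eta> m)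
      - frechet_derivative (lc c) (at (cmap c (\<gamma> a), v1 a)) (0, ?\<eta> a)))"
  proof (rule first_var_bump_piece[OF ab(1,2) _ c e \<Gamma>(4) \<Gamma>(1) \<Gamma>(2) v1 p1])
    show "((\<lambda>t. frechet_derivative (lc c) (at (cmap c (\<gamma> t), v1 t)) (?\<eta> t, 0) - p1 t (?\<eta> t)) has_integral E1) {a..m}"
    proof (rule has_integral_eq[OF _ E1])
      fix t assume t: "t \<in> {a..m}"
      then show "(t - a) * (b - t) * (frechet_derivative (lc c) (at (cmap c (\<gamma> t), v1 t)) (h, 0) - p1 t h) =
          frechet_derivative (lc c) (at (cmap c (\<gamma> t), v1 t)) (?\<eta> t, 0) - p1 t (?\<eta> t)"
        using linear_scale[OF lin_p[of a m t v1 p1, OF ab(2) t _ p1[OF t]]] scale ab by (simp add: right_diff_distrib)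
    qed
  qed (use ab in auto)
  have fv2: "first_var t0 t1 \<Gamma> m b (E2 + (frechet_derivative (lc c) (at (cmap c (\<gamma> b), v2 b)) (0, ?\<eta> b)
      - frechet_derivative (lc c) (at (cmap c (\<gamma> m), v2 m)) (0, ?\<eta> m)))"
  proof (rule first_var_bump_piece[OF _ ab(3,4) c e \<Gamma>(5) \<Gamma>(1) \<Gamma>(2) v2 p2])
    show "((\<lambda>t. frechet_derivative (lc c) (at (cmap c (\<gamma> t), v2 t)) (?\<eta> t, 0) - p2 t (?\<eta> t)) has_integral E2) {m..b}"
    proof (rule has_integral_eq[OF _ E2])
      fix t assume t: "t \<in> {m..b}"
      then show "(t - a) * (b - t) * (frechet_derivative (lc c) (at (cmap c (\<gamma> t), v2 t)) (h, 0) - p2 t h) =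
          frechet_derivative (lc c) (at (cmap c (\<gamma> t), v2 t)) (?\<eta> t, 0) - p2 t (?\<eta> t)"
        using linear_scale[OF lin_p[of m b t v2 p2, OF ab(3) t _ p2[OF t]]] scale ab by (simp add: right_diff_distrib)
    qed
  qed (use ab in auto)
  have int: "(\<lambda>t. L (velocity A t0 t1 \<gamma> t)) integrable_on {t0..t1}"
    by (rule lagrangian_velocity_integrable[OF _ assms(2)]) (use ab in auto)
  have "first_var t0 t1 \<Gamma> t0 a 0" "first_var t0 t1 \<Gamma> b t1 0"
    by (rule first_var_constant[OF _ _ int]; use ab \<Gamma>(3) in auto)+
  moreover have "first_var t0 t1 \<Gamma> a m (E1 + (m - a) * (b - m) * frechet_derivative (lc c) (at (cmap c (\<gamma> m), v1 m)) (0, h))"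
    using fv1 scale(1)[of m "v1 m" "(m - a) * (b - m)"] scale(1)[of a "v1 a" "(a - a) * (b - a)"] ab
    by (simp only: atLeastAtMost_iff) simp
  moreover have "first_var t0 t1 \<Gamma> m b (E2 - (m - a) * (b - m) * frechet_derivative (lc c) (at (cmap c (\<gamma> m), v2 m)) (0, h))"
    using fv2 scale(1)[of m "v2 m" "(m - a) * (b - m)"] scale(1)[of b "v2 b" "(b - a) * (b - b)"] ab
    by (simp only: atLeastAtMost_iff) simp
  ultimately have "first_var t0 t1 \<Gamma> t0 t1 (0 + (E1 + (m - a) * (b - m) * frechet_derivative (lc c) (at (cmap c (\<gamma> m), v1 m)) (0, h) +
      (E2 - (m - a) * (b - m) * frechet_derivative (lc c) (at (cmap c (\<gamma> m), v2 m)) (0, h))) + 0)"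
    using ab by (intro first_var_combine[of t0 t1 \<Gamma> t0 b _ t1] first_var_combine[of t0 t1 \<Gamma> t0 a _ b] first_var_combine[of t0 t1 \<Gamma> a m _ b]) auto
  then have "first_var t0 t1 \<Gamma> t0 t1 (E1 + E2 + (m - a) * (b - m) * (frechet_derivative (lc c) (at (cmap c (\<gamma> m), v1 m)) (0, h)
      - frechet_derivative (lc c) (at (cmap c (\<gamma> m), v2 m)) (0, h)))"
    by (simp add: algebra_simps)
  moreover have "((\<lambda>s. action_functional A L t0 t1 (\<Gamma> s)) has_real_derivative 0) (at 0)"
    using assms(1) var unfolding extremal_def by blast
  ultimately show ?thesis
    unfolding first_var_def action_functional_def using DERIV_unique by blast
qed

text \<open>A time inside a smooth piece may be treated as a corner with the same v on both sides:
  the jump cancels and the weighted integral of the residual vanishes on every subinterval. The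
  residual is continuous, hence zero.\<close>

lemma extremal_Euler_Lagrange:
  fixes \<gamma> :: "real \<Rightarrow> 'q"
  assumes "extremal A L t0 t1 \<gamma>" and "piecewise_smooth_curve A t0 t1 \<gamma>"
    and ab: "t0 \<le> a" "a < b" "b \<le> t1" and c: "c \<in> A"
    and smooth: "smooth_map_on A {a..b} \<gamma>" and dom: "\<gamma> ` {a..b} \<subseteq> cdom c"
    and v: "smooth_on {a..b} v" "\<And>t. t \<in> {a..b} \<Longrightarrow> (cmap c \<circ> \<gamma> has_vector_derivative v t) (at t within {a..b})"
    and p': "continuous_on {a..b} (\<lambda>t. p' t h)"
      "\<And>t h. t \<in> {a..b} \<Longrightarrow> ((\<lambda>\<tau>. frechet_derivative (lc c) (at (cmap c (\<gamma> \<tau>), v \<tau>)) (0, h))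
        has_vector_derivative p' t h) (at t within {a..b})"
    and t: "t \<in> {a..b}"
  shows "frechet_derivative (lc c) (at (cmap c (\<gamma> t), v t)) (h, 0) = p' t h"
proof -
  define f where "f t = frechet_derivative (lc c) (at (cmap c (\<gamma> t), v t)) (h, 0) - p' t h" for t
  have "smooth_on {a..b} (\<lambda>t. frechet_derivative (lc c) (at ((cmap c \<circ> \<gamma>) t, v t)) (h, 0))"
    by (rule smooth_on_frechet_derivative_along[OF open_chart_image[OF c] lc_smooth[OF c] smooth_map_on_chart[OF smooth c dom] v(1)])
      (use dom in auto)
  from smooth_on_imp_continuous_on[OF this] have f: "continuous_on {a..b} f"
    unfolding f_def using p'(1) by (intro continuous_intros) simp_all
  have "f t = 0"
  proof (rule continuous_zero_if_bump_integrals_zero[OF ab(2) f _ t])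
    fix p q assume pq: "a \<le> p" "p < q" "q \<le> b"
    define m where "m = (p + q) / 2"
    have m: "p < m" "m < q"
      using pq by (auto simp: m_def)
    let ?g = "\<lambda>t. (t - p) * (q - t) * f t"
    have cont: "continuous_on {p..q} ?g"
      using pq by (intro continuous_intros continuous_on_subset[OF f]) auto
    have int: "?g integrable_on {r..s}" if "p \<le> r" "s \<le> q" for r s
      by (rule integrable_continuous_real[OF continuous_on_subset[OF cont]]) (use that in auto)
    have sub: "{p..m} \<subseteq> {a..b}" "{m..q} \<subseteq> {a..b}"
      using pq m by auto
    have "integral {p..m} ?g + integral {m..q} ?g + (m - p) * (q - m) *
       (frechet_derivative (lc c) (at (cmap c (\<gamma> m), v m)) (0, h)
        - frechet_derivative (lc c) (at (cmap c (\<gamma> m), v m)) (0, h)) = 0"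
    proof (rule extremal_bump[OF assms(1,2) _ m _ c])
      show "smooth_map_on A {p..m} \<gamma>" "smooth_map_on A {m..q} \<gamma>"
        by (rule smooth_map_on_subset[OF smooth], fact sub)+
      show "(cmap c \<circ> \<gamma> has_vector_derivative v t) (at t within {p..m})" if "t \<in> {p..m}" for t
        using v(2)[of t] sub(1) that by (blast intro: has_vector_derivative_within_subset)
      show "(cmap c \<circ> \<gamma> has_vector_derivative v t) (at t within {m..q})" if "t \<in> {m..q}" for t
        using v(2)[of t] sub(2) that by (blast intro: has_vector_derivative_within_subset)
      show "((\<lambda>\<tau>. frechet_derivative (lc c) (at (cmap c (\<gamma> \<tau>), v \<tau>)) (0, h)) has_vector_derivative p' t h) (at t within {p..m})"
        if "t \<in> {p..m}" for t h
        by (rule has_vector_derivative_within_subset[OF p'(2) sub(1)]) (use that sub(1) in blast)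
      show "((\<lambda>\<tau>. frechet_derivative (lc c) (at (cmap c (\<gamma> \<tau>), v \<tau>)) (0, h)) has_vector_derivative p' t h) (at t within {m..q})"
        if "t \<in> {m..q}" for t h
        by (rule has_vector_derivative_within_subset[OF p'(2) sub(2)]) (use that sub(2) in blast)
      show "((\<lambda>t. (t - p) * (q - t) * (frechet_derivative (lc c) (at (cmap c (\<gamma> t), v t)) (h, 0) - p' t h)) has_integral integral {p..m} ?g) {p..m}"
        "((\<lambda>t. (t - p) * (q - t) * (frechet_derivative (lc c) (at (cmap c (\<gamma> t), v t)) (h, 0) - p' t h)) has_integral integral {m..q} ?g) {m..q}"
        unfolding f_def[symmetric] using int m by (auto intro!: integrable_integral)
    qed (use pq ab dom in auto)
    then show "integral {p..q} ?g = 0"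
      using Henstock_Kurzweil_Integration.integral_combine[of p m q ?g] m int[of p q] by simp
  qed
  then show ?thesis
    by (simp add: f_def)
qed

text \<open>The Euler-Lagrange equation on either side of m makes both residual integrals zero, so
  the jump times the positive number (m-a)(b-m) is zero.\<close>

lemma extremal_corner:
  fixes \<gamma> :: "real \<Rightarrow> 'q"
  assumes "extremal A L t0 t1 \<gamma>" and "piecewise_smooth_curve A t0 t1 \<gamma>"
    and ab: "t0 \<le> a" "a < m" "m < b" "b \<le> t1" and c: "c \<in> A"
    and smooth: "smooth_map_on A {a..m} \<gamma>" "smooth_map_on A {m..b} \<gamma>"
    and dom: "\<gamma> ` {a..b} \<subseteq> cdom c"
    and v1: "smooth_on {a..m} v1" "\<And>t. t \<in> {a..m} \<Longrightarrow> (cmap c \<circ> \<gamma> has_vector_derivative v1 t) (at t within {a..m})"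
    and v2: "smooth_on {m..b} v2" "\<And>t. t \<in> {m..b} \<Longrightarrow> (cmap c \<circ> \<gamma> has_vector_derivative v2 t) (at t within {m..b})"
  shows "frechet_derivative (lc c) (at (cmap c (\<gamma> m), v1 m)) (0, h) =
    frechet_derivative (lc c) (at (cmap c (\<gamma> m), v2 m)) (0, h)"
proof -
  have dom1: "\<gamma> ` {a..m} \<subseteq> cdom c" and dom2: "\<gamma> ` {m..b} \<subseteq> cdom c"
    using dom ab by auto
  have mt: "m \<le> t1" "t0 \<le> m"
    using ab by auto
  have im1: "(cmap c \<circ> \<gamma>) ` {a..m} \<subseteq> cmap c ` cdom c" and im2: "(cmap c \<circ> \<gamma>) ` {m..b} \<subseteq> cmap c ` cdom c"
    using dom1 dom2 by auto
  obtain p1 where p1: "\<And>h. continuous_on {a..m} (\<lambda>t. p1 t h)"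
    "\<And>t h. t \<in> {a..m} \<Longrightarrow> ((\<lambda>\<tau>. frechet_derivative (lc c) (at ((cmap c \<circ> \<gamma>) \<tau>, v1 \<tau>)) (0, h))
        has_vector_derivative p1 t h) (at t within {a..m})"
    by (rule momentum_derivative[OF ab(2) open_chart_image[OF c] lc_smooth[OF c]
          smooth_map_on_chart[OF smooth(1) c dom1] v1(1) im1]) blast
  obtain p2 where p2: "\<And>h. continuous_on {m..b} (\<lambda>t. p2 t h)"
    "\<And>t h. t \<in> {m..b} \<Longrightarrow> ((\<lambda>\<tau>. frechet_derivative (lc c) (at ((cmap c \<circ> \<gamma>) \<tau>, v2 \<tau>)) (0, h))
        has_vector_derivative p2 t h) (at t within {m..b})"
    by (rule momentum_derivative[OF ab(3) open_chart_image[OF c] lc_smooth[OF c]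
          smooth_map_on_chart[OF smooth(2) c dom2] v2(1) im2]) blast
  note p = p1(2)[unfolded o_apply] p2(2)[unfolded o_apply]
  have EL1: "frechet_derivative (lc c) (at (cmap c (\<gamma> t), v1 t)) (h, 0) = p1 t h" if "t \<in> {a..m}" for t
    by (rule extremal_Euler_Lagrange[OF assms(1,2) ab(1,2) mt(1) c smooth(1) dom1 v1 p1(1) p(1) that])
  have EL2: "frechet_derivative (lc c) (at (cmap c (\<gamma> t), v2 t)) (h, 0) = p2 t h" if "t \<in> {m..b}" for t
    by (rule extremal_Euler_Lagrange[OF assms(1,2) mt(2) ab(3,4) c smooth(2) dom2 v2 p2(1) p(2) that])
  have "0 + 0 + (m - a) * (b - m) * (frechet_derivative (lc c) (at (cmap c (\<gamma> m), v1 m)) (0, h)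
      - frechet_derivative (lc c) (at (cmap c (\<gamma> m), v2 m)) (0, h)) = 0"
  proof (rule extremal_bump[OF assms(1,2) ab c smooth dom v1(2) v2(2) p])
    show "((\<lambda>t. (t - a) * (b - t) * (frechet_derivative (lc c) (at (cmap c (\<gamma> t), v1 t)) (h, 0) - p1 t h)) has_integral 0) {a..m}"
      by (rule has_integral_is_0) (simp add: EL1)
    show "((\<lambda>t. (t - a) * (b - t) * (frechet_derivative (lc c) (at (cmap c (\<gamma> t), v2 t)) (h, 0) - p2 t h)) has_integral 0) {m..b}"
      by (rule has_integral_is_0) (simp add: EL2)
  qed
  then show ?thesis
    using ab by simp
qed

end

section \<open>Extremals and the Euler-Poincare equation\<close>

lemma curve_near:
  fixes \<gamma> :: "real \<Rightarrow> 'q::topological_space"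
  assumes "continuous_on {t0..t1} \<gamma>" "t \<in> {t0..t1}" "open W" "\<gamma> t \<in> W"
  obtains d where "0 < d" "\<And>\<tau>. \<tau> \<in> {t0..t1} \<Longrightarrow> \<bar>\<tau> - t\<bar> \<le> d \<Longrightarrow> \<gamma> \<tau> \<in> W"
proof -
  have "continuous_on ({t0..t1} \<times> {-1..1::real}) (\<lambda>z. \<gamma> (fst z))"
    by (rule continuous_on_compose2[OF assms(1)]) (auto intro!: continuous_intros)
  then obtain d where "0 < d" "\<And>\<tau> s. \<tau> \<in> {t0..t1} \<Longrightarrow> \<bar>\<tau> - t\<bar> \<le> d \<Longrightarrow> \<bar>s\<bar> \<le> d \<Longrightarrow> \<gamma> (fst (\<tau>, s)) \<in> W"
    by (rule eventually_near_slice[OF _ assms(2) zero_less_one assms(3)]) (use assms(4) in auto)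
  then show thesis
    by (intro that[of d]) (auto intro: \<open>\<And>\<tau> s. _ \<Longrightarrow> _ \<Longrightarrow> _ \<Longrightarrow> \<gamma> (fst (\<tau>, s)) \<in> W\<close>[of _ 0, simplified])
qed

section \<open>Smooth pieces of the curve inside one chart\<close>

context manifold
begin

text \<open>The interval is taken in the subdivision piece that contains t and extends to its right,
  so a corner at t does no harm.\<close>

lemma curve_piece_right:
  fixes \<gamma> :: "real \<Rightarrow> 'q"
  assumes "piecewise_smooth_curve A t0 t1 \<gamma>" "t0 \<le> t" "t < t1" "c \<in> A" "\<gamma> t \<in> cdom c"
  obtains b where "t < b" "b \<le> t1" "smooth_map_on A {t..b} \<gamma>" "\<gamma> ` {t..b} \<subseteq> cdom c"
proof -
  obtain P where \<gamma>: "continuous_on {t0..t1} \<gamma>" and P: "subdivision t0 t1 P"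
    and piece: "\<And>a b. (a, b) \<in> pieces P \<Longrightarrow> smooth_map_on A {a..b} \<gamma>"
    using assms(1) unfolding piecewise_smooth_curve_def by blast
  obtain p q where pq: "(p, q) \<in> pieces P" "p \<le> t" "t < q"
    using subdivision_piece_right[OF P assms(2,3)] by blast
  obtain d where d: "0 < d" "\<And>\<tau>. \<tau> \<in> {t0..t1} \<Longrightarrow> \<bar>\<tau> - t\<bar> \<le> d \<Longrightarrow> \<gamma> \<tau> \<in> cdom c"
    using curve_near[OF \<gamma> _ open_cdom[OF assms(4)] assms(5)] assms(2,3) by auto
  have "q \<le> t1"
    using pq(1) P unfolding pieces_def subdivision_def by auto
  show thesis
  proof (rule that[of "min q (t + d)"])
    show "smooth_map_on A {t..min q (t + d)} \<gamma>"
      by (rule smooth_map_on_subset[OF piece[OF pq(1)]]) (use pq in auto)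
    show "\<gamma> ` {t..min q (t + d)} \<subseteq> cdom c"
      using d(2) assms(2) \<open>q \<le> t1\<close> by auto
  qed (use pq d(1) \<open>q \<le> t1\<close> in auto)
qed

lemma curve_piece_left:
  fixes \<gamma> :: "real \<Rightarrow> 'q"
  assumes "piecewise_smooth_curve A t0 t1 \<gamma>" "t0 < t" "t \<le> t1" "c \<in> A" "\<gamma> t \<in> cdom c"
  obtains a where "a < t" "t0 \<le> a" "smooth_map_on A {a..t} \<gamma>" "\<gamma> ` {a..t} \<subseteq> cdom c"
proof -
  obtain P where \<gamma>: "continuous_on {t0..t1} \<gamma>" and P: "subdivision t0 t1 P"
    and piece: "\<And>a b. (a, b) \<in> pieces P \<Longrightarrow> smooth_map_on A {a..b} \<gamma>"
    using assms(1) unfolding piecewise_smooth_curve_def by blast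
  obtain p q where pq: "(p, q) \<in> pieces P" "p < t" "t \<le> q"
    using subdivision_piece_left[OF P assms(2,3)] by blast
  obtain d where d: "0 < d" "\<And>\<tau>. \<tau> \<in> {t0..t1} \<Longrightarrow> \<bar>\<tau> - t\<bar> \<le> d \<Longrightarrow> \<gamma> \<tau> \<in> cdom c"
    using curve_near[OF \<gamma> _ open_cdom[OF assms(4)] assms(5)] assms(2,3) by auto
  have "t0 \<le> p"
    using pq(1) P unfolding pieces_def subdivision_def by auto
  show thesis
  proof (rule that[of "max p (t - d)"])
    show "smooth_map_on A {max p (t - d)..t} \<gamma>"
      by (rule smooth_map_on_subset[OF piece[OF pq(1)]]) (use pq in auto)
    show "\<gamma> ` {max p (t - d)..t} \<subseteq> cdom c"
      using d(2) assms(3) \<open>t0 \<le> p\<close> by auto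
  qed (use pq d(1) \<open>t0 \<le> p\<close> in auto)
qed

lemma smooth_at_time_interior:
  assumes "smooth_map_on A {a..b} \<gamma>" "t \<in> {a<..<b}"
  shows "smooth_at_time A t0 t1 \<gamma> t"
  unfolding smooth_at_time_def
  by (intro exI[of _ "min (t - a) (b - t)"] conjI smooth_map_on_subset[OF assms(1)])
    (use assms(2) in \<open>auto simp: dist_real_def\<close>)

lemma smooth_coordinate_velocity:
  fixes \<gamma> :: "real \<Rightarrow> 'q"
  assumes "a < b" "c \<in> A" "smooth_map_on A {a..b} \<gamma>" "\<gamma> ` {a..b} \<subseteq> cdom c"
  obtains v where "smooth_on {a..b} v"
    "\<And>t. t \<in> {a..b} \<Longrightarrow> (cmap c \<circ> \<gamma> has_vector_derivative v t) (at t within {a..b})"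
  by (rule smooth_on_vector_derivative[OF assms(1) smooth_map_on_chart[OF assms(3,2,4)]]) blast

text \<open>The inner interval \<open>{a..b}\<close> is surrounded by a larger one on which the curve is smooth, so
  that \<open>v\<close> also gives the velocity at \<open>a\<close> and \<open>b\<close>, where it is computed within \<open>{t0..t1}\<close>.\<close>

lemma smooth_time_interval:
  fixes \<gamma> :: "real \<Rightarrow> 'q"
  assumes "continuous_on {t0..t1} \<gamma>" "t0 < t1" "t \<in> {t0..t1}" "smooth_at_time A t0 t1 \<gamma> t"
    and c: "c \<in> A" "\<gamma> t \<in> cdom c"
  obtains a b v where "t0 \<le> a" "a < b" "b \<le> t1" "t \<in> {a..b}" "at t within {t0..t1} = at t within {a..b}"
    "smooth_map_on A {a..b} \<gamma>" "\<gamma> ` {a..b} \<subseteq> cdom c" "smooth_on {a..b} v"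
    "\<And>\<tau>. \<tau> \<in> {a..b} \<Longrightarrow> (cmap c \<circ> \<gamma> has_vector_derivative v \<tau>) (at \<tau> within {a..b})"
    "\<And>\<tau>. \<tau> \<in> {a..b} \<Longrightarrow> smooth_at_time A t0 t1 \<gamma> \<tau>"
    "\<And>\<tau>. \<tau> \<in> {a..b} \<Longrightarrow> velocity A t0 t1 \<gamma> \<tau> = (\<gamma> \<tau>, tvec A c (\<gamma> \<tau>) (v \<tau>))"
proof -
  obtain \<delta> where \<delta>: "\<delta> > 0" "smooth_map_on A ({t0..t1} \<inter> ball t \<delta>) \<gamma>"
    using assms(4) unfolding smooth_at_time_def by blast
  obtain d where d: "0 < d" "\<And>\<tau>. \<tau> \<in> {t0..t1} \<Longrightarrow> \<bar>\<tau> - t\<bar> \<le> d \<Longrightarrow> \<gamma> \<tau> \<in> cdom c"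
    using curve_near[OF assms(1,3) open_cdom[OF c(1)] c(2)] by blast
  define r where "r = min d (\<delta> / 2)"
  have r: "0 < r" "r \<le> d" "r < \<delta>"
    using d \<delta> by (auto simp: r_def)
  define a1 b1 a b where "a1 = max t0 (t - r)" and "b1 = min t1 (t + r)"
    and "a = max t0 (t - r / 2)" and "b = min t1 (t + r / 2)"
  note defs = a1_def b1_def a_def b_def
  have smooth1: "smooth_map_on A {a1..b1} \<gamma>"
    by (rule smooth_map_on_subset[OF \<delta>(2)]) (use r in \<open>auto simp: defs dist_real_def\<close>)
  have dom1: "\<gamma> ` {a1..b1} \<subseteq> cdom c"
    using d(2) r by (auto simp: defs)
  have ab1: "a1 < b1"
    using assms(2,3) r by (auto simp: defs)
  obtain v where v: "smooth_on {a1..b1} v"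
    "\<And>\<tau>. \<tau> \<in> {a1..b1} \<Longrightarrow> (cmap c \<circ> \<gamma> has_vector_derivative v \<tau>) (at \<tau> within {a1..b1})"
    by (rule smooth_coordinate_velocity[OF ab1 c(1) smooth1 dom1]) blast
  have sub: "{a..b} \<subseteq> {a1..b1}"
    using r by (auto simp: defs)
  \<comment> \<open>Inner points lie at least r/2 away from every end of the outer interval that is
    not t0 or t1, so the two filters agree.\<close>
  have within1: "at \<tau> within {t0..t1} = at \<tau> within {a1..b1}" if "\<tau> \<in> {a..b}" for \<tau>
    by (rule at_within_nhd[of _ "{\<tau> - r / 2<..<\<tau> + r / 2}"])
      (use that r in \<open>auto simp: defs\<close>)
  show thesis
  proof (rule that[of a b v])
    show "at t within {t0..t1} = at t within {a..b}"
      by (rule at_within_nhd[of _ "{t - r / 2<..<t + r / 2}"]) (use assms(3) r in \<open>auto simp: defs\<close>)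
    show "smooth_map_on A {a..b} \<gamma>" "smooth_on {a..b} v"
      using smooth_map_on_subset[OF smooth1 sub] smooth_on_subset[OF v(1) sub] by auto
    show "\<gamma> ` {a..b} \<subseteq> cdom c"
      using dom1 sub by auto
    fix \<tau> assume \<tau>: "\<tau> \<in> {a..b}"
    then have \<tau>1: "\<tau> \<in> {a1..b1}"
      using sub by blast
    show "(cmap c \<circ> \<gamma> has_vector_derivative v \<tau>) (at \<tau> within {a..b})"
      by (rule has_vector_derivative_within_subset[OF v(2)[OF \<tau>1] sub])
    show "smooth_at_time A t0 t1 \<gamma> \<tau>"
      unfolding smooth_at_time_def
    proof (intro exI[of _ "\<delta> / 2"] conjI smooth_map_on_subset[OF \<delta>(2)])
      have "dist t \<tau> < \<delta> / 2"
        using \<tau> r by (auto simp: defs r_def dist_real_def abs_if)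
      then have "ball \<tau> (\<delta> / 2) \<subseteq> ball t \<delta>"
        by (auto simp: ball_subset_ball_iff dist_commute)
      then show "{t0..t1} \<inter> ball \<tau> (\<delta> / 2) \<subseteq> {t0..t1} \<inter> ball t \<delta>"
        by blast
    qed (use \<delta>(1) in auto)
    show "velocity A t0 t1 \<gamma> \<tau> = (\<gamma> \<tau>, tvec A c (\<gamma> \<tau>) (v \<tau>))"
    proof (rule velocity_in_chart[OF assms(2) _ c(1)])
      show "\<tau> \<in> {t0..t1}"
        using \<tau> by (auto simp: defs)
      then show "continuous (at \<tau> within {t0..t1}) \<gamma>"
        using assms(1) by (simp add: continuous_on_eq_continuous_within)
      show "\<gamma> \<tau> \<in> cdom c"
        using dom1 \<tau>1 by blast
      show "(cmap c \<circ> \<gamma> has_vector_derivative v \<tau>) (at \<tau> within {t0..t1})"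
        unfolding within1[OF \<tau>] by (rule v(2)[OF \<tau>1])
    qed
  qed (use assms(2,3) r in \<open>auto simp: defs\<close>)
qed

end

section \<open>From extremals to the Euler-Poincare equation\<close>

context lagrangian_action
begin

lemma compatible_coordinates:
  assumes "compatible A \<psi> t0 t1 \<gamma> V" "t \<in> {t0..t1}" "smooth_at_time A t0 t1 \<gamma> t" "c \<in> A" "\<gamma> t \<in> cdom c"
    and "velocity A t0 t1 \<gamma> t = (\<gamma> t, tvec A c (\<gamma> t) w)"
  shows "tcoord A c (\<gamma> t) (\<psi> (V t) (\<gamma> t)) = w"
proof -
  have "velocity A t0 t1 \<gamma> t = phi \<psi> (\<gamma> t, V t)"
    using assms(1-3) unfolding compatible_def by blast
  then have "\<psi> (V t) (\<gamma> t) = tvec A c (\<gamma> t) w"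
    using assms(6) by (simp add: phi_def)
  then show ?thesis
    using tcoord_tvec[OF assms(4,5), of w] by metis
qed

text \<open>Inside the piece compatibility replaces V by the coordinate velocity v, which is smooth
  up to the ends. The limit therefore exists even at a corner, where compatibility does not
  constrain V; it is expressed there by any X whose action gives the one-sided velocity.\<close>

lemma momentum_limit:
  fixes \<gamma> :: "real \<Rightarrow> 'q"
  assumes compat: "compatible A \<psi> t0 t1 \<gamma> V"
    and ab: "t0 \<le> a" "a < b" "b \<le> t1" and c: "c \<in> A"
    and smooth: "smooth_map_on A {a..b} \<gamma>" and dom: "\<gamma> ` {a..b} \<subseteq> cdom c"
    and v: "smooth_on {a..b} v" "\<And>t. t \<in> {a..b} \<Longrightarrow> (cmap c \<circ> \<gamma> has_vector_derivative v t) (at t within {a..b})"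
    and t: "t \<in> {a..b}" and X: "tcoord A c (\<gamma> t) (\<psi> X (\<gamma> t)) = v t"
  shows "((\<lambda>\<tau>. momentum (\<gamma> \<tau>, V \<tau>)) \<longlongrightarrow> momentum (\<gamma> t, X)) (at t within {a<..<b})"
proof (rule tendsto_componentwise1)
  fix Y :: 'g
  let ?g = "\<lambda>\<tau>. frechet_derivative (lc c) (at (cmap c (\<gamma> \<tau>), v \<tau>)) (0, vf_rep A c (\<psi> Y) (cmap c (\<gamma> \<tau>)))"
  have dom': "\<gamma> \<tau> \<in> cdom c" if "\<tau> \<in> {a..b}" for \<tau>
    using dom that by blast
  have im: "(cmap c \<circ> \<gamma>) ` {a..b} \<subseteq> cmap c ` cdom c"
    using dom by auto
  obtain p' where p': "\<And>t h. t \<in> {a..b} \<Longrightarrow> ((\<lambda>\<tau>. frechet_derivative (lc c) (at ((cmap c \<circ> \<gamma>) \<tau>, v \<tau>)) (0, h))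
        has_vector_derivative p' t h) (at t within {a..b})"
    by (rule momentum_derivative[OF ab(2) open_chart_image[OF c] lc_smooth[OF c]
          smooth_map_on_chart[OF smooth c dom] v(1) im]) blast
  have "(vf_rep A c (\<psi> Y) \<circ> (cmap c \<circ> \<gamma>) has_vector_derivative
      frechet_derivative (vf_rep A c (\<psi> Y)) (at (cmap c (\<gamma> t))) (v t)) (at t within {a..b})"
    by (rule vector_derivative_diff_chain_within[OF v(2)[OF t]])
      (simp add: has_derivative_at_withinI[OF vf_rep_has_derivative[OF c dom'[OF t]]])
  then have \<xi>: "((\<lambda>\<tau>. vf_rep A c (\<psi> Y) (cmap c (\<gamma> \<tau>))) has_vector_derivative
      frechet_derivative (vf_rep A c (\<psi> Y)) (at (cmap c (\<gamma> t))) (v t)) (at t within {a..b})"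
    by (simp add: o_def)
  have "continuous (at t within {a..b}) ?g"
    by (rule has_vector_derivative_continuous[OF has_vector_derivative_linear_pairing(1)[OF ab(2) t _ p'[OF t, unfolded o_apply] \<xi>]])
      (rule linear_frechet_derivative_on(2)[OF open_chart_image[OF c] lc_smooth[OF c] imageI[OF dom']])
  then have "(?g \<longlongrightarrow> ?g t) (at t within {a<..<b})"
    unfolding continuous_within by (rule tendsto_within_subset) auto
  moreover have "?g t = blinfun_apply (momentum (\<gamma> t, X)) Y"
    using momentum_apply[OF c dom'[OF t], of X Y] vf_rep_cmap[OF c dom'[OF t]] X by simp
  moreover have "blinfun_apply (momentum (\<gamma> \<tau>, V \<tau>)) Y = ?g \<tau>" if "\<tau> \<in> {a<..<b}" for \<tau>
  proof -
    have \<tau>: "\<tau> \<in> {a..b}" "\<tau> \<in> {t0..t1}"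
      using that ab by auto
    have "velocity A t0 t1 \<gamma> \<tau> = (\<gamma> \<tau>, tvec A c (\<gamma> \<tau>) (v \<tau>))"
      by (rule velocity_in_chart_interior[OF ab(1,3) that c dom'[OF \<tau>(1)] _ v(2)[OF \<tau>(1)]])
        (use smooth in \<open>simp add: smooth_map_on_def\<close>)
    from compatible_coordinates[OF compat \<tau>(2) smooth_at_time_interior[OF smooth that] c dom'[OF \<tau>(1)] this]
    show ?thesis
      using momentum_apply[OF c dom'[OF \<tau>(1)], of "V \<tau>" Y] vf_rep_cmap[OF c dom'[OF \<tau>(1)]] by simp
  qed
  then have "((\<lambda>\<tau>. blinfun_apply (momentum (\<gamma> \<tau>, V \<tau>)) Y) \<longlongrightarrow> ?g t) (at t within {a<..<b}) \<longleftrightarrow>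
      (?g \<longlongrightarrow> ?g t) (at t within {a<..<b})"
    by (intro Lim_cong_within refl)
  ultimately show "((\<lambda>\<tau>. blinfun_apply (momentum (\<gamma> \<tau>, V \<tau>)) Y) \<longlongrightarrow> blinfun_apply (momentum (\<gamma> t, X)) Y) (at t within {a<..<b})"
    by (simp only:)
qed

lemma action_preimage_coordinates:
  assumes "c \<in> A" "x \<in> cdom c"
  obtains X where "tcoord A c x (\<psi> X x) = w"
  using transitive_obtain[of x "tvec A c x w"] tcoord_tvec[OF assms] by metis

lemma extremal_imp_Euler_Poincare:
  fixes \<gamma> :: "real \<Rightarrow> 'q"
  assumes ext: "extremal A L t0 t1 \<gamma>" and "t0 < t1" and pw: "piecewise_smooth_curve A t0 t1 \<gamma>"
    and compat: "compatible A \<psi> t0 t1 \<gamma> V"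
  shows "Euler_Poincare A br t0 t1 \<gamma> V momentum (Omega A \<psi> L)"
  unfolding Euler_Poincare_def
proof (intro conjI ballI impI)
  have cont: "continuous_on {t0..t1} \<gamma>"
    using pw unfolding piecewise_smooth_curve_def by blast
  fix t assume t: "t \<in> {t0..t1}" "smooth_at_time A t0 t1 \<gamma> t"
  define c where "c = chart_at A (\<gamma> t)"
  have c: "c \<in> A" "\<gamma> t \<in> cdom c"
    using chart_at by (auto simp: c_def)
  show "\<exists>D. ((\<lambda>\<tau>. momentum (\<gamma> \<tau>, V \<tau>)) has_vector_derivative D) (at t within {t0..t1}) \<and>
      D - ad_star br (V t) (momentum (\<gamma> t, V t)) = Omega A \<psi> L (\<gamma> t, V t)"
  proof (rule smooth_time_interval[OF cont \<open>t0 < t1\<close> t c])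
    fix a b v
    assume ab: "t0 \<le> a" "a < b" "b \<le> t1" and tab: "t \<in> {a..b}"
      and within: "at t within {t0..t1} = at t within {a..b}"
      and smooth: "smooth_map_on A {a..b} \<gamma>" and dom: "\<gamma> ` {a..b} \<subseteq> cdom c" and v: "smooth_on {a..b} v"
      and dv: "\<And>\<tau>. \<tau> \<in> {a..b} \<Longrightarrow> (cmap c \<circ> \<gamma> has_vector_derivative v \<tau>) (at \<tau> within {a..b})"
      and st: "\<And>\<tau>. \<tau> \<in> {a..b} \<Longrightarrow> smooth_at_time A t0 t1 \<gamma> \<tau>"
      and vel: "\<And>\<tau>. \<tau> \<in> {a..b} \<Longrightarrow> velocity A t0 t1 \<gamma> \<tau> = (\<gamma> \<tau>, tvec A c (\<gamma> \<tau>) (v \<tau>))"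
    have im: "(cmap c \<circ> \<gamma>) ` {a..b} \<subseteq> cmap c ` cdom c"
      using dom by auto
    obtain p' where p': "\<And>h. continuous_on {a..b} (\<lambda>t. p' t h)"
      "\<And>t h. t \<in> {a..b} \<Longrightarrow> ((\<lambda>\<tau>. frechet_derivative (lc c) (at ((cmap c \<circ> \<gamma>) \<tau>, v \<tau>)) (0, h))
          has_vector_derivative p' t h) (at t within {a..b})"
      by (rule momentum_derivative[OF ab(2) open_chart_image[OF c(1)] lc_smooth[OF c(1)]
            smooth_map_on_chart[OF smooth c(1) dom] v im]) blast
    have V: "tcoord A c (\<gamma> \<tau>) (\<psi> (V \<tau>) (\<gamma> \<tau>)) = v \<tau>" if "\<tau> \<in> {a..b}" for \<tau>
      by (rule compatible_coordinates[OF compat _ st[OF that] c(1) _ vel[OF that]])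
        (use that ab dom in auto)
    have "p' t h = frechet_derivative (lc c) (at (cmap c (\<gamma> t), v t)) (h, 0)" for h
      by (rule extremal_Euler_Lagrange[OF ext pw ab c(1) smooth dom v dv p'(1) p'(2)[unfolded o_apply] tab, symmetric])
    then show ?thesis
      unfolding within
      using Euler_Poincare_iff_Euler_Lagrange[OF ab(2) tab c_def dom dv[OF tab] V p'(2)[OF tab, unfolded o_apply]] by blast
  qed
next
  fix t assume t: "t \<in> {t0<..<t1}"
  define c where "c = chart_at A (\<gamma> t)"
  have c: "c \<in> A" "\<gamma> t \<in> cdom c"
    using chart_at by (auto simp: c_def)
  obtain b where b: "t < b" "b \<le> t1" "smooth_map_on A {t..b} \<gamma>" "\<gamma> ` {t..b} \<subseteq> cdom c"
    using curve_piece_right[OF pw _ _ c] t by auto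
  obtain a where a: "a < t" "t0 \<le> a" "smooth_map_on A {a..t} \<gamma>" "\<gamma> ` {a..t} \<subseteq> cdom c"
    using curve_piece_left[OF pw _ _ c] t by auto
  obtain v1 where v1: "smooth_on {a..t} v1"
    "\<And>\<tau>. \<tau> \<in> {a..t} \<Longrightarrow> (cmap c \<circ> \<gamma> has_vector_derivative v1 \<tau>) (at \<tau> within {a..t})"
    by (rule smooth_coordinate_velocity[OF a(1) c(1) a(3,4)]) blast
  obtain v2 where v2: "smooth_on {t..b} v2"
    "\<And>\<tau>. \<tau> \<in> {t..b} \<Longrightarrow> (cmap c \<circ> \<gamma> has_vector_derivative v2 \<tau>) (at \<tau> within {t..b})"
    by (rule smooth_coordinate_velocity[OF b(1) c(1) b(3,4)]) blast
  \<comment> \<open>X1 and X2 represent the left and right velocities at t; at a corner V t need not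
    represent either of them.\<close>
  obtain X1 where X1: "tcoord A c (\<gamma> t) (\<psi> X1 (\<gamma> t)) = v1 t"
    by (rule action_preimage_coordinates[OF c])
  obtain X2 where X2: "tcoord A c (\<gamma> t) (\<psi> X2 (\<gamma> t)) = v2 t"
    by (rule action_preimage_coordinates[OF c])
  have "\<gamma> ` {a..b} \<subseteq> cdom c"
  proof -
    have "{a..b} = {a..t} \<union> {t..b}"
      using a b by auto
    then show ?thesis
      using a(4) b(4) by (simp add: image_Un)
  qed
  then have "frechet_derivative (lc c) (at (cmap c (\<gamma> t), v1 t)) (0, h) =
      frechet_derivative (lc c) (at (cmap c (\<gamma> t), v2 t)) (0, h)" for h
    by (intro extremal_corner[OF ext pw a(2,1) b(1,2) c(1) a(3) b(3) _ v1 v2])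
  \<comment> \<open>In coordinates the two momenta are the one-sided fibre derivatives, evaluated on
    the same vectors, and these agree at the corner. Hence the left and right limits below
    coincide.\<close>
  then have eq: "momentum (\<gamma> t, X1) = momentum (\<gamma> t, X2)"
    by (intro blinfun_eqI) (simp add: momentum_apply[OF c] X1 X2 del: o_apply)
  let ?M = "\<lambda>\<tau>. momentum (\<gamma> \<tau>, V \<tau>)"
  have "at t within {a<..<t} = at_left t"
    by (rule at_within_nhd[of _ "{a<..}"]) (use a in auto)
  then have left: "(?M \<longlongrightarrow> momentum (\<gamma> t, X1)) (at_left t)"
    using momentum_limit[OF compat a(2,1) _ c(1) a(3,4) v1 _ X1] t a(1) by (simp del: o_apply)
  have "at t within {t<..<b} = at_right t"
    by (rule at_within_nhd[of _ "{..<b}"]) (use b in auto)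
  then have right: "(?M \<longlongrightarrow> momentum (\<gamma> t, X1)) (at_right t)"
    unfolding eq using momentum_limit[OF compat _ b(1,2) c(1) b(3,4) v2 _ X2] t b(1) by (simp del: o_apply)
  from left right have "(?M \<longlongrightarrow> momentum (\<gamma> t, X1)) (at t)"
    by (rule filterlim_split_at)
  then show "\<exists>\<mu>. (?M \<longlongrightarrow> \<mu>) (at t)"
    by blast
qed

end

section \<open>From the Euler-Poincare equation to extremals\<close>

context manifold
begin

text \<open>A vector in the tangent space at \<open>\<Gamma> 0 t\<close>, hence taken in the chart
  representing that space. This is legitimate for fixed t; regularity in t appears only after
  passing to a fixed chart.\<close>

definition variation_field :: "(real \<Rightarrow> real \<Rightarrow> 'q) \<Rightarrow> real \<Rightarrow> 'e" where
  "variation_field \<Gamma> t = vector_derivative (cmap (chart_at A (\<Gamma> 0 t)) \<circ> (\<lambda>\<sigma>. \<Gamma> \<sigma> t)) (at 0)"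

lemma tcoord_variation_field:
  assumes "c \<in> A" "\<Gamma> 0 t \<in> cdom c" "continuous (at 0) (\<lambda>\<sigma>. \<Gamma> \<sigma> t)"
    and "((\<lambda>\<sigma>. cmap c (\<Gamma> \<sigma> t)) has_vector_derivative w) (at 0)"
  shows "tcoord A c (\<Gamma> 0 t) (variation_field \<Gamma> t) = w"
proof -
  have "(cmap (chart_at A (\<Gamma> 0 t)) \<circ> (\<lambda>\<sigma>. \<Gamma> \<sigma> t) has_vector_derivative jac c (chart_at A (\<Gamma> 0 t)) (\<Gamma> 0 t) w) (at 0)"
    by (rule curve_change_of_chart[where S=UNIV]) (use assms chart_at in \<open>auto simp: o_def\<close>)
  from vector_derivative_at[OF this] have "variation_field \<Gamma> t = tvec A c (\<Gamma> 0 t) w"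
    by (simp add: variation_field_def tvec_eq_jac)
  then show ?thesis
    using tcoord_tvec[OF assms(1,2)] by simp
qed

end

context lagrangian_action
begin

text \<open>The pairing of the momentum with the variation field, written through the limit of the
  momentum so that it makes sense at the corners of the curve, too; it vanishes at the end points
  since these are fixed.\<close>

definition boundary_term ::
    "real \<Rightarrow> real \<Rightarrow> (real \<Rightarrow> 'q) \<Rightarrow> (real \<Rightarrow> 'g) \<Rightarrow> (real \<Rightarrow> real \<Rightarrow> 'q) \<Rightarrow> real \<Rightarrow> real" where
  "boundary_term t0 t1 \<gamma> V \<Gamma> t = (if t \<in> {t0<..<t1} then
     blinfun_apply (Lim (at t) (\<lambda>\<tau>. momentum (\<gamma> \<tau>, V \<tau>))) (SOME X. \<psi> X (\<gamma> t) = variation_field \<Gamma> t) else 0)"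

text \<open>This is where the corner condition enters: the two-sided limit in
  \<open>boundary_term\<close> exists, so it equals the limit from within (a,b), which is the
  momentum of the one-sided velocity v. The formula thus holds up to a and b, and adjacent intervals
  share one boundary value. At t0 and t1 the variation is fixed and both sides are zero.\<close>

lemma boundary_term_in_chart:
  fixes \<gamma> :: "real \<Rightarrow> 'q"
  assumes EP: "Euler_Poincare A br t0 t1 \<gamma> V momentum (Omega A \<psi> L)"
    and compat: "compatible A \<psi> t0 t1 \<gamma> V"
    and var: "fixed_endpoint_variation A t0 t1 \<gamma> \<epsilon> \<Gamma>"
    and ab: "t0 \<le> a" "a < b" "b \<le> t1" and c: "c \<in> A" and e: "0 < e" "e \<le> \<epsilon>"
    and smooth: "smooth_map_on A ({a..b} \<times> {-e..e}) (\<lambda>(t, s). \<Gamma> s t)"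
    and dom: "\<And>t s. t \<in> {a..b} \<Longrightarrow> s \<in> {-e..e} \<Longrightarrow> \<Gamma> s t \<in> cdom c"
    and u: "smooth_on {a..b} (\<lambda>t. cmap c (\<Gamma> 0 t))"
    and v: "smooth_on {a..b} v"
      "\<And>t. t \<in> {a..b} \<Longrightarrow> ((\<lambda>\<tau>. cmap c (\<Gamma> 0 \<tau>)) has_vector_derivative v t) (at t within {a..b})"
    and w: "((\<lambda>\<sigma>. cmap c (\<Gamma> \<sigma> t)) has_vector_derivative w t) (at 0)"
    and t: "t \<in> {a..b}"
  shows "boundary_term t0 t1 \<gamma> V \<Gamma> t = frechet_derivative (lc c) (at (cmap c (\<Gamma> 0 t), v t)) (0, w t)"
proof -
  have \<Gamma>0: "\<Gamma> 0 \<tau> = \<gamma> \<tau>" if "\<tau> \<in> {t0..t1}" for \<tau>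
    using var that unfolding fixed_endpoint_variation_def by blast
  have tt: "t \<in> {t0..t1}"
    using t ab by auto
  have dom0: "\<Gamma> 0 \<tau> \<in> cdom c" if "\<tau> \<in> {a..b}" for \<tau>
    using dom[OF that, of 0] e by simp
  have near0: "eventually (\<lambda>\<sigma>. \<sigma> \<in> {-e<..<e}) (nhds 0)"
    using e by (intro eventually_nhds_in_open) auto
  note lin = linear_frechet_derivative_on(2)[OF open_chart_image[OF c] lc_smooth[OF c] imageI[OF dom0[OF t]]]
  show ?thesis
  proof (cases "t \<in> {t0<..<t1}")
    case False
    then have end_point: "t = t0 \<or> t = t1"
      using tt by auto
    have fixed: "\<Gamma> \<sigma> t = \<Gamma> 0 t" if "\<sigma> \<in> {-e<..<e}" for \<sigma>
    proof -
      have "\<sigma> \<in> {-\<epsilon>..\<epsilon>}" "0 \<in> {-\<epsilon>..\<epsilon>}"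
        using that e by auto
      then show ?thesis
        using var end_point unfolding fixed_endpoint_variation_def by auto
    qed
    have "eventually (\<lambda>\<sigma>. \<sigma> \<in> UNIV \<longrightarrow> cmap c (\<Gamma> \<sigma> t) = cmap c (\<Gamma> 0 t)) (nhds 0)"
      by (rule eventually_mono[OF near0]) (simp only: fixed simp_thms)
    from vector_derivative_cong_eq[OF this refl refl UNIV_I] have "w t = 0"
      using vector_derivative_at[OF w] by simp
    then show ?thesis
      using False linear_0[OF lin] by (auto simp: boundary_term_def)
  next
    case True
    have "continuous_on ({a..b} \<times> {-e..e}) (\<lambda>z. \<Gamma> (snd z) (fst z))"
      using smooth by (simp add: smooth_map_on_def split_beta)
    then have "continuous_on {-e<..<e} (\<lambda>\<sigma>. \<Gamma> (snd (t, \<sigma>)) (fst (t, \<sigma>)))"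
      by (rule continuous_on_compose2) (use t in \<open>auto intro!: continuous_intros\<close>)
    then have "continuous (at 0) (\<lambda>\<sigma>. \<Gamma> \<sigma> t)"
      using e by (simp add: continuous_on_eq_continuous_at)
    from tcoord_variation_field[of c \<Gamma> t "w t", OF c dom0[OF t] this w]
    have field: "tcoord A c (\<gamma> t) (variation_field \<Gamma> t) = w t"
      using \<Gamma>0[OF tt] by simp
    \<comment> \<open>Only the vector \<open>\<psi> X (\<gamma> t)\<close> matters in the pairing,
      so any choice will do; one exists by local transitivity.\<close>
    define X where "X = (SOME X. \<psi> X (\<gamma> t) = variation_field \<Gamma> t)"
    have X: "\<psi> X (\<gamma> t) = variation_field \<Gamma> t"
      unfolding X_def by (rule someI_ex) (metis transitive_obtain)
    have in\<gamma>: "\<tau> \<in> {t0..t1}" if "\<tau> \<in> {a..b}" for \<tau>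
      using that ab by auto
    have smooth\<gamma>: "smooth_map_on A {a..b} \<gamma>"
    proof (rule smooth_map_on_cong[OF smooth_map_on_cinv[OF c u]])
      show "(\<lambda>\<tau>. cmap c (\<Gamma> 0 \<tau>)) ` {a..b} \<subseteq> cmap c ` cdom c"
        using dom0 by blast
      fix \<tau> assume \<tau>: "\<tau> \<in> {a..b}"
      then show "cinv c (cmap c (\<Gamma> 0 \<tau>)) = \<gamma> \<tau>"
        using cinv_cmap[OF c dom0[OF \<tau>]] \<Gamma>0[OF in\<gamma>] by simp
    qed
    have dom\<gamma>: "\<gamma> ` {a..b} \<subseteq> cdom c"
    proof clarify
      fix \<tau> assume "\<tau> \<in> {a..b}"
      then show "\<gamma> \<tau> \<in> cdom c"
        using dom0 \<Gamma>0[OF in\<gamma>] by metis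
    qed
    have dv: "(cmap c \<circ> \<gamma> has_vector_derivative v \<tau>) (at \<tau> within {a..b})" if "\<tau> \<in> {a..b}" for \<tau>
      by (rule has_vector_derivative_transform[OF that _ v(2)[OF that]]) (simp only: o_apply \<Gamma>0[OF in\<gamma>])
    have t_dom: "\<gamma> t \<in> cdom c"
      using dom\<gamma> t by blast
    obtain X0 where X0: "tcoord A c (\<gamma> t) (\<psi> X0 (\<gamma> t)) = v t"
      by (rule action_preimage_coordinates[OF c t_dom])
    let ?M = "\<lambda>\<tau>. momentum (\<gamma> \<tau>, V \<tau>)"
    have lim: "(?M \<longlongrightarrow> momentum (\<gamma> t, X0)) (at t within {a<..<b})"
      by (rule momentum_limit[OF compat ab c smooth\<gamma> dom\<gamma> v(1) dv t X0])
    obtain \<mu> where \<mu>: "(?M \<longlongrightarrow> \<mu>) (at t)"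
      using EP True unfolding Euler_Poincare_def by blast
    \<comment> \<open>t may be an end point of the open interval; it is still a limit point of it,
      as uniqueness of the limit requires.\<close>
    have nontrivial: "at t within {a<..<b} \<noteq> bot"
    proof -
      consider "t = a" | "t = b" | "t \<in> {a<..<b}"
        using t by fastforce
      then have "t islimpt {a<..<b}"
        using ab(2) by cases (auto intro: islimpt_greaterThanLessThan1 islimpt_greaterThanLessThan2
            interior_limit_point simp: interior_open)
      then show ?thesis
        by (simp add: trivial_limit_within)
    qed
    have "\<mu> = momentum (\<gamma> t, X0)"
      by (rule tendsto_unique[OF nontrivial tendsto_within_subset[OF \<mu> subset_UNIV] lim])
    then have "Lim (at t) ?M = momentum (\<gamma> t, X0)"
      using tendsto_Lim[OF _ \<mu>] by simp
    then have "boundary_term t0 t1 \<gamma> V \<Gamma> t = blinfun_apply (momentum (\<gamma> t, X0)) X"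
      using True by (simp add: boundary_term_def X_def)
    also have "\<dots> = frechet_derivative (lc c) (at (cmap c (\<gamma> t), v t)) (0, w t)"
      using momentum_apply[OF c t_dom, of X0 X] X0 X field by simp
    finally show ?thesis
      using \<Gamma>0[OF tt] by simp
  qed
qed

text \<open>At a single time t any chart may be used, so a small interval is examined in the chart
  representing the tangent space at \<gamma>(t), where the two equations are equivalent. F is given
  as an s-derivative of L along the variation, without reference to a chart, and uniqueness of
  derivatives carries it over.\<close>

lemma boundary_term_derivative:
  fixes \<gamma> :: "real \<Rightarrow> 'q"
  assumes EP: "Euler_Poincare A br t0 t1 \<gamma> V momentum (Omega A \<psi> L)"
    and compat: "compatible A \<psi> t0 t1 \<gamma> V"
    and var: "fixed_endpoint_variation A t0 t1 \<gamma> \<epsilon> \<Gamma>"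
    and ab: "t0 \<le> a" "b \<le> t1" and e: "0 < e" "e \<le> \<epsilon>"
    and smooth: "smooth_map_on A ({a..b} \<times> {-e..e}) (\<lambda>(t, s). \<Gamma> s t)"
    and smooth\<gamma>: "smooth_map_on A {a..b} \<gamma>"
    and t: "t \<in> {a<..<b}"
    and F: "((\<lambda>\<sigma>. L (velocity A t0 t1 (\<Gamma> \<sigma>) t)) has_vector_derivative F) (at 0)"
  shows "(boundary_term t0 t1 \<gamma> V \<Gamma> has_vector_derivative F) (at t)"
proof -
  have \<epsilon>: "0 < \<epsilon>" and G: "continuous_on ({t0..t1} \<times> {-\<epsilon>..\<epsilon>}) (\<lambda>(t, s). \<Gamma> s t)"
    and \<Gamma>0: "\<And>\<tau>. \<tau> \<in> {t0..t1} \<Longrightarrow> \<Gamma> 0 \<tau> = \<gamma> \<tau>"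
    using var unfolding fixed_endpoint_variation_def by blast+
  have tt: "t \<in> {t0..t1}"
    using t ab by auto
  define c where "c = chart_at A (\<gamma> t)"
  have c: "c \<in> A" "\<gamma> t \<in> cdom c"
    using chart_at by (auto simp: c_def)
  obtain d where d: "0 < d" "d \<le> \<epsilon>"
    "\<And>\<tau> s. \<tau> \<in> {t0..t1} \<Longrightarrow> \<bar>\<tau> - t\<bar> \<le> d \<Longrightarrow> \<bar>s\<bar> \<le> d \<Longrightarrow> (\<lambda>(t, s). \<Gamma> s t) (\<tau>, s) \<in> cdom c"
    by (rule eventually_near_slice[OF G tt \<epsilon> open_cdom[OF c(1)]]) (use c(2) \<Gamma>0[OF tt] in auto)
  define a1 b1 e1 where "a1 = max a (t - d)" and "b1 = min b (t + d)" and "e1 = min d e"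
  have t1: "t \<in> {a1<..<b1}" and ab1: "t0 \<le> a1" "a1 < b1" "b1 \<le> t1" and e1: "0 < e1" "e1 \<le> \<epsilon>"
    and sub1: "{a1..b1} \<subseteq> {a..b}"
    using t ab d e by (auto simp: a1_def b1_def e1_def)
  have smooth1: "smooth_map_on A ({a1..b1} \<times> {-e1..e1}) (\<lambda>(t, s). \<Gamma> s t)"
    by (rule smooth_map_on_subset[OF smooth]) (auto simp: a1_def b1_def e1_def)
  have dom1: "\<Gamma> s \<tau> \<in> cdom c" if "\<tau> \<in> {a1..b1}" "s \<in> {-e1..e1}" for \<tau> s
    using d(3)[of \<tau> s] that ab by (auto simp: a1_def b1_def e1_def)
  show ?thesis
  proof (rule first_var_chart[OF ab1 c(1) e1(1) smooth1 dom1])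
    fix v w w'
    assume u: "smooth_on {a1..b1} (\<lambda>t. cmap c (\<Gamma> 0 t))" and v: "smooth_on {a1..b1} v"
      and dv: "\<And>t. t \<in> {a1..b1} \<Longrightarrow> ((\<lambda>\<tau>. cmap c (\<Gamma> 0 \<tau>)) has_vector_derivative v t) (at t within {a1..b1})"
      and w: "\<And>t. t \<in> {a1..b1} \<Longrightarrow> ((\<lambda>\<sigma>. cmap c (\<Gamma> \<sigma> t)) has_vector_derivative w t) (at 0)"
      and dw: "\<And>t. t \<in> {a1..b1} \<Longrightarrow> (w has_vector_derivative w' t) (at t within {a1..b1})"
      and vel: "\<And>t. t \<in> {a1<..<b1} \<Longrightarrow> velocity A t0 t1 (\<Gamma> 0) t = (\<Gamma> 0 t, tvec A c (\<Gamma> 0 t) (v t))"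
      and dL: "\<And>t. t \<in> {a1<..<b1} \<Longrightarrow> ((\<lambda>\<sigma>. L (velocity A t0 t1 (\<Gamma> \<sigma>) t)) has_vector_derivative
        frechet_derivative (lc c) (at (cmap c (\<Gamma> 0 t), v t)) (w t, w' t)) (at 0)"
    have dom0: "cmap c (\<Gamma> 0 \<tau>) \<in> cmap c ` cdom c" if "\<tau> \<in> {a1..b1}" for \<tau>
      using dom1[OF that, of 0] e1 by simp
    then have im: "(\<lambda>\<tau>. cmap c (\<Gamma> 0 \<tau>)) ` {a1..b1} \<subseteq> cmap c ` cdom c"
      by blast
    have F_eq: "F = frechet_derivative (lc c) (at (cmap c (\<Gamma> 0 t), v t)) (w t, w' t)"
      by (rule vector_derivative_unique_at[OF F dL[OF t1]])
    obtain p' where p': "\<And>t h. t \<in> {a1..b1} \<Longrightarrow> ((\<lambda>\<tau>. frechet_derivative (lc c) (at (cmap c (\<Gamma> 0 \<tau>), v \<tau>)) (0, h))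
          has_vector_derivative p' t h) (at t within {a1..b1})"
      by (rule momentum_derivative[OF ab1(2) open_chart_image[OF c(1)] lc_smooth[OF c(1)] u v im]) blast
    have t1': "t \<in> {a1..b1}"
      using t1 by auto
    have in\<gamma>: "\<tau> \<in> {t0..t1}" if "\<tau> \<in> {a1..b1}" for \<tau>
      using that ab1 by auto
    \<comment> \<open>The velocity formula is available inside (a1,b1), whereas the equivalence with
      the Euler-Lagrange equation wants compatibility on a closed interval around t.\<close>
    define a2 b2 where "a2 = (a1 + t) / 2" and "b2 = (t + b1) / 2"
    have ab2: "a2 < b2" "t \<in> {a2..b2}" and sub2: "{a2..b2} \<subseteq> {a1<..<b1}" "{a2..b2} \<subseteq> {a1..b1}"
      using t1 by (auto simp: a2_def b2_def)
    have within: "at t within {t0..t1} = at t" "at t within {a2..b2} = at t" "at t within {a1..b1} = at t"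
      using t1 ab1 by (auto intro!: at_within_interior simp: interior_atLeastAtMost_real a2_def b2_def)
    have EL: "p' t h = frechet_derivative (lc c) (at (cmap c (\<gamma> t), v t)) (h, 0)" for h
    proof -
      have dom2: "\<gamma> ` {a2..b2} \<subseteq> cdom c"
      proof clarify
        fix \<tau> assume "\<tau> \<in> {a2..b2}"
        then have \<tau>: "\<tau> \<in> {a1..b1}"
          using sub2 by blast
        show "\<gamma> \<tau> \<in> cdom c"
          using dom1[OF \<tau>, of 0] e1 \<Gamma>0[OF in\<gamma>[OF \<tau>]] by simp
      qed
      have "((\<lambda>\<tau>. cmap c (\<Gamma> 0 \<tau>)) has_vector_derivative v t) (at t within {a2..b2})"
        by (rule has_vector_derivative_within_subset[OF dv[OF t1'] sub2(2)])
      then have dv2: "(cmap c \<circ> \<gamma> has_vector_derivative v t) (at t within {a2..b2})"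
        by (rule has_vector_derivative_transform[OF ab2(2), rotated]) (use \<Gamma>0 in\<gamma> sub2 in auto)
      have V: "tcoord A c (\<gamma> \<tau>) (\<psi> (V \<tau>) (\<gamma> \<tau>)) = v \<tau>" if "\<tau> \<in> {a2..b2}" for \<tau>
      proof -
        have \<tau>: "\<tau> \<in> {a1<..<b1}" "\<tau> \<in> {a1..b1}"
          using that sub2 by blast+
        have "velocity A t0 t1 (\<Gamma> 0) \<tau> = velocity A t0 t1 \<gamma> \<tau>"
          by (rule velocity_local[of \<tau> a1 b1]) (use \<tau> in\<gamma> \<Gamma>0 in auto)
        then have "velocity A t0 t1 \<gamma> \<tau> = (\<gamma> \<tau>, tvec A c (\<gamma> \<tau>) (v \<tau>))"
          using vel[OF \<tau>(1)] \<Gamma>0[OF in\<gamma>[OF \<tau>(2)]] by simp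
        moreover have "smooth_at_time A t0 t1 \<gamma> \<tau>"
          by (rule smooth_at_time_interior[OF smooth_map_on_subset[OF smooth\<gamma> sub1] \<tau>(1)])
        moreover have "\<gamma> \<tau> \<in> cdom c"
          using dom2 that by blast
        ultimately show ?thesis
          by (intro compatible_coordinates[OF compat in\<gamma>[OF \<tau>(2)] _ c(1)])
      qed
      have p2: "((\<lambda>\<tau>. frechet_derivative (lc c) (at (cmap c (\<gamma> \<tau>), v \<tau>)) (0, h)) has_vector_derivative p' t h) (at t within {a2..b2})" for h
      proof -
        have "((\<lambda>\<tau>. frechet_derivative (lc c) (at (cmap c (\<Gamma> 0 \<tau>), v \<tau>)) (0, h)) has_vector_derivative p' t h) (at t within {a2..b2})"
          by (rule has_vector_derivative_within_subset[OF p'[OF t1'] sub2(2)])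
        then show ?thesis
          by (rule has_vector_derivative_transform[OF ab2(2), rotated]) (use \<Gamma>0 in\<gamma> sub2 in auto)
      qed
      have "smooth_at_time A t0 t1 \<gamma> t"
        by (rule smooth_at_time_interior[OF smooth\<gamma> t])
      then have "\<exists>D. ((\<lambda>\<tau>. momentum (\<gamma> \<tau>, V \<tau>)) has_vector_derivative D) (at t within {t0..t1}) \<and>
          D - ad_star br (V t) (momentum (\<gamma> t, V t)) = Omega A \<psi> L (\<gamma> t, V t)"
        using EP tt unfolding Euler_Poincare_def by blast
      then have "\<exists>D. ((\<lambda>\<tau>. momentum (\<gamma> \<tau>, V \<tau>)) has_vector_derivative D) (at t within {a2..b2}) \<and>
          D - ad_star br (V t) (momentum (\<gamma> t, V t)) = Omega A \<psi> L (\<gamma> t, V t)"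
        unfolding within(1,2) .
      then show ?thesis
        using Euler_Poincare_iff_Euler_Lagrange[OF ab2 c_def dom2 dv2 V p2] by blast
    qed
    have "((\<lambda>\<tau>. frechet_derivative (lc c) (at (cmap c (\<Gamma> 0 \<tau>), v \<tau>)) (0, w \<tau>)) has_vector_derivative
        p' t (w t) + frechet_derivative (lc c) (at (cmap c (\<Gamma> 0 t), v t)) (0, w' t)) (at t within {a1..b1})"
      by (rule has_vector_derivative_linear_pairing(1)[OF ab1(2) t1' _ p'[OF t1'] dw[OF t1']])
        (rule linear_frechet_derivative_on(2)[OF open_chart_image[OF c(1)] lc_smooth[OF c(1)] dom0])
    also have "p' t (w t) + frechet_derivative (lc c) (at (cmap c (\<Gamma> 0 t), v t)) (0, w' t) = F"
      unfolding EL F_eq \<Gamma>0[OF tt]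
      by (rule frechet_derivative_split[OF open_chart_image[OF c(1)] lc_smooth[OF c(1)] imageI[OF c(2)], symmetric])
    finally have "(boundary_term t0 t1 \<gamma> V \<Gamma> has_vector_derivative F) (at t within {a1..b1})"
      by (rule has_vector_derivative_transform[OF t1', rotated])
        (rule boundary_term_in_chart[where v=v and w=w, OF EP compat var ab1 c(1) e1 smooth1 dom1 u v dv w])
    then show ?thesis
      unfolding within .
  qed
qed

lemma Euler_Poincare_imp_extremal:
  fixes \<gamma> :: "real \<Rightarrow> 'q"
  assumes EP: "Euler_Poincare A br t0 t1 \<gamma> V momentum (Omega A \<psi> L)" and "t0 < t1"
    and compat: "compatible A \<psi> t0 t1 \<gamma> V"
  shows "extremal A L t0 t1 \<gamma>"
  unfolding extremal_def
proof (intro allI impI)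
  fix \<epsilon> \<Gamma> assume var: "fixed_endpoint_variation A t0 t1 \<gamma> \<epsilon> \<Gamma>"
  let ?B = "boundary_term t0 t1 \<gamma> V \<Gamma>"
  have \<Gamma>0: "\<Gamma> 0 \<tau> = \<gamma> \<tau>" if "\<tau> \<in> {t0..t1}" for \<tau>
    using var that unfolding fixed_endpoint_variation_def by blast
  have "\<exists>K. first_var t0 t1 \<Gamma> t0 t1 K \<and> K = ?B t1 - ?B t0"
  proof (rule first_var_Bolzano[where R="\<lambda>a b K. K = ?B b - ?B a", OF var])
    fix a b c and e :: real
    assume ab: "t0 \<le> a" "a < b" "b \<le> t1" and c: "c \<in> A" and e: "0 < e" "e \<le> \<epsilon>"
      and smooth: "smooth_map_on A ({a..b} \<times> {-e..e}) (\<lambda>(t, s). \<Gamma> s t)"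
      and dom: "\<And>t s. t \<in> {a..b} \<Longrightarrow> s \<in> {-e..e} \<Longrightarrow> \<Gamma> s t \<in> cdom c"
    show "\<exists>K. first_var t0 t1 \<Gamma> a b K \<and> K = ?B b - ?B a"
    proof (rule first_var_chart[OF ab c e(1) smooth dom])
      fix v w w'
      assume u: "smooth_on {a..b} (\<lambda>t. cmap c (\<Gamma> 0 t))" and v: "smooth_on {a..b} v"
        and dv: "\<And>t. t \<in> {a..b} \<Longrightarrow> ((\<lambda>\<tau>. cmap c (\<Gamma> 0 \<tau>)) has_vector_derivative v t) (at t within {a..b})"
        and w: "\<And>t. t \<in> {a..b} \<Longrightarrow> ((\<lambda>\<sigma>. cmap c (\<Gamma> \<sigma> t)) has_vector_derivative w t) (at 0)"
        and dw: "\<And>t. t \<in> {a..b} \<Longrightarrow> (w has_vector_derivative w' t) (at t within {a..b})"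
        and dL: "\<And>t. t \<in> {a<..<b} \<Longrightarrow> ((\<lambda>\<sigma>. L (velocity A t0 t1 (\<Gamma> \<sigma>) t)) has_vector_derivative
          frechet_derivative (lc c) (at (cmap c (\<Gamma> 0 t), v t)) (w t, w' t)) (at 0)"
        and fv: "first_var t0 t1 \<Gamma> a b
          (integral {a..b} (\<lambda>t. frechet_derivative (lc c) (at (cmap c (\<Gamma> 0 t), v t)) (w t, w' t)))"
      have dom0: "\<Gamma> 0 \<tau> \<in> cdom c" if "\<tau> \<in> {a..b}" for \<tau>
        using dom[OF that, of 0] e by simp
      then have im: "(\<lambda>\<tau>. cmap c (\<Gamma> 0 \<tau>)) ` {a..b} \<subseteq> cmap c ` cdom c"
        by blast
      obtain p' where p': "\<And>t h. t \<in> {a..b} \<Longrightarrow> ((\<lambda>\<tau>. frechet_derivative (lc c) (at (cmap c (\<Gamma> 0 \<tau>), v \<tau>)) (0, h))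
            has_vector_derivative p' t h) (at t within {a..b})"
        by (rule momentum_derivative[OF ab(2) open_chart_image[OF c] lc_smooth[OF c] u v im]) blast
      have smooth\<gamma>: "smooth_map_on A {a..b} \<gamma>"
      proof (rule smooth_map_on_cong[OF smooth_map_on_cinv[OF c u im]])
        fix \<tau> assume \<tau>: "\<tau> \<in> {a..b}"
        then show "cinv c (cmap c (\<Gamma> 0 \<tau>)) = \<gamma> \<tau>"
          using cinv_cmap[OF c dom0[OF \<tau>]] \<Gamma>0[of \<tau>] ab by simp
      qed
      have B: "?B t = frechet_derivative (lc c) (at (cmap c (\<Gamma> 0 t), v t)) (0, w t)" if "t \<in> {a..b}" for t
        by (rule boundary_term_in_chart[where v=v and w=w, OF EP compat var ab c e smooth dom u v dv w that]) (use that in auto)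
      have cont: "continuous_on {a..b} ?B"
      proof (rule continuous_on_eq)
        show "continuous_on {a..b} (\<lambda>t. frechet_derivative (lc c) (at (cmap c (\<Gamma> 0 t), v t)) (0, w t))"
          unfolding continuous_on_eq_continuous_within
        proof
          fix t assume t: "t \<in> {a..b}"
          show "continuous (at t within {a..b}) (\<lambda>t. frechet_derivative (lc c) (at (cmap c (\<Gamma> 0 t), v t)) (0, w t))"
            by (rule has_vector_derivative_continuous[OF has_vector_derivative_linear_pairing(1)[OF ab(2) t _ p'[OF t] dw[OF t]]])
              (rule linear_frechet_derivative_on(2)[OF open_chart_image[OF c] lc_smooth[OF c] imageI[OF dom0]])
        qed
      qed (simp add: B)
      \<comment> \<open>The derivative of the boundary term is known at interior points only, as a
        and b may be corners; its continuity up to the ends still allows the fundamental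
        theorem.\<close>
      have "((\<lambda>t. frechet_derivative (lc c) (at (cmap c (\<Gamma> 0 t), v t)) (w t, w' t)) has_integral ?B b - ?B a) {a..b}"
        by (rule fundamental_theorem_of_calculus_interior[OF less_imp_le[OF ab(2)] cont])
          (rule boundary_term_derivative[OF EP compat var ab(1,3) e smooth smooth\<gamma> _ dL])
      from integral_unique[OF this] show ?thesis
        using fv by metis
    qed
  qed (use \<open>t0 < t1\<close> in auto)
  moreover have "?B t0 = 0" "?B t1 = 0"
    by (simp_all add: boundary_term_def)
  ultimately show "((\<lambda>s. action_functional A L t0 t1 (\<Gamma> s)) has_real_derivative 0) (at 0)"
    unfolding first_var_def action_functional_def by simp
qed

end

theorem mainTheorem1:
  fixes A :: "('q::{t2_space,second_countable_topology}, 'e::euclidean_space) chart set"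
    and L :: "('q, 'e) tangent \<Rightarrow> real"
    and br :: "'g::euclidean_space \<Rightarrow> 'g \<Rightarrow> 'g"
    and \<psi> :: "'g \<Rightarrow> 'q \<Rightarrow> 'e"
  assumes "smooth_manifold A"
    and "smooth_on_TQ A L"
    and "lie_algebra br"
    and "lie_algebra_action A br \<psi>"
    and "locally_transitive \<psi>"
  shows "d_g (Lbar \<psi> L) = momentum_map \<psi> \<circ> Legendre L \<circ> phi \<psi> \<and>
         Omega A \<psi> L = momentum_map \<psi> \<circ> d_Q A (Lbar \<psi> L) \<and>
         (\<forall>t0 t1 (\<gamma> :: real \<Rightarrow> 'q) (V :: real \<Rightarrow> 'g).
           t0 < t1 \<and> piecewise_smooth_curve A t0 t1 \<gamma> \<and> piecewise_continuous_smooth t0 t1 V \<and>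
           compatible A \<psi> t0 t1 \<gamma> V \<longrightarrow>
           (extremal A L t0 t1 \<gamma> \<longleftrightarrow>
              Euler_Poincare A br t0 t1 \<gamma> V (d_g (Lbar \<psi> L)) (Omega A \<psi> L)) \<and>
           (Euler_Poincare A br t0 t1 \<gamma> V (d_g (Lbar \<psi> L)) (Omega A \<psi> L) \<longleftrightarrow>
              Euler_Poincare A br t0 t1 \<gamma> V
                (momentum_map \<psi> \<circ> Legendre L \<circ> phi \<psi>) (momentum_map \<psi> \<circ> d_Q A (Lbar \<psi> L))))"
proof -
  interpret lagrangian_action A L br \<psi>
    by unfold_locales (fact assms)+
  have "extremal A L t0 t1 \<gamma> \<longleftrightarrow> Euler_Poincare A br t0 t1 \<gamma> V (d_g (Lbar \<psi> L)) (Omega A \<psi> L)"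
    if "t0 < t1" "piecewise_smooth_curve A t0 t1 \<gamma>" "compatible A \<psi> t0 t1 \<gamma> V" for t0 t1 \<gamma> V
    unfolding d_g_Lbar
    using extremal_imp_Euler_Poincare[OF _ that] Euler_Poincare_imp_extremal[OF _ that(1,3)] by blast
  then show ?thesis
    using d_g_Lbar Omega_eq by simp
qed

end
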